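(* Let $\eta\in(1/2,1)$, let $x\in C^\eta([0,1])$ be real-valued, and let $\sigma:X\to X$ satisfy: (a) $\sigma$ is Gâteaux differentiable, with bounded and locally Lipschitz continuous Gâteaux derivative $\sigma'$ (i.e. $\sigma':X\to\mathscr{L}(X)$ is bounded and, for every $R>0$, Lipschitz continuous on $\{z\in X:\|z\|_X\le R\}$); (b) there exists $\alpha\in(0,1)$ with $\eta+\alpha>1$ such that the restriction of $\sigma$ to $X_\alpha$ maps $X_\alpha$ into itself, and there exist positive constants $L_\sigma^\alpha$, $\mathrm{Lip}_\sigma^\alpha$ and $\omega$ such that, for every $R>0$, $$\|\sigma(u)-\sigma(v)\|_{X_\alpha}\le\mathrm{Lip}_\sigma^\alpha(1+R)^\omega\|u-v\|_{X_\alpha}\quad\text{for all }u,v\in X_\alpha\text{ with }\|u\|_{X_\alpha},\|v\|_{X_\alpha}\le R,$$ and $\|\sigma(u)\|_{X_\alpha}\le L_\sigma^\alpha(1+\|u\|_{X_\alpha})$ for every $u\in X_\alpha$. Then, for every $\psi\in X_\theta$ with $\theta\ge0$, $\alpha\ge\theta$ and $\eta>\alpha+(1+\omega)(\alpha-\theta)$, there exists a unique mild solution $y$ to the problem $$dy(t)=Ay(t)\,dt+\sigma(y(t))\,dx(t),\quad t\in(0,1],\qquad y(0)=\psi,$$ which belongs to $Y^\alpha_{\theta-\alpha}(0,1)$.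
   Context: Standing assumptions. $X$ is a Banach space and $A:D(A)\subset X\to X$ is the generator of a semigroup $(S(t))_{t\ge0}$ of bounded linear operators on $X$ ($S(0)=I$, $S(t+s)=S(t)S(s)$; continuity of $t\mapsto S(t)x$ at $t=0$ is not required). For every $\lambda\in[0,2)$ there is a Banach space $X_\lambda$, with $X_0=X$ and $X_1=D(A)$, such that $X_\lambda$ is continuously embedded in $X_\beta$ whenever $\beta<\lambda$. For every $T>0$, every $0\le\zeta\le\lambda<2$ and every $\mu,\nu\in[0,1]$ with $\mu>\nu$ there are constants $L_{\zeta,\lambda,T},C_{\mu,\nu,T}>0$ with $\|S(t)\|_{\mathscr{L}(X_\zeta,X_\lambda)}\le L_{\zeta,\lambda,T}t^{-\lambda+\zeta}$ and $\|S(t)-I\|_{\mathscr{L}(X_\mu,X_\nu)}\le C_{\mu,\nu,T}t^{\mu-\nu}$ for every $t\in(0,T]$. Each $S(t)$, $t\ge0$, is injective. Notation. $[a,b]^n_<=\{a\le t_1\le\dots\le t_n\le b\}$, $(a,b]^n_<=\{a<t_1\le\dots\le t_n\le b\}$; $(\hat\delta_1f)(s,t)=f(t)-S(t-s)f(s)$. For $\beta,\gamma\ge0$: $\mathscr{C}^\beta([a,b]^2_<;X_\lambda)$ is the set of continuous $f:[a,b]^2_<\to X_\lambda$ with $f(s,s)=0$ for all $s$ and $\sup_{a\le s<t\le b}\|f(s,t)\|_{X_\lambda}(t-s)^{-\beta}<\infty$; $\mathscr{C}_{-\gamma}((a,b];X_\lambda)$ is the set of continuous $f:(a,b]\to X_\lambda$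 with $\sup_{t\in(a,b]}(t-a)^\gamma\|f(t)\|_{X_\lambda}<\infty$, and $C_b((a,b];X_\lambda)=\mathscr{C}_0((a,b];X_\lambda)$; $\mathscr{C}^\beta_{-\gamma}((a,b]^2_<;X_\lambda)$ is the set of continuous $f:(a,b]^2_<\to X_\lambda$ with $f(s,s)=0$ for all $s$ and $\sup_{a<s<t\le b}(s-a)^\gamma\|f(s,t)\|_{X_\lambda}(t-s)^{-\beta}<\infty$; the suprema are the norms. For $\alpha>0$, $\gamma\ge0$, $Y^\alpha_{-\gamma}(0,1)$ is the set of functions $f:[0,1]\to X$ whose restriction to $(0,1]$ belongs to $\mathscr{C}_{-\gamma}((0,1];X_\alpha)\cap C_b((0,1];X)$ and such that $\hat\delta_1f\in\mathscr{C}^\alpha([0,1]^2_<;X_\alpha)$; its norm is the sum of the three corresponding norms. Thus $Y^\alpha_{\theta-\alpha}(0,1)$ is this space with $\gamma=\alpha-\theta$. Convolution integral. Let $x\in C^\eta([a,b])$ and $\varphi:(a,b]\to X$. The convolution integral $\mathscr{I}_{S,\varphi}$ is well defined if there are $\alpha',\beta'\in[0,2)$ with $0\le\alpha'-\beta'<1$, $\rho\in(1-\eta,1)$ and $\gamma'\in[0,\eta\wedge(\rho+\eta+\beta'-\alpha'))$ with $\varphi\in\mathscr{C}_{-\gamma'}((a,b];X_{\alpha'})$ and $\hat\delta_1\varphi\in\mathscr{C}^\rho_{-\gamma'}((a,b]^2_<;X_{\beta'})$. In this case there is a unique $M:(a,b]^2_<\to X$ that belongs to $\mathscr{C}^{\eta+\rho}([a+\vartheta,b]^2_<;X_{\beta'})$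 for every $\vartheta\in(0,b-a)$ and satisfies $M(r,t)-M(s,t)-S(t-s)M(r,s)=-(x(t)-x(s))S(t-s)(\hat\delta_1\varphi)(r,s)$ on $(a,b]^3_<$; one sets $\mathscr{I}_{S,\varphi}(s,t)=\int_s^tS(t-r)\varphi(r)\,dx(r):=(x(t)-x(s))S(t-s)\varphi(s)-M(s,t)$ on $(a,b]^2_<$, extended by continuity (in $X$) to $[a,b]^2_<$. Mild solution. A mild solution on $[0,1]$ is a function $y:[0,1]\to X$ such that $\mathscr{I}_{S,\sigma\circ y}$ is well defined on $[0,1]^2_<$ and $y(t)=S(t)\psi+\mathscr{I}_{S,\sigma\circ y}(0,t)$ for every $t\in[0,1]$. *)

theory Defs
  imports "HOL-Analysis.Analysis"
begin

text \<open>
  A Banach space continuously embedded in the ambient space is represented by a linear subspace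
  \<open>V\<close> of the ambient type together with a complete norm \<open>n\<close>, of which only the values on \<open>V\<close> matter.
\<close>

definition banach_subspace :: "'a::real_vector set \<Rightarrow> ('a \<Rightarrow> real) \<Rightarrow> bool" where
  "banach_subspace V n \<longleftrightarrow>
     subspace V \<and>
     (\<forall>u\<in>V. 0 \<le> n u \<and> (n u = 0 \<longleftrightarrow> u = 0)) \<and>
     (\<forall>u\<in>V. \<forall>c. n (c *\<^sub>R u) = \<bar>c\<bar> * n u) \<and>
     (\<forall>u\<in>V. \<forall>v\<in>V. n (u + v) \<le> n u + n v) \<and>
     (\<forall>f::nat \<Rightarrow> 'a. range f \<subseteq> V \<longrightarrow>
        (\<forall>e>0. \<exists>k. \<forall>i\<ge>k. \<forall>j\<ge>k. n (f i - f j) < e) \<longrightarrow>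
        (\<exists>l\<in>V. (\<lambda>i. n (f i - l)) \<longlonglongrightarrow> 0))"

definition continuous_into ::
    "'b::topological_space set \<Rightarrow> 'a::real_vector set \<Rightarrow> ('a \<Rightarrow> real) \<Rightarrow> ('b \<Rightarrow> 'a) \<Rightarrow> bool" where
  "continuous_into T V n f \<longleftrightarrow>
     f ` T \<subseteq> V \<and> (\<forall>p\<in>T. ((\<lambda>q. n (f q - f p)) \<longlongrightarrow> 0) (at p within T))"

text \<open>
  For a semigroup that need not be strongly continuous at \<open>0\<close>, the generator is the operator whose
  resolvent is the Laplace transform of the semigroup (the limit of the difference quotients at \<open>0\<close>
  would only give its part in the closure of its domain). For strongly continuous semigroups this is
  the usual infinitesimal generator.
\<close>

definition is_generator ::
    "'a::banach set \<Rightarrow> ('a \<Rightarrow> 'a) \<Rightarrow> (real \<Rightarrow> 'a \<Rightarrow> 'a) \<Rightarrow> bool" where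
  "is_generator D A S \<longleftrightarrow>
     subspace D \<and>
     (\<forall>u\<in>D. \<forall>v\<in>D. A (u + v) = A u + A v) \<and>
     (\<forall>u\<in>D. \<forall>c. A (c *\<^sub>R u) = c *\<^sub>R A u) \<and>
     (\<exists>w. \<forall>l>w.
        bij_betw (\<lambda>u. l *\<^sub>R u - A u) D UNIV \<and>
        (\<forall>u\<in>D. ((\<lambda>t. exp (- (l * t)) *\<^sub>R S t (l *\<^sub>R u - A u)) has_integral u) {0..}))"

text \<open>
  \<open>Xs l\<close> and \<open>N l\<close> are the carrier and the norm of the space of index \<open>l\<close>. Operator norm bounds are
  written out pointwise. Only the carrier of \<open>Xs 1\<close> is prescribed: since \<open>A\<close> is closed and \<open>Xs 1\<close> is
  complete and continuously embedded, \<open>N 1\<close> is then equivalent to the graph norm of \<open>A\<close> by the closed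
  graph theorem.
\<close>

locale semigroup_scale =
  fixes D :: "'a::banach set"
    and A :: "'a \<Rightarrow> 'a"
    and S :: "real \<Rightarrow> 'a \<Rightarrow> 'a"
    and Xs :: "real \<Rightarrow> 'a set"
    and N :: "real \<Rightarrow> 'a \<Rightarrow> real"
  assumes S_bounded_linear: "\<And>t. 0 \<le> t \<Longrightarrow> bounded_linear (S t)"
    and S_zero: "\<And>u. S 0 u = u"
    and S_add: "\<And>s t u. 0 \<le> s \<Longrightarrow> 0 \<le> t \<Longrightarrow> S (t + s) u = S t (S s u)"
    and S_inj: "\<And>t. 0 \<le> t \<Longrightarrow> inj (S t)"
    and generator: "is_generator D A S"
    and banach: "\<And>l. 0 \<le> l \<Longrightarrow> l < 2 \<Longrightarrow> banach_subspace (Xs l) (N l)"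
    and X_zero: "Xs 0 = UNIV" "\<And>u. N 0 u = norm u"
    and X_one: "Xs 1 = D"
    and embedding: "\<And>b l. 0 \<le> b \<Longrightarrow> b < l \<Longrightarrow> l < 2 \<Longrightarrow>
      Xs l \<subseteq> Xs b \<and> (\<exists>K. \<forall>u\<in>Xs l. N b u \<le> K * N l u)"
    and S_smoothing: "\<And>T z l. 0 < T \<Longrightarrow> 0 \<le> z \<Longrightarrow> z \<le> l \<Longrightarrow> l < 2 \<Longrightarrow>
      \<exists>L>0. \<forall>t. 0 < t \<and> t \<le> T \<longrightarrow>
        (\<forall>u\<in>Xs z. S t u \<in> Xs l \<and> N l (S t u) \<le> L * t powr (- l + z) * N z u)"
    and S_minus_id: "\<And>T m n. 0 < T \<Longrightarrow> 0 \<le> n \<Longrightarrow> n < m \<Longrightarrow> m \<le> 1 \<Longrightarrow>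
      \<exists>C>0. \<forall>t. 0 < t \<and> t \<le> T \<longrightarrow>
        (\<forall>u\<in>Xs m. S t u - u \<in> Xs n \<and> N n (S t u - u) \<le> C * t powr (m - n) * N m u)"

definition simplex2 :: "real \<Rightarrow> real \<Rightarrow> (real \<times> real) set" where
  "simplex2 a b = {(s, t). a \<le> s \<and> s \<le> t \<and> t \<le> b}"

definition lopen_simplex2 :: "real \<Rightarrow> real \<Rightarrow> (real \<times> real) set" where
  "lopen_simplex2 a b = {(s, t). a < s \<and> s \<le> t \<and> t \<le> b}"

definition hdelta :: "(real \<Rightarrow> 'a \<Rightarrow> 'a) \<Rightarrow> (real \<Rightarrow> 'a) \<Rightarrow> real \<Rightarrow> real \<Rightarrow> 'a::real_vector" where
  "hdelta S f s t = f t - S (t - s) (f s)"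

definition holder_real :: "real \<Rightarrow> real \<Rightarrow> real \<Rightarrow> (real \<Rightarrow> real) set" where
  "holder_real \<eta> a b =
     {x. \<exists>C. \<forall>s\<in>{a..b}. \<forall>t\<in>{a..b}. \<bar>x t - x s\<bar> \<le> C * \<bar>t - s\<bar> powr \<eta>}"

text \<open>
  The next three sets are \<open>C\<^sup>\<beta>([a,b]\<^sup>2; V)\<close>, \<open>C\<^sub>-\<^sub>\<gamma>((a,b]; V)\<close> and \<open>C\<^sup>\<beta>\<^sub>-\<^sub>\<gamma>((a,b]\<^sup>2; V)\<close> (on simplices),
  where \<open>V\<close> carries the norm \<open>n\<close>. Functions are total; only their values on the indicated domain matter.
\<close>

definition C2 ::
    "real \<Rightarrow> real \<Rightarrow> real \<Rightarrow> 'a::real_vector set \<Rightarrow> ('a \<Rightarrow> real) \<Rightarrow> (real \<Rightarrow> real \<Rightarrow> 'a) set" where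
  "C2 \<beta> a b V n =
     {f. continuous_into (simplex2 a b) V n (\<lambda>(s, t). f s t) \<and>
         (\<forall>s\<in>{a..b}. f s s = 0) \<and>
         bdd_above {n (f s t) * (t - s) powr (- \<beta>) | s t. a \<le> s \<and> s < t \<and> t \<le> b}}"

definition C1_weighted ::
    "real \<Rightarrow> real \<Rightarrow> real \<Rightarrow> 'a::real_vector set \<Rightarrow> ('a \<Rightarrow> real) \<Rightarrow> (real \<Rightarrow> 'a) set" where
  "C1_weighted \<gamma> a b V n =
     {f. continuous_into {a<..b} V n f \<and>
         bdd_above {(t - a) powr \<gamma> * n (f t) | t. a < t \<and> t \<le> b}}"

definition C2_weighted ::
    "real \<Rightarrow> real \<Rightarrow> real \<Rightarrow> real \<Rightarrow> 'a::real_vector set \<Rightarrow> ('a \<Rightarrow> real) \<Rightarrow>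
      (real \<Rightarrow> real \<Rightarrow> 'a) set" where
  "C2_weighted \<beta> \<gamma> a b V n =
     {f. continuous_into (lopen_simplex2 a b) V n (\<lambda>(s, t). f s t) \<and>
         (\<forall>s\<in>{a<..b}. f s s = 0) \<and>
         bdd_above {(s - a) powr \<gamma> * n (f s t) * (t - s) powr (- \<beta>) | s t.
                      a < s \<and> s < t \<and> t \<le> b}}"

text \<open>\<open>Y_space S Xs N \<alpha> \<gamma>\<close> is the space \<open>Y\<^sup>\<alpha>\<^sub>-\<^sub>\<gamma>(0,1)\<close>.\<close>

definition Y_space ::
    "(real \<Rightarrow> 'a \<Rightarrow> 'a) \<Rightarrow> (real \<Rightarrow> 'a set) \<Rightarrow> (real \<Rightarrow> 'a \<Rightarrow> real) \<Rightarrow> real \<Rightarrow> real \<Rightarrow>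
      (real \<Rightarrow> 'a::real_vector) set" where
  "Y_space S Xs N \<alpha> \<gamma> =
     {f. f \<in> C1_weighted \<gamma> 0 1 (Xs \<alpha>) (N \<alpha>) \<and>
         f \<in> C1_weighted 0 0 1 (Xs 0) (N 0) \<and>
         hdelta S f \<in> C2 \<alpha> 0 1 (Xs \<alpha>) (N \<alpha>)}"

definition conv_admissible ::
    "(real \<Rightarrow> 'a \<Rightarrow> 'a) \<Rightarrow> (real \<Rightarrow> 'a set) \<Rightarrow> (real \<Rightarrow> 'a \<Rightarrow> real) \<Rightarrow> real \<Rightarrow> real \<Rightarrow> real \<Rightarrow>
      (real \<Rightarrow> 'a::real_vector) \<Rightarrow> real \<Rightarrow> real \<Rightarrow> real \<Rightarrow> real \<Rightarrow> bool" where
  "conv_admissible S Xs N \<eta> a b \<phi> \<alpha>' \<beta>' \<rho> \<gamma>' \<longleftrightarrow>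
     0 \<le> \<alpha>' \<and> \<alpha>' < 2 \<and> 0 \<le> \<beta>' \<and> \<beta>' < 2 \<and>
     0 \<le> \<alpha>' - \<beta>' \<and> \<alpha>' - \<beta>' < 1 \<and>
     1 - \<eta> < \<rho> \<and> \<rho> < 1 \<and>
     0 \<le> \<gamma>' \<and> \<gamma>' < min \<eta> (\<rho> + \<eta> + \<beta>' - \<alpha>') \<and>
     \<phi> \<in> C1_weighted \<gamma>' a b (Xs \<alpha>') (N \<alpha>') \<and>
     hdelta S \<phi> \<in> C2_weighted \<rho> \<gamma>' a b (Xs \<beta>') (N \<beta>')"

definition conv_well_defined ::
    "(real \<Rightarrow> 'a \<Rightarrow> 'a) \<Rightarrow> (real \<Rightarrow> 'a set) \<Rightarrow> (real \<Rightarrow> 'a \<Rightarrow> real) \<Rightarrow> real \<Rightarrow> real \<Rightarrow> real \<Rightarrow>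
      (real \<Rightarrow> 'a::real_vector) \<Rightarrow> bool" where
  "conv_well_defined S Xs N \<eta> a b \<phi> \<longleftrightarrow>
     (\<exists>\<alpha>' \<beta>' \<rho> \<gamma>'. conv_admissible S Xs N \<eta> a b \<phi> \<alpha>' \<beta>' \<rho> \<gamma>')"

text \<open>
  The remainder \<open>M\<close> is determined on the simplex \<open>a < s \<le> t \<le> b\<close>, and does not depend on the choice
  of the admissible exponents, because two remainders differ by a function with vanishing increments
  and Hoelder exponent larger than \<open>1\<close>.
\<close>

definition conv_remainder ::
    "(real \<Rightarrow> 'a \<Rightarrow> 'a) \<Rightarrow> (real \<Rightarrow> 'a set) \<Rightarrow> (real \<Rightarrow> 'a \<Rightarrow> real) \<Rightarrow> real \<Rightarrow> (real \<Rightarrow> real) \<Rightarrow>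
      real \<Rightarrow> real \<Rightarrow> (real \<Rightarrow> 'a::real_vector) \<Rightarrow> (real \<Rightarrow> real \<Rightarrow> 'a) \<Rightarrow> bool" where
  "conv_remainder S Xs N \<eta> x a b \<phi> M \<longleftrightarrow>
     (\<exists>\<alpha>' \<beta>' \<rho> \<gamma>'. conv_admissible S Xs N \<eta> a b \<phi> \<alpha>' \<beta>' \<rho> \<gamma>' \<and>
        (\<forall>\<theta>. 0 < \<theta> \<and> \<theta> < b - a \<longrightarrow> M \<in> C2 (\<eta> + \<rho>) (a + \<theta>) b (Xs \<beta>') (N \<beta>'))) \<and>
     (\<forall>r s t. a < r \<and> r \<le> s \<and> s \<le> t \<and> t \<le> b \<longrightarrow>
        M r t - M s t - S (t - s) (M r s) = - ((x t - x s) *\<^sub>R S (t - s) (hdelta S \<phi> r s)))"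

definition conv_open ::
    "(real \<Rightarrow> 'a \<Rightarrow> 'a) \<Rightarrow> (real \<Rightarrow> 'a set) \<Rightarrow> (real \<Rightarrow> 'a \<Rightarrow> real) \<Rightarrow> real \<Rightarrow> (real \<Rightarrow> real) \<Rightarrow>
      real \<Rightarrow> real \<Rightarrow> (real \<Rightarrow> 'a::real_vector) \<Rightarrow> real \<Rightarrow> real \<Rightarrow> 'a" where
  "conv_open S Xs N \<eta> x a b \<phi> s t =
     (x t - x s) *\<^sub>R S (t - s) (\<phi> s) - (SOME M. conv_remainder S Xs N \<eta> x a b \<phi> M) s t"

text \<open>
  The convolution integral of \<open>S (t - r) (\<phi> r)\<close> against \<open>x\<close> over \<open>[s,t]\<close>, extended by continuity in
  the ambient space from \<open>a < s\<close> to \<open>s = a\<close>.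
\<close>

definition conv_integral ::
    "(real \<Rightarrow> 'a \<Rightarrow> 'a) \<Rightarrow> (real \<Rightarrow> 'a set) \<Rightarrow> (real \<Rightarrow> 'a \<Rightarrow> real) \<Rightarrow> real \<Rightarrow> (real \<Rightarrow> real) \<Rightarrow>
      real \<Rightarrow> real \<Rightarrow> (real \<Rightarrow> 'a::real_normed_vector) \<Rightarrow> real \<Rightarrow> real \<Rightarrow> 'a" where
  "conv_integral S Xs N \<eta> x a b \<phi> s t =
     (if s = a
      then Lim (at (a, t) within lopen_simplex2 a b) (\<lambda>(s', t'). conv_open S Xs N \<eta> x a b \<phi> s' t')
      else conv_open S Xs N \<eta> x a b \<phi> s t)"

definition mild_solution ::
    "(real \<Rightarrow> 'a \<Rightarrow> 'a) \<Rightarrow> (real \<Rightarrow> 'a set) \<Rightarrow> (real \<Rightarrow> 'a \<Rightarrow> real) \<Rightarrow> real \<Rightarrow> (real \<Rightarrow> real) \<Rightarrow>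
      ('a \<Rightarrow> 'a) \<Rightarrow> 'a \<Rightarrow> (real \<Rightarrow> 'a::real_normed_vector) \<Rightarrow> bool" where
  "mild_solution S Xs N \<eta> x \<sigma> \<psi> y \<longleftrightarrow>
     conv_well_defined S Xs N \<eta> 0 1 (\<sigma> \<circ> y) \<and>
     (\<forall>t\<in>{0..1}. y t = S t \<psi> + conv_integral S Xs N \<eta> x 0 1 (\<sigma> \<circ> y) 0 t)"

definition has_gateaux_derivative ::
    "('a::real_normed_vector \<Rightarrow> 'a) \<Rightarrow> ('a \<Rightarrow> 'a \<Rightarrow>\<^sub>L 'a) \<Rightarrow> bool" where
  "has_gateaux_derivative \<sigma> \<sigma>' \<longleftrightarrow>
     (\<forall>u h. ((\<lambda>r. \<sigma> (u + r *\<^sub>R h)) has_vector_derivative blinfun_apply (\<sigma>' u) h) (at 0))"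

end

theory Submission
  imports Defs "HOL-Analysis.Analysis"
begin

text \<open>
  The remainder of the convolution integral of \<open>\<sigma> \<circ> y\<close> along a solution \<open>y\<close> is
  \<open>(x t - x s) S(t - s) \<sigma>(y s) - y t + S(t - s) (y s)\<close>, and its defining relation holds for every \<open>y\<close>. So
  \<open>y\<close> is a mild solution iff this expression is \<open>O((t - s)\<^sup>\<eta>\<^sup>+\<^sup>\<alpha>)\<close> away from \<open>0\<close> and
  \<open>y t - S t \<psi>\<close> tends to \<open>0\<close>, and solutions can be handled through estimates alone.

  For a fixed final time \<open>t\<close> the map \<open>r \<mapsto> S(t - r) (\<phi> r)\<close> is \<open>\<alpha>\<close>-Hoelder in \<open>X\<close>, hence the integral is an
  ordinary Young integral. Halving \<open>[s, t]\<close> towards \<open>t\<close> and smoothing each piece with the semigroup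
  turns the sewing bound in \<open>X\<close> into a bound \<open>s\<^sup>-\<^sup>\<gamma> (t - s)\<^sup>\<eta>\<close> in \<open>X\<^sub>\<alpha>\<close>, where
  \<open>\<gamma> = \<alpha> - \<theta>\<close>; halving towards \<open>0\<close> gives \<open>t\<^sup>\<eta>\<^sup>-\<^sup>\<gamma>\<close>. As \<open>\<eta> - \<gamma> > \<alpha>\<close> this gains a power of
  the length of the time interval, so Picard iteration converges on short intervals; for differences
  the weight is \<open>(1 + \<omega>) \<gamma>\<close>. Since \<open>\<sigma>\<close> grows linearly in \<open>X\<^sub>\<alpha>\<close> and is Lipschitz in \<open>X\<close>, solutions
  satisfy an a priori bound in \<open>X\<^sub>\<alpha>\<close>, and the local solutions continue to \<open>[0, 1]\<close>.
\<close>

subsection \<open>Sewing and Young integration\<close>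

text \<open>The semigroup need not be continuous at time 0, so \<open>S t \<psi>\<close> need not
  approach \<psi>. Hence the initial condition is that \<open>y t - S t \<psi>\<close> tends to 0,
  and continuity statements rest on smoothing at positive times. Many estimates share one device:
  some finite, uncontrolled constant \<open>Z\<close> is admissible, and an argument turns any
  admissible \<open>Z\<close> into \<open>a + q * Z\<close> with \<open>q < 1\<close>; iteration
  leaves \<open>a / (1 - q)\<close> and forgets the initial constant. The sewing bound, uniqueness
  (with \<open>a = 0\<close>) and the a priori bound are instances, which is why a solution may
  carry an arbitrary constant \<open>R\<close>. The weight \<open>s powr - \<gamma>\<close> stems
  from the free orbit of \<psi>. The integral part and differences of solutions with the same \<psi>
  are unweighted, and at positive times a solution lies in the scale space; so existence needs the
  weight on one short initial interval only.\<close>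

lemma geometric_contraction:
  fixes P :: "real \<Rightarrow> bool"
  assumes "P Z" "0 \<le> Z" "0 \<le> a" "0 \<le> q" "q < 1"
    and step: "\<And>Z. 0 \<le> Z \<Longrightarrow> P Z \<Longrightarrow> P (a + q * Z)"
  shows "P (a / (1 - q) + q ^ n * (Z - a / (1 - q)))"
proof -
  \<comment> \<open>Closed form of the \<open>n\<close>-th iterate of
    \<open>Z \<mapsto> a + q * Z\<close>, written around its fixed point. Its sign has to be
    tracked, because \<open>step\<close> accepts nonnegative constants only.\<close>
  let ?f = "\<lambda>n. a / (1 - q) + q ^ n * (Z - a / (1 - q))"
  have nonneg: "0 \<le> ?f n" for n
  proof -
    have "?f n = a / (1 - q) * (1 - q ^ n) + q ^ n * Z"
      by (simp add: algebra_simps diff_divide_distrib)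
    moreover have "0 \<le> 1 - q ^ n"
      using assms by (simp add: power_le_one)
    ultimately show ?thesis
      using assms by (metis add_nonneg_nonneg diff_ge_0_iff_ge divide_nonneg_nonneg less_imp_le
          mult_nonneg_nonneg zero_le_power)
  qed
  show ?thesis
  proof (induction n)
    case 0
    then show ?case using assms by simp
  next
    case (Suc n)
    define b where "b = a / (1 - q)"
    have "a = b * (1 - q)" using assms by (simp add: b_def)
    then have "a + q * ?f n = ?f (Suc n)"
      unfolding b_def[symmetric] by (simp add: algebra_simps)
    then show ?case
      using step[OF nonneg Suc] by simp
  qed
qed

lemma geometric_contraction_tendsto:
  fixes q :: real
  assumes "0 \<le> q" "q < 1"
  shows "(\<lambda>n. b + q ^ n * c) \<longlonglongrightarrow> b"
proof -
  have "(\<lambda>n. b + q ^ n * c) \<longlonglongrightarrow> b + 0 * c"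
    using assms by (intro tendsto_intros LIMSEQ_power_zero) auto
  then show ?thesis by simp
qed

text \<open>A crude bound suffices: comparing the interval with its two halves contracts the constant,
  so the supremum of the normalised increments is controlled by the defect alone.\<close>

lemma sewing_bound:
  fixes R :: "real \<Rightarrow> real \<Rightarrow> 'a::real_normed_vector"
  assumes p: "1 < p"
    and K: "0 \<le> K"
    and crude: "\<And>s t. a \<le> s \<Longrightarrow> s \<le> t \<Longrightarrow> t \<le> b \<Longrightarrow> norm (R s t) \<le> C * (t - s) powr p"
    and defect: "\<And>s m t. a \<le> s \<Longrightarrow> t \<le> b \<Longrightarrow> m - s = t - m \<Longrightarrow> s \<le> m \<Longrightarrow>
      norm (R s t - R s m - R m t) \<le> K * (t - s) powr p"
    and st: "a \<le> s" "s \<le> t" "t \<le> b"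
  shows "norm (R s t) \<le> K / (1 - 2 powr (1 - p)) * (t - s) powr p"
proof -
  \<comment> \<open>Each half of an interval carries the factor \<open>2 powr - p\<close>; both
    together give \<open>q\<close>, which is below 1 exactly because \<open>1 < p\<close>.\<close>
  define q where "q = 2 powr (1 - p)"
  have q: "0 \<le> q" "q < 1"
    using p by (auto simp: q_def powr_less_one)
  define P where "P = (\<lambda>Z. \<forall>s t. a \<le> s \<and> s \<le> t \<and> t \<le> b \<longrightarrow> norm (R s t) \<le> Z * (t - s) powr p)"
  have "P \<bar>C\<bar>"
    unfolding P_def
  proof (intro allI impI)
    fix s t assume "a \<le> s \<and> s \<le> t \<and> t \<le> b"
    then have "norm (R s t) \<le> C * (t - s) powr p" using crude by blast
    also have "\<dots> \<le> \<bar>C\<bar> * (t - s) powr p" by (intro mult_right_mono) auto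
    finally show "norm (R s t) \<le> \<bar>C\<bar> * (t - s) powr p" .
  qed
  moreover have "P (K + q * Z)" if "P Z" "0 \<le> Z" for Z
    unfolding P_def
  proof (intro allI impI)
    fix s t assume st: "a \<le> s \<and> s \<le> t \<and> t \<le> b"
    define m where "m = (s + t) / 2"
    have m: "m - s = t - m" "s \<le> m" "m \<le> t" "m - s = (t - s) / 2"
      using st by (auto simp: m_def field_simps)
    have "((t - s) / 2) powr p = 2 powr (- p) * (t - s) powr p"
      using st by (simp add: powr_divide powr_minus field_simps)
    then have half: "(m - s) powr p = 2 powr (- p) * (t - s) powr p"
      "(t - m) powr p = 2 powr (- p) * (t - s) powr p"
      using m by (metis, metis)
    have "norm (R s t) \<le> norm (R s t - R s m - R m t) + norm (R s m) + norm (R m t)"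
      by (smt (verit) norm_triangle_ineq diff_add_cancel diff_diff_eq2 norm_triangle_sub)
    also have "\<dots> \<le> K * (t - s) powr p + Z * (m - s) powr p + Z * (t - m) powr p"
      using that(1) st m unfolding P_def by (intro add_mono defect) auto
    also have "\<dots> = (K + q * Z) * (t - s) powr p"
      unfolding half by (simp add: q_def powr_diff powr_minus field_simps)
    finally show "norm (R s t) \<le> (K + q * Z) * (t - s) powr p" .
  qed
  ultimately have "\<And>n. P (K / (1 - q) + q ^ n * (\<bar>C\<bar> - K / (1 - q)))"
    using geometric_contraction[of P "\<bar>C\<bar>" K q] K q by auto
  then have *: "norm (R s t) \<le> (K / (1 - q) + q ^ n * (\<bar>C\<bar> - K / (1 - q))) * (t - s) powr p" for n
    using st unfolding P_def by blast
  have "norm (R s t) \<le> K / (1 - q) * (t - s) powr p"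
    by (rule LIMSEQ_le_const[OF tendsto_mult_right[OF geometric_contraction_tendsto[OF q]]])
      (use * in blast)
  then show ?thesis by (simp add: q_def)
qed

section \<open>Hoelder functions and their Steklov means\<close>

lemma powr_tendsto_zero:
  fixes e :: real
  assumes "0 < e"
  shows "((\<lambda>t. \<bar>t - s\<bar> powr e) \<longlongrightarrow> 0) (at s within A)"
proof -
  have "((\<lambda>t. \<bar>t - s\<bar> powr e) \<longlongrightarrow> \<bar>s - s\<bar> powr e) (at s within A)"
    using assms by (intro tendsto_powr' tendsto_intros) auto
  then show ?thesis by simp
qed

lemma holder_continuous_on:
  fixes g :: "real \<Rightarrow> 'a::real_normed_vector"
  assumes "0 < e" and "\<And>s t. s \<in> A \<Longrightarrow> t \<in> A \<Longrightarrow> s \<le> t \<Longrightarrow> norm (g t - g s) \<le> G * (t - s) powr e"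
  shows "continuous_on A g"
  unfolding continuous_on_def
proof
  fix s assume s: "s \<in> A"
  have *: "norm (g t - g s) \<le> G * \<bar>t - s\<bar> powr e" if "t \<in> A" for t
    using assms(2)[of s t] assms(2)[of t s] s that by (cases "s \<le> t") (auto simp: norm_minus_commute)
  have "((\<lambda>t. g t - g s) \<longlongrightarrow> 0) (at s within A)"
  proof (rule Lim_null_comparison)
    show "\<forall>\<^sub>F t in at s within A. norm (g t - g s) \<le> G * \<bar>t - s\<bar> powr e"
      unfolding eventually_at_filter by (auto intro!: always_eventually *)
    show "((\<lambda>t. G * \<bar>t - s\<bar> powr e) \<longlongrightarrow> 0) (at s within A)"
      using tendsto_mult_left[OF powr_tendsto_zero[OF assms(1)], of G] by simp
  qed
  then show "(g \<longlongrightarrow> g s) (at s within A)"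
    by (simp add: LIM_zero_iff)
qed

definition holder_line :: "real \<Rightarrow> real \<Rightarrow> (real \<Rightarrow> real) \<Rightarrow> bool" where
  "holder_line \<eta> H x \<longleftrightarrow> (\<forall>s t. \<bar>x t - x s\<bar> \<le> H * \<bar>t - s\<bar> powr \<eta>)"

lemma holder_lineD: "holder_line \<eta> H x \<Longrightarrow> \<bar>x t - x s\<bar> \<le> H * \<bar>t - s\<bar> powr \<eta>"
  by (simp add: holder_line_def)

lemma holder_line_shift: "holder_line \<eta> H x \<Longrightarrow> holder_line \<eta> H (\<lambda>t. x (a + t))"
  unfolding holder_line_def by (metis add_diff_cancel_left)

lemma holder_line_continuous_on: "0 < \<eta> \<Longrightarrow> holder_line \<eta> H x \<Longrightarrow> continuous_on A x"
  by (rule holder_continuous_on[of \<eta> _ _ H]) (simp_all add: holder_line_def, metis abs_of_nonneg diff_ge_0_iff_ge)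

lemma bounded_real_deriv_diff:
  fixes f :: "real \<Rightarrow> real"
  assumes "\<And>r. u \<le> r \<Longrightarrow> r \<le> v \<Longrightarrow> (f has_real_derivative f' r) (at r)"
    and "\<And>r. u \<le> r \<Longrightarrow> r \<le> v \<Longrightarrow> \<bar>f' r\<bar> \<le> B" and "u \<le> v"
  shows "\<bar>f v - f u\<bar> \<le> B * (v - u)"
proof -
  have "norm (f v - f u) \<le> B * norm (v - u)"
    by (rule field_differentiable_bound[of "{u..v}" f f'])
      (use assms in \<open>auto intro: has_field_derivative_at_within\<close>)
  then show ?thesis using assms(3) by simp
qed

text \<open>\<open>X t\<close> is the average of \<open>x\<close> over \<open>[t, t + c]\<close>, so
  integrals against \<open>X\<close> are classical. Averaging does not enlarge the Hoelder constant;
  this uniformity in \<open>c\<close> is what survives the limit \<open>c\<close> to 0.\<close>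

lemma steklov_mean:
  assumes x: "holder_line \<eta> H x" and \<eta>: "0 < \<eta>" and H: "0 \<le> H" and c: "0 < c" "c \<le> 1"
  obtains X where
    "\<And>s t. a \<le> s \<Longrightarrow> s \<le> t \<Longrightarrow> t \<le> b \<Longrightarrow> ((\<lambda>r. (x (r + c) - x r) / c) has_integral (X t - X s)) {s..t}"
    "\<And>s t. a \<le> s \<Longrightarrow> s \<le> t \<Longrightarrow> t \<le> b \<Longrightarrow> \<bar>X t - X s\<bar> \<le> H * (t - s) powr \<eta>"
    "\<And>t. a \<le> t \<Longrightarrow> t \<le> b \<Longrightarrow> \<bar>X t - x t\<bar> \<le> H * c powr \<eta>"
proof -
  \<comment> \<open>The primitive starts at \<open>a - 1\<close> and is differentiated inside
    \<open>{a - 1..b + 2}\<close>, so its derivative is two-sided on \<open>[a, b + 1]\<close>;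
    going up to \<open>b + 1\<close> suffices because \<open>c \<le> 1\<close>.\<close>
  define W where "W = (\<lambda>t. integral {a - 1..t} x)"
  have cont: "continuous_on A x" for A
    using holder_line_continuous_on \<eta> x by blast
  have W: "(W has_real_derivative x t) (at t)" if "a \<le> t" "t \<le> b + 1" for t
  proof -
    have "(W has_real_derivative x t) (at t within {a - 1..b + 2})"
      unfolding W_def by (rule integral_has_real_derivative[OF cont]) (use that in auto)
    moreover have "at t within {a - 1..b + 2} = at t"
      by (rule at_within_interior) (use that in auto)
    ultimately show ?thesis by simp
  qed
  define X where "X = (\<lambda>t. (W (t + c) - W t) / c)"
  show thesis
  proof
    show "((\<lambda>r. (x (r + c) - x r) / c) has_integral (X t - X s)) {s..t}"
      if "a \<le> s" "s \<le> t" "t \<le> b" for s t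
    proof (rule fundamental_theorem_of_calculus[OF \<open>s \<le> t\<close>])
      fix r assume r: "r \<in> {s..t}"
      have "(X has_real_derivative (x (r + c) - x r) / c) (at r)"
        unfolding X_def using r c that
        by (auto intro!: derivative_eq_intros W DERIV_chain2[OF W])
      then show "(X has_vector_derivative (x (r + c) - x r) / c) (at r within {s..t})"
        by (simp add: has_real_derivative_iff_has_vector_derivative[symmetric]
            has_field_derivative_at_within)
    qed
    show "\<bar>X t - X s\<bar> \<le> H * (t - s) powr \<eta>" if "a \<le> s" "s \<le> t" "t \<le> b" for s t
    proof -
      \<comment> \<open>Differentiate in the window length \<open>r\<close> and not in time: the
        derivative is the increment of \<open>x\<close> from \<open>s + r\<close> to
        \<open>t + r\<close>.\<close>
      have "\<bar>(W (t + c) - W (s + c)) - (W (t + 0) - W (s + 0))\<bar> \<le> (H * (t - s) powr \<eta>) * (c - 0)"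
      proof (rule bounded_real_deriv_diff[where f = "\<lambda>r. W (t + r) - W (s + r)" and
            f' = "\<lambda>r. x (t + r) - x (s + r)"])
        show "((\<lambda>r. W (t + r) - W (s + r)) has_real_derivative x (t + r) - x (s + r)) (at r)"
          if "0 \<le> r" "r \<le> c" for r
          using that c \<open>a \<le> s\<close> \<open>s \<le> t\<close> \<open>t \<le> b\<close>
          by (auto intro!: derivative_eq_intros DERIV_chain2[OF W])
        show "\<bar>x (t + r) - x (s + r)\<bar> \<le> H * (t - s) powr \<eta>" for r
          using holder_lineD[OF x, of "t + r" "s + r"] that by simp
      qed (use c in auto)
      moreover have "X t - X s = ((W (t + c) - W (s + c)) - (W (t + 0) - W (s + 0))) / c"
        by (simp add: X_def add_divide_distrib diff_divide_distrib)
      ultimately show ?thesis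
        using c by (simp only: abs_divide) (simp add: pos_divide_le_eq)
    qed
    show "\<bar>X t - x t\<bar> \<le> H * c powr \<eta>" if "a \<le> t" "t \<le> b" for t
    proof -
      have "\<bar>(W (t + c) - c * x t) - (W (t + 0) - 0 * x t)\<bar> \<le> (H * c powr \<eta>) * (c - 0)"
      proof (rule bounded_real_deriv_diff[where f = "\<lambda>r. W (t + r) - r * x t" and
            f' = "\<lambda>r. x (t + r) - x t"])
        show "((\<lambda>r. W (t + r) - r * x t) has_real_derivative x (t + r) - x t) (at r)"
          if "0 \<le> r" "r \<le> c" for r
          using that c \<open>a \<le> t\<close> \<open>t \<le> b\<close>
          by (auto intro!: derivative_eq_intros DERIV_chain2[OF W])
        show "\<bar>x (t + r) - x t\<bar> \<le> H * c powr \<eta>" if "0 \<le> r" "r \<le> c" for r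
        proof -
          have "\<bar>x (t + r) - x t\<bar> \<le> H * r powr \<eta>"
            using holder_lineD[OF x, of "t + r" t] that by simp
          also have "\<dots> \<le> H * c powr \<eta>"
            using that H \<eta> by (intro mult_left_mono powr_mono2) auto
          finally show ?thesis .
        qed
      qed (use c in auto)
      moreover have "X t - x t = ((W (t + c) - c * x t) - (W (t + 0) - 0 * x t)) / c"
        using c by (simp add: X_def field_simps)
      ultimately show ?thesis
        using c by (simp only: abs_divide) (simp add: pos_divide_le_eq)
    qed
  qed
qed

text \<open>The defect at an intermediate time \<open>m\<close> is
  \<open>(X t - X m) *\<^sub>R (g m - g s)\<close>, a product of Hoelder increments of total order
  above 1. The crude constant \<open>C\<close> is absent from the conclusion, so it may blow up with
  a regularisation.\<close>

lemma young_remainder_bound: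
  fixes F g :: "real \<Rightarrow> 'a::real_normed_vector" and X :: "real \<Rightarrow> real"
  assumes e: "0 < \<eta>" "0 < \<alpha>" "1 < \<eta> + \<alpha>" and H: "0 \<le> H" and G: "0 \<le> G"
    and X: "\<And>s t. a \<le> s \<Longrightarrow> s \<le> t \<Longrightarrow> t \<le> b \<Longrightarrow> \<bar>X t - X s\<bar> \<le> H * (t - s) powr \<eta>"
    and g: "\<And>s t. a \<le> s \<Longrightarrow> s \<le> t \<Longrightarrow> t \<le> b \<Longrightarrow> norm (g t - g s) \<le> G * (t - s) powr \<alpha>"
    and crude: "\<And>s t. a \<le> s \<Longrightarrow> s \<le> t \<Longrightarrow> t \<le> b \<Longrightarrow>
      norm (F t - F s - (X t - X s) *\<^sub>R g s) \<le> C * (t - s) powr (\<eta> + \<alpha>)"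
    and st: "a \<le> s" "s \<le> t" "t \<le> b"
  shows "norm (F t - F s - (X t - X s) *\<^sub>R g s) \<le>
    H * G / (1 - 2 powr (1 - (\<eta> + \<alpha>))) * (t - s) powr (\<eta> + \<alpha>)"
proof (rule sewing_bound[where R = "\<lambda>s t. F t - F s - (X t - X s) *\<^sub>R g s", OF e(3) _ crude _ st])
  show "0 \<le> H * G" using H G by simp
  fix s m t assume st: "a \<le> s" "t \<le> b" "m - s = t - m" "s \<le> m"
  have "\<bar>X t - X m\<bar> * norm (g m - g s) \<le> (H * (t - s) powr \<eta>) * (G * (t - s) powr \<alpha>)"
  proof (rule mult_mono)
    have "\<bar>X t - X m\<bar> \<le> H * (t - m) powr \<eta>" by (rule X) (use st in auto)
    also have "\<dots> \<le> H * (t - s) powr \<eta>" using H e st by (intro mult_left_mono powr_mono2) auto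
    finally show "\<bar>X t - X m\<bar> \<le> H * (t - s) powr \<eta>" .
    have "norm (g m - g s) \<le> G * (m - s) powr \<alpha>" by (rule g) (use st in auto)
    also have "\<dots> \<le> G * (t - s) powr \<alpha>" using G e st by (intro mult_left_mono powr_mono2) auto
    finally show "norm (g m - g s) \<le> G * (t - s) powr \<alpha>" .
  qed (use H in auto)
  moreover have "F t - F s - (X t - X s) *\<^sub>R g s - (F m - F s - (X m - X s) *\<^sub>R g s) -
      (F t - F m - (X t - X m) *\<^sub>R g m) = (X t - X m) *\<^sub>R (g m - g s)"
    by (simp add: algebra_simps)
  ultimately show "norm (F t - F s - (X t - X s) *\<^sub>R g s - (F m - F s - (X m - X s) *\<^sub>R g s) -
      (F t - F m - (X t - X m) *\<^sub>R g m)) \<le> H * G * (t - s) powr (\<eta> + \<alpha>)"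
    by (simp only: norm_scaleR real_norm_def) (simp add: powr_add mult_ac)
qed

text \<open>\<open>F\<close> is the limit of classical integrals against Steklov means of
  \<open>x\<close>. Their remainders obey one bound, since the means share the constant
  \<open>H\<close>; convergence is obtained at a slightly smaller exponent, at which differences of
  two means become small.\<close>

lemma young_integral_exists:
  fixes g :: "real \<Rightarrow> 'a::banach"
  assumes x: "holder_line \<eta> H x" and H: "0 \<le> H" and \<eta>: "0 < \<eta>" "\<eta> < 1" and \<alpha>: "0 < \<alpha>" "\<alpha> < 1"
    and p: "1 < \<eta> + \<alpha>" and ab: "a \<le> b" "b \<le> a + 1" and G: "0 \<le> G"
    and g: "\<And>s t. a \<le> s \<Longrightarrow> s \<le> t \<Longrightarrow> t \<le> b \<Longrightarrow> norm (g t - g s) \<le> G * (t - s) powr \<alpha>"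
  shows "\<exists>F. \<forall>s t. a \<le> s \<and> s \<le> t \<and> t \<le> b \<longrightarrow>
    norm (F t - F s - (x t - x s) *\<^sub>R g s) \<le>
      H * G / (1 - 2 powr (1 - (\<eta> + \<alpha>))) * (t - s) powr (\<eta> + \<alpha>)"
proof -
  define c where "c = (\<lambda>n. 1 / real (Suc n))"
  have c: "0 < c n" "c n \<le> 1" for n by (auto simp: c_def)
  define D where "D = (\<lambda>n r. (x (r + c n) - x r) / c n)"
  have "\<forall>n. \<exists>X. (\<forall>s t. a \<le> s \<longrightarrow> s \<le> t \<longrightarrow> t \<le> b \<longrightarrow> (D n has_integral (X t - X s)) {s..t}) \<and>
      (\<forall>s t. a \<le> s \<longrightarrow> s \<le> t \<longrightarrow> t \<le> b \<longrightarrow> \<bar>X t - X s\<bar> \<le> H * (t - s) powr \<eta>) \<and>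
      (\<forall>t. a \<le> t \<longrightarrow> t \<le> b \<longrightarrow> \<bar>X t - x t\<bar> \<le> H * c n powr \<eta>)"
  proof
    fix n
    show "\<exists>X. (\<forall>s t. a \<le> s \<longrightarrow> s \<le> t \<longrightarrow> t \<le> b \<longrightarrow> (D n has_integral (X t - X s)) {s..t}) \<and>
      (\<forall>s t. a \<le> s \<longrightarrow> s \<le> t \<longrightarrow> t \<le> b \<longrightarrow> \<bar>X t - X s\<bar> \<le> H * (t - s) powr \<eta>) \<and>
      (\<forall>t. a \<le> t \<longrightarrow> t \<le> b \<longrightarrow> \<bar>X t - x t\<bar> \<le> H * c n powr \<eta>)"
      by (rule steklov_mean[OF x \<eta>(1) H c, of a b n]) (unfold D_def, blast)
  qed
  then obtain X where
    X_int: "\<And>n s t. a \<le> s \<Longrightarrow> s \<le> t \<Longrightarrow> t \<le> b \<Longrightarrow> (D n has_integral (X n t - X n s)) {s..t}" and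
    X_hol: "\<And>n s t. a \<le> s \<Longrightarrow> s \<le> t \<Longrightarrow> t \<le> b \<Longrightarrow> \<bar>X n t - X n s\<bar> \<le> H * (t - s) powr \<eta>" and
    X_conv: "\<And>n t. a \<le> t \<Longrightarrow> t \<le> b \<Longrightarrow> \<bar>X n t - x t\<bar> \<le> H * c n powr \<eta>"
    by metis
  have contg: "continuous_on {a..b} g"
    by (rule holder_continuous_on[of \<alpha> _ _ G]) (use \<alpha> g in auto)
  have contx: "continuous_on A x" for A
    using holder_line_continuous_on \<eta> x by blast
  have contD: "continuous_on A (D n)" for A n
    unfolding D_def using c[of n]
    by (intro continuous_intros continuous_on_compose2[OF contx[of UNIV]]) auto
  define F where "F = (\<lambda>n t. integral {a..t} (\<lambda>r. D n r *\<^sub>R g r))"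
  define R where "R = (\<lambda>n s t. F n t - F n s - (X n t - X n s) *\<^sub>R g s)"
  have R_int: "((\<lambda>r. D n r *\<^sub>R (g r - g s)) has_integral R n s t) {s..t}"
    if "a \<le> s" "s \<le> t" "t \<le> b" for n s t
  proof -
    have int: "(\<lambda>r. D n r *\<^sub>R g r) integrable_on {u..v}" if "a \<le> u" "v \<le> b" for u v
      by (intro integrable_continuous_real continuous_intros contD continuous_on_subset[OF contg])
        (use that in auto)
    have "F n t = F n s + integral {s..t} (\<lambda>r. D n r *\<^sub>R g r)"
      unfolding F_def by (rule Henstock_Kurzweil_Integration.integral_combine[symmetric])
        (use that int in auto)
    then have "((\<lambda>r. D n r *\<^sub>R g r) has_integral (F n t - F n s)) {s..t}"
      using int[of s t] that by (simp add: has_integral_integrable_integral)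
    from has_integral_diff[OF this has_integral_scaleR_left[OF X_int[OF that], where c = "g s"]]
    show ?thesis by (simp add: R_def algebra_simps)
  qed
  \<comment> \<open>The derivative of the mean blows up as \<open>c n\<close> tends to 0;
    \<open>B n\<close> only supplies the finite crude constant that the sewing argument
    discards.\<close>
  define B where "B = (\<lambda>n. H * c n powr \<eta> / c n)"
  have D_bound: "\<bar>D n r\<bar> \<le> B n" for n r
    using holder_lineD[OF x, of "r + c n" r] c[of n] by (simp add: D_def B_def abs_div divide_right_mono)
  have B0: "0 \<le> B n" for n using H c[of n] by (simp add: B_def)
  \<comment> \<open>The exponent is left free because the bound is needed at
    \<open>\<eta> + \<alpha>\<close> and, for differences of means, at
    \<open>\<eta>' + \<alpha>\<close>; lowering it is allowed on lengths up to 1.\<close>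
  have R_crude: "norm (R n s t) \<le> (B n * G) * (t - s) powr q"
    if "a \<le> s" "s \<le> t" "t \<le> b" "q \<le> 1 + \<alpha>" for n s t q
  proof -
    have "norm (D n r *\<^sub>R (g r - g s)) \<le> B n * (G * (t - s) powr \<alpha>)" if r: "r \<in> {s..t}" for r
    proof -
      have "norm (g r - g s) \<le> G * (r - s) powr \<alpha>" using g r \<open>a \<le> s\<close> \<open>t \<le> b\<close> by auto
      also have "\<dots> \<le> G * (t - s) powr \<alpha>" using r \<alpha> G by (intro mult_left_mono powr_mono2) auto
      finally show ?thesis
        using D_bound B0 by (simp add: mult_mono)
    qed
    then have "norm (R n s t) \<le> (B n * (G * (t - s) powr \<alpha>)) * (t - s)"
      using has_integral_bound_real[OF _ finite.emptyI R_int[OF that(1-3)],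
          of "B n * (G * (t - s) powr \<alpha>)"] B0 G that by auto
    also have "\<dots> = (B n * G) * (t - s) powr (1 + \<alpha>)"
      using that by (cases "s = t") (auto simp: powr_add)
    also have "\<dots> \<le> (B n * G) * (t - s) powr q"
      using that B0 G ab by (intro mult_left_mono powr_mono') auto
    finally show ?thesis .
  qed
  have R_bound: "norm (R n s t) \<le> H * G / (1 - 2 powr (1 - (\<eta> + \<alpha>))) * (t - s) powr (\<eta> + \<alpha>)"
    if "a \<le> s" "s \<le> t" "t \<le> b" for n s t
    unfolding R_def
    by (rule young_remainder_bound[OF \<eta>(1) \<alpha>(1) p H G X_hol g R_crude[unfolded R_def] that]) (use \<eta> in auto)
  \<comment> \<open>Midpoint of \<open>1 - \<alpha>\<close> and \<eta>: below \<eta> to leave room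
    for decay, yet \<open>\<eta>' + \<alpha>\<close> stays above 1.\<close>
  define \<eta>' where "\<eta>' = (\<eta> + (1 - \<alpha>)) / 2"
  have \<eta>': "1 < \<eta>' + \<alpha>" "\<eta>' < \<eta>" "0 < \<eta>'" using p \<alpha> \<eta> by (auto simp: \<eta>'_def field_simps)
  \<comment> \<open>Interpolation: on lengths up to \<open>c N\<close> the larger Hoelder exponent
    \<eta> gains a power of the length; on longer ones the uniform distance of the means to
    \<open>x\<close> is small enough.\<close>
  have X_diff: "\<bar>(X n t - X m t) - (X n s - X m s)\<bar> \<le>
      4 * H * c N powr (\<eta> - \<eta>') * (t - s) powr \<eta>'"
    if "a \<le> s" "s \<le> t" "t \<le> b" "N \<le> n" "N \<le> m" for n m N s t
  proof (cases "t - s \<le> c N")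
    case True
    have "\<bar>(X n t - X m t) - (X n s - X m s)\<bar> \<le> 2 * H * (t - s) powr \<eta>"
      using X_hol[OF that(1-3), of n] X_hol[OF that(1-3), of m] unfolding abs_le_iff by linarith
    also have "\<dots> = 2 * H * ((t - s) powr (\<eta> - \<eta>') * (t - s) powr \<eta>')"
      by (simp add: powr_add[symmetric])
    also have "\<dots> \<le> 4 * H * (c N powr (\<eta> - \<eta>') * (t - s) powr \<eta>')"
      using True H \<eta>' that by (intro mult_mono powr_mono2) auto
    finally show ?thesis by (simp add: algebra_simps)
  next
    case False
    have cn: "c n \<le> c N" "c m \<le> c N" using that by (auto simp: c_def frac_le)
    have "H * c n powr \<eta> \<le> H * c N powr \<eta>" "H * c m powr \<eta> \<le> H * c N powr \<eta>"
      using cn H \<eta> c[of n] c[of m] by (auto intro!: mult_left_mono powr_mono2)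
    then have "\<bar>(X n t - X m t) - (X n s - X m s)\<bar> \<le> 4 * (H * c N powr \<eta>)"
      using X_conv[OF \<open>a \<le> s\<close>, of n] X_conv[OF \<open>a \<le> s\<close>, of m] X_conv[OF _ \<open>t \<le> b\<close>, of n]
        X_conv[OF _ \<open>t \<le> b\<close>, of m] that(1-3) unfolding abs_le_iff by linarith
    also have "\<dots> = 4 * H * (c N powr (\<eta> - \<eta>') * c N powr \<eta>')"
      by (simp add: powr_add[symmetric])
    also have "\<dots> \<le> 4 * H * (c N powr (\<eta> - \<eta>') * (t - s) powr \<eta>')"
      using False H \<eta>' c[of N] by (intro mult_left_mono powr_mono2) auto
    finally show ?thesis by (simp add: algebra_simps)
  qed
  define \<epsilon> where "\<epsilon> = (\<lambda>N. 4 * H * c N powr (\<eta> - \<eta>'))"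
  have \<epsilon>0: "0 \<le> \<epsilon> N" for N using H by (simp add: \<epsilon>_def)
  have R_diff: "norm (R n s t - R m s t) \<le> \<epsilon> N * G / (1 - 2 powr (1 - (\<eta>' + \<alpha>))) * (t - s) powr (\<eta>' + \<alpha>)"
    if "a \<le> s" "s \<le> t" "t \<le> b" "N \<le> n" "N \<le> m" for n m N s t
  proof -
    let ?F = "\<lambda>t. F n t - F m t" and ?X = "\<lambda>t. X n t - X m t"
    have R: "R n s t - R m s t = ?F t - ?F s - (?X t - ?X s) *\<^sub>R g s" for s t
      by (simp add: R_def algebra_simps)
    show ?thesis
      unfolding R
    proof (rule young_remainder_bound[OF \<eta>'(3) \<alpha>(1) \<eta>'(1) \<epsilon>0 G _ g _ that(1-3)])
      show "\<bar>?X t - ?X s\<bar> \<le> \<epsilon> N * (t - s) powr \<eta>'" if "a \<le> s" "s \<le> t" "t \<le> b" for s t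
        unfolding \<epsilon>_def by (rule X_diff[OF that \<open>N \<le> n\<close> \<open>N \<le> m\<close>])
      show "norm (?F t - ?F s - (?X t - ?X s) *\<^sub>R g s) \<le> (B n * G + B m * G) * (t - s) powr (\<eta>' + \<alpha>)"
        if "a \<le> s" "s \<le> t" "t \<le> b" for s t
        unfolding R[symmetric]
        using R_crude[OF that, of "\<eta>' + \<alpha>" n] R_crude[OF that, of "\<eta>' + \<alpha>" m] \<eta>' \<eta>
          norm_triangle_ineq4[of "R n s t" "R m s t"]
        by (simp add: algebra_simps)
    qed
  qed
  have c_lim: "c \<longlonglongrightarrow> 0" unfolding c_def using LIMSEQ_inverse_real_of_nat by (simp add: inverse_eq_divide)
  have \<epsilon>_lim: "\<epsilon> \<longlonglongrightarrow> 0"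
  proof -
    have "(\<lambda>N. 4 * H * c N powr (\<eta> - \<eta>')) \<longlonglongrightarrow> 4 * H * 0 powr (\<eta> - \<eta>')"
      using \<eta>' by (intro tendsto_intros tendsto_powr' c_lim) (auto intro: always_eventually simp: less_imp_le[OF c(1)])
    then show ?thesis by (simp add: \<epsilon>_def)
  qed
  define q where "q = 1 / (1 - 2 powr (1 - (\<eta>' + \<alpha>)))"
  have q: "0 < q" using \<eta>' by (simp add: q_def powr_less_one)
  have "\<forall>t\<in>{a..b}. convergent (\<lambda>n. F n t)"
  proof
    fix t assume t: "t \<in> {a..b}"
    have F0: "F n a = 0" for n by (simp add: F_def)
    define e where "e = (\<lambda>N. \<epsilon> N * G * q + \<epsilon> N * norm (g a))"
    have e_lim: "e \<longlonglongrightarrow> 0"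
      unfolding e_def using tendsto_add[OF tendsto_mult_right[OF tendsto_mult_right[OF \<epsilon>_lim]]
          tendsto_mult_right[OF \<epsilon>_lim]] by simp
    have F_diff: "norm (F n t - F m t) \<le> e N" if "N \<le> n" "N \<le> m" for n m N
    proof -
      have one: "(t - a) powr (\<eta>' + \<alpha>) \<le> 1" "(t - a) powr \<eta>' \<le> 1"
        using t ab \<eta>' \<alpha> by (auto intro!: powr_le1)
      have "F n t - F m t = (R n a t - R m a t) + ((X n t - X m t) - (X n a - X m a)) *\<^sub>R g a"
        by (simp add: R_def F0 algebra_simps)
      also have "norm \<dots> \<le> norm (R n a t - R m a t) + \<bar>(X n t - X m t) - (X n a - X m a)\<bar> * norm (g a)"
        by (rule norm_triangle_le) simp
      also have "\<dots> \<le> \<epsilon> N * G * q * (t - a) powr (\<eta>' + \<alpha>) + (\<epsilon> N * (t - a) powr \<eta>') * norm (g a)"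
        using R_diff[of a t N n m] X_diff[of a t N n m] that t
        by (intro add_mono mult_right_mono) (auto simp: q_def \<epsilon>_def)
      also have "\<dots> \<le> \<epsilon> N * G * q * 1 + (\<epsilon> N * 1) * norm (g a)"
        using one \<epsilon>0 G q by (intro add_mono mult_left_mono mult_right_mono) auto
      finally show ?thesis by (simp add: e_def)
    qed
    show "convergent (\<lambda>n. F n t)"
    proof (rule Cauchy_convergent, rule metric_CauchyI)
      fix r :: real assume "0 < r"
      then have "\<forall>\<^sub>F N in sequentially. e N < r" using e_lim by (intro order_tendstoD) auto
      then obtain N where "e N < r" by (auto simp: eventually_sequentially)
      then show "\<exists>M. \<forall>m\<ge>M. \<forall>n\<ge>M. dist (F m t) (F n t) < r"
        using F_diff by (auto simp: dist_norm intro!: exI[of _ N] intro: le_less_trans)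
    qed
  qed
  then have F_lim: "(\<lambda>n. F n t) \<longlonglongrightarrow> lim (\<lambda>n. F n t)" if "a \<le> t" "t \<le> b" for t
    using that by (auto simp: convergent_LIMSEQ_iff)
  have X_lim: "(\<lambda>n. X n t) \<longlonglongrightarrow> x t" if "a \<le> t" "t \<le> b" for t
  proof -
    have "(\<lambda>n. H * c n powr \<eta>) \<longlonglongrightarrow> H * 0 powr \<eta>"
      using \<eta> by (intro tendsto_intros tendsto_powr' c_lim) (auto intro: always_eventually simp: less_imp_le[OF c(1)])
    then have "(\<lambda>n. X n t - x t) \<longlonglongrightarrow> 0"
      using X_conv[OF that] by (intro Lim_null_comparison[of "\<lambda>n. X n t - x t" "\<lambda>n. H * c n powr \<eta>"]) auto
    then show ?thesis by (simp add: LIM_zero_iff)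
  qed
  show ?thesis
  proof (intro exI allI impI)
    fix s t assume st: "a \<le> s \<and> s \<le> t \<and> t \<le> b"
    let ?F = "\<lambda>t. lim (\<lambda>n. F n t)"
    have "(\<lambda>n. R n s t) \<longlonglongrightarrow> ?F t - ?F s - (x t - x s) *\<^sub>R g s"
      unfolding R_def using st by (intro tendsto_intros F_lim X_lim) auto
    then show "norm (?F t - ?F s - (x t - x s) *\<^sub>R g s) \<le>
        H * G / (1 - 2 powr (1 - (\<eta> + \<alpha>))) * (t - s) powr (\<eta> + \<alpha>)"
      by (rule tendsto_upperbound[OF tendsto_norm]) (use R_bound st in auto)
  qed
qed

subsection \<open>Convolution against a smoothing semigroup\<close>

text \<open>
  \<open>V\<close> with the norm \<open>n\<close> is the space of index \<open>\<alpha>\<close>, and \<open>L\<close> dominates all semigroup constants on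
  \<open>[0, 1]\<close>. Drivers are Hoelder on the whole line with constant \<open>H\<close>, so that they can be translated.
\<close>

locale smoothing =
  fixes S :: "real \<Rightarrow> 'a::banach \<Rightarrow> 'a" and V :: "'a set" and n :: "'a \<Rightarrow> real"
    and \<alpha> L \<eta> H :: real
  assumes S_bounded_linear: "0 \<le> t \<Longrightarrow> bounded_linear (S t)"
    and S_zero: "S 0 u = u"
    and S_add: "0 \<le> s \<Longrightarrow> 0 \<le> t \<Longrightarrow> S (t + s) u = S t (S s u)"
    and V: "banach_subspace V n"
    and L: "1 \<le> L"
    and V_norm: "u \<in> V \<Longrightarrow> norm u \<le> L * n u"
    and S_norm: "0 \<le> t \<Longrightarrow> t \<le> 1 \<Longrightarrow> norm (S t u) \<le> L * norm u"
    and S_V: "0 \<le> t \<Longrightarrow> t \<le> 1 \<Longrightarrow> u \<in> V \<Longrightarrow> S t u \<in> V"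
    and S_n: "0 \<le> t \<Longrightarrow> t \<le> 1 \<Longrightarrow> u \<in> V \<Longrightarrow> n (S t u) \<le> L * n u"
    and S_smooth_V: "0 < t \<Longrightarrow> t \<le> 1 \<Longrightarrow> S t u \<in> V"
    and S_smooth: "0 < t \<Longrightarrow> t \<le> 1 \<Longrightarrow> n (S t u) \<le> L * t powr - \<alpha> * norm u"
    and S_id: "0 \<le> t \<Longrightarrow> t \<le> 1 \<Longrightarrow> u \<in> V \<Longrightarrow> norm (S t u - u) \<le> L * t powr \<alpha> * n u"
    and \<alpha>: "0 < \<alpha>" "\<alpha> < 1"
    and \<eta>: "0 < \<eta>" "\<eta> < 1" "1 < \<eta> + \<alpha>"
    and H: "0 \<le> H"
begin

section \<open>Norms and limits in the scale space\<close>

lemma S_diff: "0 \<le> t \<Longrightarrow> S t (u - v) = S t u - S t v"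
  by (intro linear_diff bounded_linear.linear S_bounded_linear)

lemma S_plus: "0 \<le> t \<Longrightarrow> S t (u + v) = S t u + S t v"
  by (intro linear_add bounded_linear.linear S_bounded_linear)

lemma S_scaleR: "0 \<le> t \<Longrightarrow> S t (c *\<^sub>R u) = c *\<^sub>R S t u"
  by (intro linear_scale bounded_linear.linear S_bounded_linear)

lemma S_zero_right: "0 \<le> t \<Longrightarrow> S t 0 = 0"
  by (intro linear_0 bounded_linear.linear S_bounded_linear)

lemma V_zero: "0 \<in> V" and V_plus: "u \<in> V \<Longrightarrow> v \<in> V \<Longrightarrow> u + v \<in> V"
  and V_diff: "u \<in> V \<Longrightarrow> v \<in> V \<Longrightarrow> u - v \<in> V" and V_scaleR: "u \<in> V \<Longrightarrow> c *\<^sub>R u \<in> V"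
  using V by (auto simp: banach_subspace_def subspace_0 subspace_add subspace_diff subspace_scale)

lemma n_nonneg: "u \<in> V \<Longrightarrow> 0 \<le> n u" and n_zero: "n 0 = 0"
  and n_scaleR: "u \<in> V \<Longrightarrow> n (c *\<^sub>R u) = \<bar>c\<bar> * n u"
  and n_triangle: "u \<in> V \<Longrightarrow> v \<in> V \<Longrightarrow> n (u + v) \<le> n u + n v"
proof -
  have "\<forall>u\<in>V. 0 \<le> n u \<and> (n u = 0 \<longleftrightarrow> u = 0)"
    using V unfolding banach_subspace_def by (elim conjE)
  moreover have "\<forall>u\<in>V. \<forall>c. n (c *\<^sub>R u) = \<bar>c\<bar> * n u"
    using V unfolding banach_subspace_def by (elim conjE)
  moreover have "\<forall>u\<in>V. \<forall>v\<in>V. n (u + v) \<le> n u + n v"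
    using V unfolding banach_subspace_def by (elim conjE)
  ultimately show "u \<in> V \<Longrightarrow> 0 \<le> n u" "n 0 = 0" "u \<in> V \<Longrightarrow> n (c *\<^sub>R u) = \<bar>c\<bar> * n u"
    "u \<in> V \<Longrightarrow> v \<in> V \<Longrightarrow> n (u + v) \<le> n u + n v"
    using V_zero by simp_all
qed

lemma n_minus_commute: "u \<in> V \<Longrightarrow> v \<in> V \<Longrightarrow> n (u - v) = n (v - u)"
  using n_scaleR[of "v - u" "-1"] V_diff by simp

lemma n_triangle4: "u \<in> V \<Longrightarrow> v \<in> V \<Longrightarrow> n (u - v) \<le> n u + n v"
  using n_triangle[of u "(-1) *\<^sub>R v"] n_scaleR[of v "-1"] V_scaleR[of v "-1"] by simp

lemma V_complete:
  assumes "\<And>k. f k \<in> V" and "\<And>e. 0 < e \<Longrightarrow> \<exists>k. \<forall>i\<ge>k. \<forall>j\<ge>k. n (f i - f j) < e"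
  shows "\<exists>l\<in>V. (\<lambda>i. n (f i - l)) \<longlonglongrightarrow> 0"
proof -
  have "range f \<subseteq> V" using assms(1) by auto
  moreover have "\<forall>f::nat \<Rightarrow> 'a. range f \<subseteq> V \<longrightarrow>
        (\<forall>e>0. \<exists>k. \<forall>i\<ge>k. \<forall>j\<ge>k. n (f i - f j) < e) \<longrightarrow>
        (\<exists>l\<in>V. (\<lambda>i. n (f i - l)) \<longlonglongrightarrow> 0)"
    using V unfolding banach_subspace_def by (elim conjE)
  ultimately show ?thesis using assms(2) by simp
qed

text \<open>The limit is known in the ambient space only. Geometric increments make the sequence
  Cauchy for \<open>n\<close> too, completeness gives a limit in \<open>V\<close>, and the embedding
  identifies the two.\<close>

lemma V_geometric_limit:
  assumes u: "\<And>k. u k \<in> V" and step: "\<And>k. n (u (Suc k) - u k) \<le> c * q ^ k"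
    and q: "0 \<le> q" "q < 1" and lim: "u \<longlonglongrightarrow> l"
  shows "l \<in> V" and "n (l - u k) \<le> c * q ^ k / (1 - q)"
proof -
  have "0 \<le> n (u (Suc 0) - u 0)" using u V_diff n_nonneg by blast
  then have c: "0 \<le> c" using step[of 0] by simp
  have diff: "n (u (k + j) - u k) \<le> c * q ^ k * (1 - q ^ j) / (1 - q)" for k j
  proof (induction j)
    case 0
    then show ?case using n_zero by simp
  next
    case (Suc j)
    have "n (u (k + Suc j) - u k) \<le> n (u (Suc (k + j)) - u (k + j)) + n (u (k + j) - u k)"
      using n_triangle[of "u (Suc (k + j)) - u (k + j)" "u (k + j) - u k"] u V_diff by simp
    also have "\<dots> \<le> c * q ^ (k + j) + c * q ^ k * (1 - q ^ j) / (1 - q)"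
      using step Suc by (intro add_mono) auto
    also have "\<dots> = c * q ^ k * (1 - q ^ Suc j) / (1 - q)"
      using q by (simp add: field_simps power_add)
    finally show ?case .
  qed
  have diff': "n (u (k + j) - u k) \<le> c * q ^ k / (1 - q)" for k j
  proof -
    have "c * q ^ k * (1 - q ^ j) / (1 - q) \<le> c * q ^ k * 1 / (1 - q)"
      using c q by (intro divide_right_mono mult_left_mono) auto
    then show ?thesis using diff[of k j] by simp
  qed
  have q_lim: "(\<lambda>k. c * q ^ k / (1 - q)) \<longlonglongrightarrow> 0"
    using tendsto_divide[OF tendsto_mult_left[OF LIMSEQ_power_zero[of q], of c] tendsto_const, of "1 - q"] q
    by simp
  have "\<exists>l'\<in>V. (\<lambda>i. n (u i - l')) \<longlonglongrightarrow> 0"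
  proof (rule V_complete[OF u])
    fix e :: real assume "0 < e"
    then have "\<forall>\<^sub>F k in sequentially. c * q ^ k / (1 - q) < e / 2"
      using q_lim by (intro order_tendstoD) auto
    then obtain k where k: "c * q ^ k / (1 - q) < e / 2" by (auto simp: eventually_sequentially)
    have "n (u i - u j) < e" if "k \<le> i" "k \<le> j" for i j
    proof -
      have "n (u i - u j) \<le> n (u i - u k) + n (u j - u k)"
        using n_triangle4[of "u i - u k" "u j - u k"] u V_diff by simp
      moreover have "n (u i - u k) \<le> c * q ^ k / (1 - q)" "n (u j - u k) \<le> c * q ^ k / (1 - q)"
        using diff'[of k "i - k"] diff'[of k "j - k"] that by simp_all
      ultimately show ?thesis using k by linarith
    qed
    then show "\<exists>k. \<forall>i\<ge>k. \<forall>j\<ge>k. n (u i - u j) < e" by blast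
  qed
  then obtain l' where l': "l' \<in> V" "(\<lambda>i. n (u i - l')) \<longlonglongrightarrow> 0" by blast
  have "(\<lambda>i. u i - l') \<longlonglongrightarrow> 0"
  proof (rule Lim_null_comparison)
    show "\<forall>\<^sub>F i in sequentially. norm (u i - l') \<le> L * n (u i - l')"
      using V_norm[OF V_diff[OF u l'(1)]] by simp
    show "(\<lambda>i. L * n (u i - l')) \<longlonglongrightarrow> 0"
      using tendsto_mult_left[OF l'(2), of L] by simp
  qed
  then have [simp]: "l = l'" using lim LIMSEQ_unique by (simp add: LIM_zero_iff)
  show "l \<in> V" using l' by simp
  show "n (l - u k) \<le> c * q ^ k / (1 - q)"
  proof (rule tendsto_lowerbound)
    show "(\<lambda>j. n (u (j + k) - l') + c * q ^ k / (1 - q)) \<longlonglongrightarrow> c * q ^ k / (1 - q)"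
      using tendsto_add[OF LIMSEQ_ignore_initial_segment[OF l'(2), of k] tendsto_const] by simp
    show "\<forall>\<^sub>F j in sequentially. n (l - u k) \<le> n (u (j + k) - l') + c * q ^ k / (1 - q)"
    proof (rule always_eventually, rule allI)
      fix j
      have "n (l - u k) \<le> n (u (k + j) - u k) + n (u (k + j) - l')"
        using n_triangle4[of "u (k + j) - u k" "u (k + j) - l'"] u l' V_diff by simp
      then show "n (l - u k) \<le> n (u (j + k) - l') + c * q ^ k / (1 - q)"
        using diff'[of k j] by (simp add: add.commute)
    qed
  qed simp
qed

text \<open>\<open>P\<close> measures the scale norm, \<open>Q\<close> the ambient Hoelder seminorm,
  under a common weight. Plain increments replace \<open>hdelta\<close> because \<sigma> is
  Lipschitz for plain differences and need not commute with the semigroup.\<close>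

definition ctrl :: "real \<Rightarrow> real \<Rightarrow> real \<Rightarrow> real \<Rightarrow> (real \<Rightarrow> 'a) \<Rightarrow> bool" where
  "ctrl \<gamma> T P Q \<phi> \<longleftrightarrow>
     (\<forall>s. 0 < s \<and> s \<le> T \<longrightarrow> \<phi> s \<in> V \<and> n (\<phi> s) \<le> P * s powr - \<gamma>) \<and>
     (\<forall>s t. 0 < s \<and> s \<le> t \<and> t \<le> T \<longrightarrow> norm (\<phi> t - \<phi> s) \<le> Q * s powr - \<gamma> * (t - s) powr \<alpha>)"

text \<open>
  \<open>K s t\<close> stands for the convolution integral of \<open>\<phi>\<close> over \<open>[s, t]\<close>: \<open>chen\<close> is its additivity, and \<open>davie\<close> says
  that the remainder has order \<open>\<eta> + \<alpha>\<close>, with a constant that may blow up at \<open>0\<close>.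
\<close>

definition chen :: "real \<Rightarrow> (real \<Rightarrow> real \<Rightarrow> 'a) \<Rightarrow> bool" where
  "chen T K \<longleftrightarrow> (\<forall>r s t. 0 < r \<and> r \<le> s \<and> s \<le> t \<and> t \<le> T \<longrightarrow> K r t = K s t + S (t - s) (K r s))"

definition davie :: "real \<Rightarrow> real \<Rightarrow> real \<Rightarrow> (real \<Rightarrow> real) \<Rightarrow> (real \<Rightarrow> 'a) \<Rightarrow> (real \<Rightarrow> real \<Rightarrow> 'a) \<Rightarrow> bool" where
  "davie \<gamma> T C x \<phi> K \<longleftrightarrow> (\<forall>s t. 0 < s \<and> s \<le> t \<and> t \<le> T \<longrightarrow>
     norm (K s t - (x t - x s) *\<^sub>R S (t - s) (\<phi> s)) \<le> C * s powr - \<gamma> * (t - s) powr (\<eta> + \<alpha>))"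

section \<open>The convolution kernel: existence and sharp remainder\<close>

lemma ctrl_V: "ctrl \<gamma> T P Q \<phi> \<Longrightarrow> 0 < s \<Longrightarrow> s \<le> T \<Longrightarrow> \<phi> s \<in> V"
  and ctrl_n: "ctrl \<gamma> T P Q \<phi> \<Longrightarrow> 0 < s \<Longrightarrow> s \<le> T \<Longrightarrow> n (\<phi> s) \<le> P * s powr - \<gamma>"
  and ctrl_holder: "ctrl \<gamma> T P Q \<phi> \<Longrightarrow> 0 < s \<Longrightarrow> s \<le> t \<Longrightarrow> t \<le> T \<Longrightarrow>
    norm (\<phi> t - \<phi> s) \<le> Q * s powr - \<gamma> * (t - s) powr \<alpha>"
  by (auto simp: ctrl_def)

lemma chenD: "chen T K \<Longrightarrow> 0 < r \<Longrightarrow> r \<le> s \<Longrightarrow> s \<le> t \<Longrightarrow> t \<le> T \<Longrightarrow> K r t = K s t + S (t - s) (K r s)"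
  by (auto simp: chen_def)

lemma chen_diag: "chen T K \<Longrightarrow> 0 < s \<Longrightarrow> s \<le> T \<Longrightarrow> K s s = 0"
  using chenD[of T K s s s] by (simp add: S_zero)

lemma davieD: "davie \<gamma> T C x \<phi> K \<Longrightarrow> 0 < s \<Longrightarrow> s \<le> t \<Longrightarrow> t \<le> T \<Longrightarrow>
    norm (K s t - (x t - x s) *\<^sub>R S (t - s) (\<phi> s)) \<le> C * s powr - \<gamma> * (t - s) powr (\<eta> + \<alpha>)"
  by (auto simp: davie_def)

lemma chen_hdelta: "chen T (hdelta S J)"
  by (auto simp: chen_def hdelta_def S_diff S_add[symmetric])

lemma weight_mono: "0 < s \<Longrightarrow> s \<le> u \<Longrightarrow> 0 \<le> \<gamma> \<Longrightarrow> 0 \<le> C \<Longrightarrow> C * u powr - \<gamma> \<le> C * s powr - \<gamma>" for s u \<gamma> C :: real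
  by (intro mult_left_mono powr_mono2') auto

text \<open>The two kinds of increments differ by \<open>S (t - s) (\<phi> s) - \<phi> s\<close>,
  which \<open>S_id\<close> bounds with the same order \<alpha> at the price of the scale norm of
  \<open>\<phi> s\<close>; thus \<open>P\<close> enters a Hoelder bound.\<close>

lemma ctrl_hdelta:
  assumes c: "ctrl \<gamma> T P Q \<phi>" and P: "0 \<le> P" and Q: "0 \<le> Q" and T: "T \<le> 1"
    and st: "0 < s" "s \<le> t" "t \<le> T"
  shows "norm (hdelta S \<phi> s t) \<le> L * (P + Q) * s powr - \<gamma> * (t - s) powr \<alpha>"
proof -
  have "norm (hdelta S \<phi> s t) \<le> norm (\<phi> t - \<phi> s) + norm (S (t - s) (\<phi> s) - \<phi> s)"
    using norm_triangle_ineq4[of "\<phi> t - \<phi> s" "S (t - s) (\<phi> s) - \<phi> s"] by (simp add: hdelta_def)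
  also have "\<dots> \<le> Q * s powr - \<gamma> * (t - s) powr \<alpha> + L * (t - s) powr \<alpha> * (P * s powr - \<gamma>)"
  proof (rule add_mono[OF ctrl_holder[OF c st]])
    have "norm (S (t - s) (\<phi> s) - \<phi> s) \<le> L * (t - s) powr \<alpha> * n (\<phi> s)"
      by (rule S_id) (use st T c ctrl_V in auto)
    also have "\<dots> \<le> L * (t - s) powr \<alpha> * (P * s powr - \<gamma>)"
      using ctrl_n[OF c, of s] st L by (intro mult_left_mono) auto
    finally show "norm (S (t - s) (\<phi> s) - \<phi> s) \<le> L * (t - s) powr \<alpha> * (P * s powr - \<gamma>)" .
  qed
  also have "\<dots> = (Q + L * P) * (s powr - \<gamma> * (t - s) powr \<alpha>)"
    by (simp add: algebra_simps)
  also have "\<dots> \<le> (L * (P + Q)) * (s powr - \<gamma> * (t - s) powr \<alpha>)"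
    using mult_right_mono[OF L Q] by (intro mult_right_mono) (auto simp: algebra_simps)
  finally show ?thesis by (simp add: mult_ac)
qed

text \<open>Factoring out \<open>S (t - v)\<close> leaves \<open>hdelta S \<phi> u v\<close>. The
  weight is taken at the left end \<open>s\<close>, where it is largest.\<close>

lemma convolved_holder:
  assumes c: "ctrl \<gamma> T P Q \<phi>" and P: "0 \<le> P" and Q: "0 \<le> Q" and T: "T \<le> 1" and \<gamma>: "0 \<le> \<gamma>"
    and st: "0 < s" "s \<le> u" "u \<le> v" "v \<le> t" "t \<le> T"
  shows "norm (S (t - v) (\<phi> v) - S (t - u) (\<phi> u)) \<le> L * L * (P + Q) * s powr - \<gamma> * (v - u) powr \<alpha>"
proof -
  have "S (t - v) (\<phi> v) - S (t - u) (\<phi> u) = S (t - v) (hdelta S \<phi> u v)"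
    using st S_add[of "v - u" "t - v"] by (simp add: hdelta_def S_diff)
  also have "norm \<dots> \<le> L * norm (hdelta S \<phi> u v)"
    by (rule S_norm) (use st T in auto)
  also have "\<dots> \<le> L * (L * (P + Q) * u powr - \<gamma> * (v - u) powr \<alpha>)"
    using ctrl_hdelta[OF c P Q T, of u v] st L by (intro mult_left_mono) auto
  also have "\<dots> = L * L * (v - u) powr \<alpha> * ((P + Q) * u powr - \<gamma>)"
    by (simp add: mult_ac)
  also have "\<dots> \<le> L * L * (v - u) powr \<alpha> * ((P + Q) * s powr - \<gamma>)"
    by (rule mult_left_mono[OF weight_mono]) (use st \<gamma> P Q L in auto)
  finally show ?thesis by (simp add: mult_ac)
qed

text \<open>The Young constant of \<open>young_remainder_bound\<close> with \<open>P + Q\<close> and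
  the weight split off. One \<open>L\<close> comes from \<open>ctrl_hdelta\<close>, the other from
  the outer propagator.\<close>

definition "sewing_const = H * (L * L) / (1 - 2 powr (1 - (\<eta> + \<alpha>)))"

lemma sewing_denominator: "0 < 1 - 2 powr (1 - (\<eta> + \<alpha>))"
  using \<eta> by (simp add: powr_less_one)

lemma sewing_const: "0 \<le> sewing_const"
  using sewing_denominator H by (simp add: sewing_const_def)

text \<open>For a fixed final time \<open>t\<close>, additivity makes \<open>- K u t\<close> a
  primitive of \<open>u \<mapsto> S (t - u) (\<phi> u)\<close> against \<open>x\<close> up to order
  \<open>\<eta> + \<alpha>\<close>, so the Young bound applies and discards \<open>C\<close>. Any
  finite constant in \<open>davie\<close> thus upgrades to one determined by the controls of
  \<phi>.\<close>

lemma davie_sharp: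
  assumes c: "ctrl \<gamma> T P Q \<phi>" and P: "0 \<le> P" and Q: "0 \<le> Q" and T: "T \<le> 1" and \<gamma>: "0 \<le> \<gamma>"
    and x: "holder_line \<eta> H x" and K: "chen T K" and d: "davie \<gamma> T C x \<phi> K"
  shows "davie \<gamma> T (sewing_const * (P + Q)) x \<phi> K"
  unfolding davie_def
proof (intro allI impI)
  fix s t assume st: "0 < s \<and> s \<le> t \<and> t \<le> T"
  define G where "G = L * L * (P + Q) * s powr - \<gamma>"
  have G: "0 \<le> G" using P Q L by (simp add: G_def)
  have "norm (- K t t - - K s t - (x t - x s) *\<^sub>R S (t - s) (\<phi> s)) \<le>
      H * G / (1 - 2 powr (1 - (\<eta> + \<alpha>))) * (t - s) powr (\<eta> + \<alpha>)"
  proof (rule young_remainder_bound[where a = s and b = t and C = "L * (\<bar>C\<bar> * s powr - \<gamma>)"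
        and F = "\<lambda>u. - K u t" and g = "\<lambda>u. S (t - u) (\<phi> u)"])
    show "\<bar>x v - x u\<bar> \<le> H * (v - u) powr \<eta>" if "u \<le> v" for u v
      using holder_lineD[OF x, of v u] that by simp
    show "norm (S (t - v) (\<phi> v) - S (t - u) (\<phi> u)) \<le> G * (v - u) powr \<alpha>"
      if "s \<le> u" "u \<le> v" "v \<le> t" for u v
      unfolding G_def by (rule convolved_holder[OF c P Q T \<gamma>]) (use that st in auto)
    show "norm (- K v t - - K u t - (x v - x u) *\<^sub>R S (t - u) (\<phi> u)) \<le>
        L * (\<bar>C\<bar> * s powr - \<gamma>) * (v - u) powr (\<eta> + \<alpha>)" if "s \<le> u" "u \<le> v" "v \<le> t" for u v
    proof -
      have "norm (- K v t - - K u t - (x v - x u) *\<^sub>R S (t - u) (\<phi> u)) =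
          norm (S (t - v) (K u v - (x v - x u) *\<^sub>R S (v - u) (\<phi> u)))"
        using chenD[OF K, of u v t] S_add[of "v - u" "t - v" "\<phi> u"] that st
        by (simp add: S_diff S_scaleR)
      also have "\<dots> \<le> L * norm (K u v - (x v - x u) *\<^sub>R S (v - u) (\<phi> u))"
        by (rule S_norm) (use that st T in auto)
      also have "\<dots> \<le> L * (C * u powr - \<gamma> * (v - u) powr (\<eta> + \<alpha>))"
        using davieD[OF d, of u v] that st L by (intro mult_left_mono) auto
      also have "\<dots> \<le> L * (\<bar>C\<bar> * s powr - \<gamma> * (v - u) powr (\<eta> + \<alpha>))"
        using that st L \<gamma> by (intro mult_left_mono mult_right_mono mult_mono powr_mono2') auto
      finally show ?thesis by (simp add: mult_ac)
    qed
  qed (use \<eta> \<alpha> H G st in auto)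
  then show "norm (K s t - (x t - x s) *\<^sub>R S (t - s) (\<phi> s)) \<le>
      sewing_const * (P + Q) * s powr - \<gamma> * (t - s) powr (\<eta> + \<alpha>)"
    using chen_diag[OF K, of t] st by (simp add: sewing_const_def G_def mult_ac)
qed

text \<open>Each pair \<open>s, t\<close> gets its own primitive of the integrand with final time
  \<open>t\<close>, and these choices are unrelated. Additivity of the increments is recovered from
  uniqueness of primitives.\<close>

lemma young_kernel_exists:
  assumes c: "ctrl \<gamma> T P Q \<phi>" and P: "0 \<le> P" and Q: "0 \<le> Q" and T: "T \<le> 1" and \<gamma>: "0 \<le> \<gamma>"
    and x: "holder_line \<eta> H x"
  shows "\<exists>K. chen T K \<and> davie \<gamma> T (sewing_const * (P + Q)) x \<phi> K"
proof -
  define prim where "prim = (\<lambda>s t F. \<forall>u v. s \<le> u \<and> u \<le> v \<and> v \<le> t \<longrightarrow>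
    norm (F v - F u - (x v - x u) *\<^sub>R S (t - u) (\<phi> u)) \<le>
      sewing_const * (P + Q) * s powr - \<gamma> * (v - u) powr (\<eta> + \<alpha>))"
  have "\<exists>F. prim s t F" if st: "0 < s" "s \<le> t" "t \<le> T" for s t
  proof -
    define G where "G = L * L * (P + Q) * s powr - \<gamma>"
    have G: "0 \<le> G" using P Q L by (simp add: G_def)
    have "H * G / (1 - 2 powr (1 - (\<eta> + \<alpha>))) = sewing_const * (P + Q) * s powr - \<gamma>"
      by (simp add: sewing_const_def G_def mult_ac)
    moreover have "\<exists>F. \<forall>u v. s \<le> u \<and> u \<le> v \<and> v \<le> t \<longrightarrow>
        norm (F v - F u - (x v - x u) *\<^sub>R S (t - u) (\<phi> u)) \<le>
        H * G / (1 - 2 powr (1 - (\<eta> + \<alpha>))) * (v - u) powr (\<eta> + \<alpha>)"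
    proof (rule young_integral_exists[OF x H \<eta>(1,2) \<alpha> \<eta>(3) \<open>s \<le> t\<close> _ G])
      show "t \<le> s + 1" using st T by simp
      show "norm (S (t - v) (\<phi> v) - S (t - u) (\<phi> u)) \<le> G * (v - u) powr \<alpha>"
        if "s \<le> u" "u \<le> v" "v \<le> t" for u v
        unfolding G_def by (rule convolved_holder[OF c P Q T \<gamma>]) (use st that in auto)
    qed
    ultimately show ?thesis by (simp add: prim_def)
  qed
  then obtain F where F: "\<And>s t. 0 < s \<Longrightarrow> s \<le> t \<Longrightarrow> t \<le> T \<Longrightarrow> prim s t (F s t)"
    by metis
  define K where "K = (\<lambda>s t. F s t t - F s t s)"
  \<comment> \<open>The increments of the difference of two primitives are additive and of order
    above 1, so the sewing bound with zero defect annihilates them.\<close>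
  have uniq: "f b - f a = h b - h a"
    if f: "\<And>u v. a \<le> u \<Longrightarrow> u \<le> v \<Longrightarrow> v \<le> b \<Longrightarrow> norm (f v - f u - (x v - x u) *\<^sub>R g u) \<le> C * (v - u) powr (\<eta> + \<alpha>)"
      and h: "\<And>u v. a \<le> u \<Longrightarrow> u \<le> v \<Longrightarrow> v \<le> b \<Longrightarrow> norm (h v - h u - (x v - x u) *\<^sub>R g u) \<le> C' * (v - u) powr (\<eta> + \<alpha>)"
      and "a \<le> b" for f h g a b C C'
  proof -
    have "norm ((f b - h b) - (f a - h a)) \<le> 0 / (1 - 2 powr (1 - (\<eta> + \<alpha>))) * (b - a) powr (\<eta> + \<alpha>)"
    proof (rule sewing_bound[where a = a and b = b and C = "C + C'"
          and R = "\<lambda>u v. (f v - h v) - (f u - h u)"])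
      show "norm ((f v - h v) - (f u - h u)) \<le> (C + C') * (v - u) powr (\<eta> + \<alpha>)"
        if "a \<le> u" "u \<le> v" "v \<le> b" for u v
        using norm_triangle_ineq4[of "f v - f u - (x v - x u) *\<^sub>R g u" "h v - h u - (x v - x u) *\<^sub>R g u"]
          f[OF that] h[OF that] by (simp add: algebra_simps)
    qed (use \<eta> \<open>a \<le> b\<close> in auto)
    then show ?thesis by (simp add: algebra_simps)
  qed
  have "chen T K"
    unfolding chen_def
  proof (intro allI impI)
    fix r s t assume *: "0 < r \<and> r \<le> s \<and> s \<le> t \<and> t \<le> T"
    have 1: "F r t t - F r t s = K s t"
      unfolding K_def
    proof (rule uniq)
      show "norm (F r t v - F r t u - (x v - x u) *\<^sub>R S (t - u) (\<phi> u)) \<le>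
          (sewing_const * (P + Q) * r powr - \<gamma>) * (v - u) powr (\<eta> + \<alpha>)" if "s \<le> u" "u \<le> v" "v \<le> t" for u v
        using F[of r t] * that unfolding prim_def by auto
      show "norm (F s t v - F s t u - (x v - x u) *\<^sub>R S (t - u) (\<phi> u)) \<le>
          (sewing_const * (P + Q) * s powr - \<gamma>) * (v - u) powr (\<eta> + \<alpha>)" if "s \<le> u" "u \<le> v" "v \<le> t" for u v
        using F[of s t] * that unfolding prim_def by auto
    qed (use * in auto)
    \<comment> \<open>Propagating a primitive for final time \<open>s\<close> by
      \<open>S (t - s)\<close> gives one for final time \<open>t\<close>.\<close>
    define h where "h = (\<lambda>u. S (t - s) (F r s u))"
    have 2: "F r t s - F r t r = h s - h r"
    proof (rule uniq)
      show "norm (F r t v - F r t u - (x v - x u) *\<^sub>R S (t - u) (\<phi> u)) \<le>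
          (sewing_const * (P + Q) * r powr - \<gamma>) * (v - u) powr (\<eta> + \<alpha>)" if "r \<le> u" "u \<le> v" "v \<le> s" for u v
        using F[of r t] * that unfolding prim_def by auto
      show "norm (h v - h u - (x v - x u) *\<^sub>R S (t - u) (\<phi> u)) \<le>
          (L * (sewing_const * (P + Q) * r powr - \<gamma>)) * (v - u) powr (\<eta> + \<alpha>)" if "r \<le> u" "u \<le> v" "v \<le> s" for u v
      proof -
        have "h v - h u - (x v - x u) *\<^sub>R S (t - u) (\<phi> u) =
            S (t - s) (F r s v - F r s u - (x v - x u) *\<^sub>R S (s - u) (\<phi> u))"
          using S_add[of "s - u" "t - s" "\<phi> u"] * that by (simp add: h_def S_diff S_scaleR)
        also have "norm \<dots> \<le> L * norm (F r s v - F r s u - (x v - x u) *\<^sub>R S (s - u) (\<phi> u))"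
          by (rule S_norm) (use * T in auto)
        also have "\<dots> \<le> L * ((sewing_const * (P + Q) * r powr - \<gamma>) * (v - u) powr (\<eta> + \<alpha>))"
          using F[of r s] * that L unfolding prim_def by (intro mult_left_mono) auto
        finally show ?thesis by (simp add: mult_ac)
      qed
    qed (use * in auto)
    have "K r t = (F r t t - F r t s) + (F r t s - F r t r)" by (simp add: K_def)
    also have "\<dots> = K s t + S (t - s) (K r s)"
      using * unfolding 1 2 by (simp add: h_def K_def S_diff)
    finally show "K r t = K s t + S (t - s) (K r s)" .
  qed
  moreover have "davie \<gamma> T (sewing_const * (P + Q)) x \<phi> K"
    unfolding davie_def K_def using F unfolding prim_def by auto
  ultimately show ?thesis by blast
qed

end

subsection \<open>Smoothing estimates and paths\<close>

lemma powr_pow_swap: "0 \<le> a \<Longrightarrow> (a ^ k) powr e = (a powr e) ^ k" for a e :: real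
  by (induction k) (auto simp: powr_mult)

context smoothing
begin

text \<open>The numerator bounds one dyadic piece: \<open>L * sewing_const\<close> from smoothing
  its remainder, the other summand from its leading term. The denominator sums the geometric series
  over the pieces.\<close>

definition "local_const = (L * sewing_const + H * (L * L)) / (1 - 2 powr - \<eta>)"

lemma half_powr_\<eta>: "(1 / 2) powr \<eta> = 2 powr - \<eta>" "0 < 2 powr - \<eta>" "2 powr - \<eta> < 1"
  using \<eta> by (auto simp: powr_divide powr_minus_divide powr_less_one)

lemma local_const: "0 \<le> local_const"
  using sewing_const L H half_powr_\<eta> by (simp add: local_const_def)

text \<open>
  With \<open>r k = t - (t - s) / 2^k\<close>, the differences \<open>K s t - K (r k) t\<close> converge geometrically in \<open>V\<close>; their limit
  \<open>K s t\<close> is identified in the ambient norm.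
\<close>

lemma kernel_V:
  assumes c: "ctrl \<gamma> T P Q \<phi>" and P: "0 \<le> P" and Q: "0 \<le> Q" and T: "T \<le> 1" and \<gamma>: "0 \<le> \<gamma>"
    and x: "holder_line \<eta> H x" and K: "chen T K" and d: "davie \<gamma> T C x \<phi> K"
    and st: "0 < s" "s \<le> t" "t \<le> T"
  shows "K s t \<in> V" and "n (K s t) \<le> local_const * (P + Q) * s powr - \<gamma> * (t - s) powr \<eta>"
proof -
  note d' = davie_sharp[OF c P Q T \<gamma> x K d]
  define W where "W = (P + Q) * s powr - \<gamma>"
  define h where "h = t - s"
  define q where "q = 2 powr - \<eta>"
  have q: "0 < q" "q < 1" using half_powr_\<eta> by (auto simp: q_def)
  have W: "0 \<le> W" using P Q by (simp add: W_def)
  have Wa: "(P + Q) * a powr - \<gamma> \<le> W" if "s \<le> a" for a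
    unfolding W_def by (rule weight_mono) (use that st \<gamma> P Q in auto)
  have n\<phi>: "n (\<phi> a) \<le> W" if "s \<le> a" "a \<le> t" for a
  proof -
    have "n (\<phi> a) \<le> P * a powr - \<gamma>" using ctrl_n[OF c, of a] that st by auto
    also have "\<dots> \<le> (P + Q) * a powr - \<gamma>" using Q by (intro mult_right_mono) auto
    finally show ?thesis using Wa[OF that(1)] by simp
  qed
  have V\<phi>: "\<phi> a \<in> V" if "s \<le> a" "a \<le> t" for a
    using ctrl_V[OF c] that st by auto
  have M: "norm (K a b - (x b - x a) *\<^sub>R S (b - a) (\<phi> a)) \<le> sewing_const * W * (b - a) powr (\<eta> + \<alpha>)"
    if "s \<le> a" "a \<le> b" "b \<le> t" for a b
  proof -
    have "norm (K a b - (x b - x a) *\<^sub>R S (b - a) (\<phi> a)) \<le>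
        sewing_const * ((P + Q) * a powr - \<gamma>) * (b - a) powr (\<eta> + \<alpha>)"
      using davieD[OF d', of a b] that st by (simp add: mult_ac)
    also have "\<dots> \<le> sewing_const * W * (b - a) powr (\<eta> + \<alpha>)"
      using Wa[OF that(1)] sewing_const by (intro mult_right_mono mult_left_mono) auto
    finally show ?thesis .
  qed
  have x': "\<bar>x b - x a\<bar> \<le> H * (b - a) powr \<eta>" if "a \<le> b" for a b
    using holder_lineD[OF x, of b a] that by simp
  \<comment> \<open>\<open>r (Suc k)\<close> is the midpoint of \<open>r k\<close> and
    \<open>t\<close>, so the propagator that carries the piece over \<open>[r k, r (Suc k)]\<close>
    to \<open>t\<close> is exactly as long as the piece.\<close>
  define r where "r = (\<lambda>k. t - h * (1 / 2) ^ k)"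
  define \<delta> where "\<delta> = (\<lambda>k. h * (1 / 2) ^ Suc k)"
  have h: "0 \<le> h" "h \<le> 1" using st T by (auto simp: h_def)
  have r0: "r 0 = s" by (simp add: r_def h_def)
  have r\<delta>: "r (Suc k) - r k = \<delta> k" "t - r (Suc k) = \<delta> k" for k
    by (simp_all add: r_def \<delta>_def field_simps)
  have r: "s \<le> r k" "r k \<le> t" "r k \<le> r (Suc k)" for k
  proof -
    have "h * (1 / 2) ^ k \<le> h * 1" using h by (intro mult_left_mono power_le_one) auto
    then show "s \<le> r k" by (simp add: r_def h_def)
    show "r k \<le> t" using h by (simp add: r_def)
    have "0 \<le> \<delta> k" using h by (simp add: \<delta>_def)
    then show "r k \<le> r (Suc k)" using r\<delta>[of k] by simp
  qed
  have powr_h: "(h * (1 / 2) ^ k) powr \<eta> = h powr \<eta> * q ^ k" for k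
    using h by (simp add: powr_mult powr_pow_swap half_powr_\<eta> q_def)
  \<comment> \<open>Smoothing over the length of the piece costs
    \<open>(b - a) powr - \<alpha>\<close>, paid for by the order \<open>\<eta> + \<alpha>\<close>
    of the remainder; \<eta> is left. The leading term is in \<open>V\<close> without
    smoothing.\<close>
  have key: "S (b - a) (K a b) \<in> V \<and> n (S (b - a) (K a b)) \<le> (L * sewing_const + H * (L * L)) * W * (b - a) powr \<eta>"
    if "s \<le> a" "a < b" "b \<le> t" for a b
  proof -
    have ba: "0 < b - a" "b - a \<le> 1" using that st T by auto
    define M' where "M' = K a b - (x b - x a) *\<^sub>R S (b - a) (\<phi> a)"
    have eq: "S (b - a) (K a b) = S (b - a) M' + (x b - x a) *\<^sub>R S (b - a) (S (b - a) (\<phi> a))"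
      using that by (simp add: M'_def S_diff S_scaleR)
    have SV: "S (b - a) M' \<in> V" "S (b - a) (\<phi> a) \<in> V" "S (b - a) (S (b - a) (\<phi> a)) \<in> V"
      using ba S_smooth_V by auto
    have "n (S (b - a) M') \<le> L * (b - a) powr - \<alpha> * norm M'"
      by (rule S_smooth[OF ba])
    also have "\<dots> \<le> L * (b - a) powr - \<alpha> * (sewing_const * W * (b - a) powr (\<eta> + \<alpha>))"
      unfolding M'_def using L that by (intro mult_left_mono M) auto
    also have "\<dots> = L * sewing_const * W * (b - a) powr \<eta>"
      using ba by (simp add: powr_add powr_minus field_simps)
    finally have 1: "n (S (b - a) M') \<le> L * sewing_const * W * (b - a) powr \<eta>" .
    have "n (S (b - a) (S (b - a) (\<phi> a))) \<le> L * n (S (b - a) (\<phi> a))"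
      by (rule S_n) (use ba SV in auto)
    also have "\<dots> \<le> L * (L * n (\<phi> a))"
      using L ba V\<phi>[of a] that by (intro mult_left_mono S_n) auto
    also have "\<dots> \<le> L * (L * W)"
      using L n\<phi>[of a] that by (intro mult_left_mono) auto
    finally have 2: "n (S (b - a) (S (b - a) (\<phi> a))) \<le> L * L * W" by simp
    have "n (S (b - a) (K a b)) \<le> n (S (b - a) M') + \<bar>x b - x a\<bar> * n (S (b - a) (S (b - a) (\<phi> a)))"
      unfolding eq using n_triangle[OF SV(1) V_scaleR[OF SV(3)], of "x b - x a"]
        n_scaleR[OF SV(3), of "x b - x a"] by simp
    also have "\<dots> \<le> L * sewing_const * W * (b - a) powr \<eta> + (H * (b - a) powr \<eta>) * (L * L * W)"
      using 1 2 x'[of a b] that H n_nonneg[OF SV(3)] by (intro add_mono mult_mono) auto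
    finally have "n (S (b - a) (K a b)) \<le> (L * sewing_const + H * (L * L)) * W * (b - a) powr \<eta>"
      by (simp add: algebra_simps)
    moreover have "S (b - a) (K a b) \<in> V"
      using S_smooth_V ba by auto
    ultimately show ?thesis by blast
  qed
  have K_norm: "norm (K a t) \<le> (sewing_const + H * (L * L)) * W * (t - a) powr \<eta>" if "s \<le> a" "a \<le> t" for a
  proof -
    have "norm (K a t) \<le> norm (K a t - (x t - x a) *\<^sub>R S (t - a) (\<phi> a)) + \<bar>x t - x a\<bar> * norm (S (t - a) (\<phi> a))"
      using norm_triangle_ineq[of "K a t - (x t - x a) *\<^sub>R S (t - a) (\<phi> a)" "(x t - x a) *\<^sub>R S (t - a) (\<phi> a)"]
      by simp
    also have "\<dots> \<le> sewing_const * W * (t - a) powr \<eta> + (H * (t - a) powr \<eta>) * (L * L * W)"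
    proof (intro add_mono mult_mono)
      have "norm (K a t - (x t - x a) *\<^sub>R S (t - a) (\<phi> a)) \<le> sewing_const * W * (t - a) powr (\<eta> + \<alpha>)"
        by (rule M) (use that in auto)
      also have "\<dots> \<le> sewing_const * W * (t - a) powr \<eta>"
        using sewing_const W that st T \<alpha> by (intro mult_left_mono powr_mono') auto
      finally show "norm (K a t - (x t - x a) *\<^sub>R S (t - a) (\<phi> a)) \<le> sewing_const * W * (t - a) powr \<eta>" .
      have "norm (S (t - a) (\<phi> a)) \<le> L * norm (\<phi> a)"
        by (rule S_norm) (use that st T in auto)
      also have "\<dots> \<le> L * (L * n (\<phi> a))"
        using V_norm[OF V\<phi>[OF that]] L by (intro mult_left_mono) auto
      also have "\<dots> \<le> L * (L * W)" using L n\<phi>[OF that] by (intro mult_left_mono) auto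
      finally show "norm (S (t - a) (\<phi> a)) \<le> L * L * W" by simp
    qed (use x' that H in auto)
    finally show ?thesis by (simp add: algebra_simps)
  qed
  have "K s t \<in> V \<and> n (K s t) \<le> (L * sewing_const + H * (L * L)) * W * h powr \<eta> / (1 - q)"
  proof (cases "s = t")
    case True
    then have "K s t = 0" using chen_diag[OF K, of t] st by simp
    then show ?thesis using True by (simp add: V_zero n_zero h_def)
  next
    case False
    then have h0: "0 < h" using st by (simp add: h_def)
    then have \<delta>0: "0 < \<delta> k" for k by (simp add: \<delta>_def)
    define u where "u = (\<lambda>k. K s t - K (r k) t)"
    have u0: "u 0 = 0" by (simp add: u_def r0)
    have step: "u (Suc k) - u k = S (\<delta> k) (K (r k) (r (Suc k)))" for k
      using chenD[OF K, of "r k" "r (Suc k)" t] r[of k] r[of "Suc k"] st r\<delta>[of k]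
      by (simp add: u_def)
    have stepV: "u (Suc k) - u k \<in> V \<and> n (u (Suc k) - u k) \<le> (L * sewing_const + H * (L * L)) * W * h powr \<eta> * q ^ k" for k
    proof -
      have "u (Suc k) - u k \<in> V \<and> n (u (Suc k) - u k) \<le> (L * sewing_const + H * (L * L)) * W * \<delta> k powr \<eta>"
        unfolding step r\<delta>(1)[of k, symmetric] using r[of k] r[of "Suc k"] \<delta>0[of k] r\<delta>(1)[of k]
        by (intro key) auto
      moreover have "\<delta> k powr \<eta> \<le> h powr \<eta> * q ^ k"
        using powr_h[of "Suc k"] q by (simp add: \<delta>_def mult_left_mono mult_left_le_one_le)
      moreover have "0 \<le> (L * sewing_const + H * (L * L)) * W" using sewing_const W L H by simp
      ultimately show ?thesis by (smt (verit, best) mult.assoc mult_left_mono)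
    qed
    have uV: "u k \<in> V" for k
    proof (induction k)
      case 0
      then show ?case by (simp add: u0 V_zero)
    next
      case (Suc k)
      then show ?case using V_plus[of "u (Suc k) - u k" "u k"] stepV[of k] by simp
    qed
    have "(\<lambda>k. K (r k) t) \<longlonglongrightarrow> 0"
    proof (rule Lim_null_comparison)
      show "\<forall>\<^sub>F k in sequentially. norm (K (r k) t) \<le> (sewing_const + H * (L * L)) * W * (h powr \<eta> * q ^ k)"
      proof (rule always_eventually, rule allI)
        fix k
        have "t - r k = h * (1 / 2) ^ k" by (simp add: r_def)
        then show "norm (K (r k) t) \<le> (sewing_const + H * (L * L)) * W * (h powr \<eta> * q ^ k)"
          using K_norm[of "r k"] r[of k] powr_h[of k] by simp
      qed
      show "(\<lambda>k. (sewing_const + H * (L * L)) * W * (h powr \<eta> * q ^ k)) \<longlonglongrightarrow> 0"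
        using tendsto_mult_left[OF tendsto_mult_left[OF LIMSEQ_power_zero[of q]],
            of "(sewing_const + H * (L * L)) * W" "h powr \<eta>"] q by simp
    qed
    from tendsto_diff[OF tendsto_const[of "K s t"] this] have lim: "u \<longlonglongrightarrow> K s t"
      by (simp add: u_def)
    show ?thesis
      using V_geometric_limit[OF uV _ _ q(2) lim, of "(L * sewing_const + H * (L * L)) * W * h powr \<eta>"] stepV q u0
      by (metis diff_zero less_imp_le mult.right_neutral power_0)
  qed
  then show "K s t \<in> V" and "n (K s t) \<le> local_const * (P + Q) * s powr - \<gamma> * (t - s) powr \<eta>"
    by (simp_all add: local_const_def q_def W_def h_def mult_ac)
qed

text \<open>The dyadic pieces towards \<open>0\<close> have geometrically decreasing size, so the bound on comparable
  times sums up; the extra propagator \<open>S \<tau>\<close> keeps the constant from growing with the number of pieces.\<close>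

lemma kernel_dyadic:
  assumes K: "chen T K" and T: "T \<le> 1" and \<kappa>: "0 < \<kappa>" and C: "0 \<le> C"
    and near: "\<And>s t. 0 < s \<Longrightarrow> s \<le> t \<Longrightarrow> t \<le> 2 * s \<Longrightarrow> t \<le> T \<Longrightarrow> K s t \<in> V \<and> n (K s t) \<le> C * t powr \<kappa>"
    and st: "0 < s" "s \<le> t" "t \<le> T"
  shows "K s t \<in> V" and "n (K s t) \<le> L * C / (1 - 2 powr - \<kappa>) * t powr \<kappa>"
proof -
  define B where "B = L * C / (1 - 2 powr - \<kappa>)"
  have q: "2 powr - \<kappa> < 1" using \<kappa> by (simp add: powr_less_one)
  \<comment> \<open>\<open>B\<close> closes the induction: a near piece of size \<open>L * C\<close>
    plus the bound at \<open>t / 2\<close>, worth \<open>B * 2 powr - \<kappa>\<close>, gives back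
    \<open>B\<close>.\<close>
  have B: "L * C = B * (1 - 2 powr - \<kappa>)" using q \<kappa> by (simp add: B_def)
  have B0: "0 \<le> B" using q L C by (simp add: B_def)
  have LB: "L * C \<le> B" unfolding B using B0 by (simp add: mult_left_le)
  have main: "0 < s \<Longrightarrow> s \<le> t \<Longrightarrow> t \<le> 2 ^ k * s \<Longrightarrow> 0 \<le> \<tau> \<Longrightarrow> t + \<tau> \<le> T \<Longrightarrow>
      K s t \<in> V \<and> n (S \<tau> (K s t)) \<le> B * t powr \<kappa>" for k s t \<tau>
  proof (induction k arbitrary: s t \<tau>)
    case 0
    then have "K s t = 0" using chen_diag[OF K, of s] by simp
    then show ?case using 0 B0 by (simp add: V_zero n_zero S_zero_right)
  next
    case (Suc k)
    have near': "K s t \<in> V \<and> n (S \<tau> (K s t)) \<le> L * C * t powr \<kappa>"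
      if "0 < s" "s \<le> t" "t \<le> 2 * s" for s
    proof -
      have "K s t \<in> V" "n (K s t) \<le> C * t powr \<kappa>" using near[of s t] that Suc.prems by auto
      moreover from this have "n (S \<tau> (K s t)) \<le> L * n (K s t)"
        using Suc.prems T that by (intro S_n) auto
      ultimately show ?thesis using L by (smt (verit) mult.assoc mult_left_mono)
    qed
    show ?case
    proof (cases "t \<le> 2 * s")
      case True
      have "L * C * t powr \<kappa> \<le> B * t powr \<kappa>" using LB by (intro mult_right_mono) auto
      with near'[OF Suc.prems(1,2) True] show ?thesis
        by (intro conjI) (erule conjunct1, erule conjE, erule order_trans)
    next
      case False
      define m where "m = t / 2"
      have m: "0 < m" "s \<le> m" "m \<le> t" "t - m = m" "m \<le> 2 ^ k * s" "m + (\<tau> + m) = t + \<tau>"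
        using False Suc.prems by (auto simp: m_def)
      have eq: "K s t = K m t + S m (K s m)"
        using chenD[OF K, of s m t] m Suc.prems by simp
      have IH: "K s m \<in> V \<and> n (S (\<tau> + m) (K s m)) \<le> B * m powr \<kappa>"
        using m Suc.prems by (intro Suc.IH) auto
      have Km: "K m t \<in> V \<and> n (S \<tau> (K m t)) \<le> L * C * t powr \<kappa>"
        by (rule near') (use m in auto)
      have SV: "S m (K s m) \<in> V" "S \<tau> (K m t) \<in> V" "S (\<tau> + m) (K s m) \<in> V"
        using IH Km m Suc.prems T by (auto intro!: S_V)
      have "S \<tau> (K s t) = S \<tau> (K m t) + S (\<tau> + m) (K s m)"
        unfolding eq using S_add[of m \<tau>] m Suc.prems by (simp add: S_plus)
      then have "n (S \<tau> (K s t)) \<le> n (S \<tau> (K m t)) + n (S (\<tau> + m) (K s m))"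
        using n_triangle[OF SV(2,3)] by simp
      also have "\<dots> \<le> L * C * t powr \<kappa> + B * m powr \<kappa>"
        using Km IH by (intro add_mono) auto
      also have "\<dots> = B * t powr \<kappa>"
        unfolding B m_def using Suc.prems by (simp add: powr_divide powr_minus field_simps)
      finally have "n (S \<tau> (K s t)) \<le> B * t powr \<kappa>" .
      then show ?thesis using Km SV unfolding eq by (auto intro: V_plus)
    qed
  qed
  obtain k where "t / s < 2 ^ k" using real_arch_pow[of 2 "t / s"] by auto
  then have "t \<le> 2 ^ k * s" using st by (simp add: field_simps)
  then show "K s t \<in> V" and "n (K s t) \<le> L * C / (1 - 2 powr - \<kappa>) * t powr \<kappa>"
    using main[of s t k 0] st by (simp_all add: S_zero B_def)
qed

text \<open>The constant of \<open>kernel_dyadic\<close> for near pieces of size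
  \<open>local_const * 2 powr \<gamma>\<close>; the power of 2 comes from moving the weight from
  \<open>s\<close> to \<open>t\<close> when \<open>t \<le> 2 * s\<close>.\<close>

definition "decay_const \<gamma> = L * (local_const * 2 powr \<gamma>) / (1 - 2 powr - (\<eta> - \<gamma>))"

lemma decay_const: "\<gamma> < \<eta> \<Longrightarrow> 0 \<le> decay_const \<gamma>"
  using local_const L by (simp add: decay_const_def powr_less_one less_imp_le)

text \<open>On comparable times the weight is absorbed into a power of \<open>t\<close>, leaving the
  positive exponent \<open>\<eta> - \<gamma>\<close>; dyadic summation removes the restriction
  \<open>t \<le> 2 * s\<close>. Uniformity as \<open>s\<close> tends to 0 makes integration from
  time 0 possible.\<close>

lemma kernel_total:
  assumes c: "ctrl \<gamma> T P Q \<phi>" and P: "0 \<le> P" and Q: "0 \<le> Q" and T: "T \<le> 1" and \<gamma>: "0 \<le> \<gamma>" "\<gamma> < \<eta>"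
    and x: "holder_line \<eta> H x" and K: "chen T K" and d: "davie \<gamma> T C x \<phi> K"
    and st: "0 < s" "s \<le> t" "t \<le> T"
  shows "n (K s t) \<le> decay_const \<gamma> * (P + Q) * t powr (\<eta> - \<gamma>)"
proof -
  have "n (K s t) \<le> L * (local_const * (P + Q) * 2 powr \<gamma>) / (1 - 2 powr - (\<eta> - \<gamma>)) * t powr (\<eta> - \<gamma>)"
  proof (rule kernel_dyadic[OF K T _ _ _ st])
    fix s t assume st: "0 < s" "s \<le> t" "t \<le> 2 * s" "t \<le> T"
    have "s powr - \<gamma> \<le> (t / 2) powr - \<gamma>" "(t - s) powr \<eta> \<le> t powr \<eta>"
      subgoal by (rule powr_mono2') (use st \<gamma> in auto)
      subgoal by (rule powr_mono2) (use st \<eta> in auto)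
      done
    then have "s powr - \<gamma> * (t - s) powr \<eta> \<le> (t / 2) powr - \<gamma> * t powr \<eta>"
      by (rule mult_mono) auto
    also have "\<dots> = 2 powr \<gamma> * t powr (\<eta> - \<gamma>)"
      using st by (simp add: powr_divide powr_minus powr_diff field_simps)
    finally have "local_const * (P + Q) * (s powr - \<gamma> * (t - s) powr \<eta>) \<le> local_const * (P + Q) * (2 powr \<gamma> * t powr (\<eta> - \<gamma>))"
      using local_const P Q by (intro mult_left_mono) auto
    then show "K s t \<in> V \<and> n (K s t) \<le> local_const * (P + Q) * 2 powr \<gamma> * t powr (\<eta> - \<gamma>)"
      using kernel_V[OF c P Q T \<gamma>(1) x K d st(1,2,4)] by (simp add: mult_ac)
  qed (use \<gamma> local_const P Q in auto)
  then show ?thesis by (simp add: decay_const_def mult_ac)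
qed

definition "holder_const \<gamma> = local_const + decay_const \<gamma> * 2 powr (\<eta> - \<gamma>)"

lemma holder_const: "\<gamma> < \<eta> \<Longrightarrow> 0 \<le> holder_const \<gamma>"
  using local_const decay_const by (simp add: holder_const_def)

text \<open>Trades the weight for Hoelder order. If \<open>t - s \<le> s\<close>, the weight at
  \<open>s\<close> is dominated by \<open>(t - s) powr - \<gamma>\<close>; otherwise
  \<open>t\<close> is at most \<open>2 * (t - s)\<close> and the total bound applies.\<close>

lemma kernel_holder:
  assumes c: "ctrl \<gamma> T P Q \<phi>" and P: "0 \<le> P" and Q: "0 \<le> Q" and T: "T \<le> 1" and \<gamma>: "0 \<le> \<gamma>" "\<gamma> < \<eta>"
    and x: "holder_line \<eta> H x" and K: "chen T K" and d: "davie \<gamma> T C x \<phi> K"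
    and st: "0 < s" "s \<le> t" "t \<le> T"
  shows "n (K s t) \<le> holder_const \<gamma> * (P + Q) * (t - s) powr (\<eta> - \<gamma>)"
proof (cases "t - s \<le> s")
  case True
  have "s powr - \<gamma> * (t - s) powr \<eta> \<le> (t - s) powr - \<gamma> * (t - s) powr \<eta>"
  proof (cases "s = t")
    case False
    then show ?thesis using True st \<gamma> by (intro mult_right_mono powr_mono2') auto
  qed simp
  also have "\<dots> = (t - s) powr (\<eta> - \<gamma>)" by (simp add: powr_add[symmetric])
  finally have "local_const * (P + Q) * (s powr - \<gamma> * (t - s) powr \<eta>) \<le> local_const * (P + Q) * (t - s) powr (\<eta> - \<gamma>)"
    using local_const P Q by (intro mult_left_mono) auto
  also have "\<dots> \<le> holder_const \<gamma> * (P + Q) * (t - s) powr (\<eta> - \<gamma>)"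
    using decay_const[OF \<gamma>(2)] P Q by (intro mult_right_mono) (auto simp: holder_const_def)
  finally show ?thesis
    using kernel_V[OF c P Q T \<gamma>(1) x K d st] by (simp add: mult_ac)
next
  case False
  have "n (K s t) \<le> decay_const \<gamma> * (P + Q) * t powr (\<eta> - \<gamma>)"
    by (rule kernel_total[OF c P Q T \<gamma> x K d st])
  also have "\<dots> \<le> decay_const \<gamma> * (P + Q) * (2 * (t - s)) powr (\<eta> - \<gamma>)"
    using False st decay_const[OF \<gamma>(2)] P Q \<gamma> by (intro mult_left_mono powr_mono2) auto
  also have "\<dots> = decay_const \<gamma> * 2 powr (\<eta> - \<gamma>) * ((P + Q) * (t - s) powr (\<eta> - \<gamma>))"
    by (subst powr_mult) (simp add: mult_ac)
  also have "\<dots> \<le> holder_const \<gamma> * ((P + Q) * (t - s) powr (\<eta> - \<gamma>))"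
    using local_const P Q by (intro mult_right_mono) (auto simp: holder_const_def)
  finally show ?thesis by (simp add: mult_ac)
qed

text \<open>The integral from time 0 is the limit of \<open>K s t\<close> as \<open>s\<close> tends
  to 0: by additivity two such values differ by \<open>S (t - s) (K r s)\<close>, of size
  \<open>s powr (\<eta> - \<gamma>)\<close>. Replacing the kernel by a path lets later arguments
  work with functions of one time.\<close>

lemma path_exists:
  assumes c: "ctrl \<gamma> T P Q \<phi>" and P: "0 \<le> P" and Q: "0 \<le> Q" and T: "0 < T" "T \<le> 1" and \<gamma>: "0 \<le> \<gamma>" "\<gamma> < \<eta>"
    and x: "holder_line \<eta> H x"
  shows "\<exists>J. J 0 = 0 \<and> davie \<gamma> T (sewing_const * (P + Q)) x \<phi> (hdelta S J) \<and> (J \<longlongrightarrow> 0) (at_right 0)"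
proof -
  obtain K where K: "chen T K" and d: "davie \<gamma> T (sewing_const * (P + Q)) x \<phi> K"
    using young_kernel_exists[OF c P Q T(2) \<gamma>(1) x] by blast
  define B where "B = L * decay_const \<gamma> * (P + Q)"
  have \<kappa>: "0 < \<eta> - \<gamma>" using \<gamma> by simp
  have K_norm: "norm (K s t) \<le> B * t powr (\<eta> - \<gamma>)" if "0 < s" "s \<le> t" "t \<le> T" for s t
  proof -
    have "norm (K s t) \<le> L * n (K s t)"
      by (rule V_norm) (rule kernel_V[OF c P Q T(2) \<gamma>(1) x K d that])
    also have "\<dots> \<le> L * (decay_const \<gamma> * (P + Q) * t powr (\<eta> - \<gamma>))"
      using kernel_total[OF c P Q T(2) \<gamma> x K d that] L by (intro mult_left_mono) auto
    finally show ?thesis by (simp add: B_def mult_ac)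
  qed
  have K_diff: "norm (K r t - K s t) \<le> L * B * s powr (\<eta> - \<gamma>)" if "0 < r" "r \<le> s" "s \<le> t" "t \<le> T" for r s t
  proof -
    have "K r t - K s t = S (t - s) (K r s)" using chenD[OF K that] by simp
    also have "norm \<dots> \<le> L * norm (K r s)" using that T by (intro S_norm) auto
    also have "\<dots> \<le> L * (B * s powr (\<eta> - \<gamma>))" using K_norm[of r s] that L by (intro mult_left_mono) auto
    finally show ?thesis by (simp add: mult_ac)
  qed
  define J where "J = (\<lambda>t. if t = 0 then 0 else lim (\<lambda>k. K (t * (1 / 2) ^ k) t))"
  have tk: "0 < t * (1 / 2) ^ k" "t * (1 / 2) ^ k \<le> t" if "0 < t" for t :: real and k
    using that by (auto simp: power_le_one mult_left_le)
  have powr_lim: "(\<lambda>k. C * (t * (1 / 2) ^ k) powr (\<eta> - \<gamma>)) \<longlonglongrightarrow> 0" if "0 < t" for C t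
  proof -
    have "(\<lambda>k. t * (1 / 2) ^ k) \<longlonglongrightarrow> t * 0"
      by (intro tendsto_intros LIMSEQ_power_zero) auto
    then have "(\<lambda>k. (t * (1 / 2) ^ k) powr (\<eta> - \<gamma>)) \<longlonglongrightarrow> 0 powr (\<eta> - \<gamma>)"
      using \<kappa> that by (intro tendsto_powr') (auto intro!: always_eventually)
    then show ?thesis using tendsto_mult_left[of _ "0 powr (\<eta> - \<gamma>)" _ C] by simp
  qed
  have J_lim: "(\<lambda>k. K (t * (1 / 2) ^ k) t) \<longlonglongrightarrow> J t" if "0 < t" "t \<le> T" for t
  proof -
    have "Cauchy (\<lambda>k. K (t * (1 / 2) ^ k) t)"
    proof (rule metric_CauchyI)
      fix e :: real assume "0 < e"
      then have "\<forall>\<^sub>F k in sequentially. L * B * (t * (1 / 2) ^ k) powr (\<eta> - \<gamma>) < e / 2"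
        using powr_lim[OF that(1)] by (intro order_tendstoD) auto
      then obtain k where k: "L * B * (t * (1 / 2) ^ k) powr (\<eta> - \<gamma>) < e / 2"
        by (auto simp: eventually_sequentially)
      have *: "norm (K (t * (1 / 2) ^ i) t - K (t * (1 / 2) ^ k) t) < e / 2" if "k \<le> i" for i
      proof -
        have "(1 / 2 :: real) ^ i \<le> (1 / 2) ^ k" using that by (intro power_decreasing) auto
        then have "norm (K (t * (1 / 2) ^ i) t - K (t * (1 / 2) ^ k) t) \<le> L * B * (t * (1 / 2) ^ k) powr (\<eta> - \<gamma>)"
          using tk \<open>0 < t\<close> \<open>t \<le> T\<close> by (intro K_diff) (auto intro: mult_left_mono)
        then show ?thesis using k by simp
      qed
      show "\<exists>M. \<forall>i\<ge>M. \<forall>j\<ge>M. dist (K (t * (1 / 2) ^ i) t) (K (t * (1 / 2) ^ j) t) < e"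
      proof (intro exI allI impI)
        fix i j assume "k \<le> i" "k \<le> j"
        then show "dist (K (t * (1 / 2) ^ i) t) (K (t * (1 / 2) ^ j) t) < e"
          using * by (metis dist_norm dist_triangle_half_l)
      qed
    qed
    then show ?thesis
      using that by (simp add: J_def Cauchy_convergent_iff convergent_LIMSEQ_iff)
  qed
  have JK: "norm (J t - K s t) \<le> L * B * s powr (\<eta> - \<gamma>)" if "0 < s" "s \<le> t" "t \<le> T" for s t
  proof (rule tendsto_upperbound)
    show "(\<lambda>k. norm (K (t * (1 / 2) ^ k) t - K s t)) \<longlonglongrightarrow> norm (J t - K s t)"
      using that by (intro tendsto_intros J_lim) auto
    have "(\<lambda>k. t * (1 / 2) ^ k) \<longlonglongrightarrow> t * 0"
      by (intro tendsto_intros LIMSEQ_power_zero) auto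
    then have "\<forall>\<^sub>F k in sequentially. t * (1 / 2) ^ k < s"
      using that by (intro order_tendstoD) auto
    then show "\<forall>\<^sub>F k in sequentially. norm (K (t * (1 / 2) ^ k) t - K s t) \<le> L * B * s powr (\<eta> - \<gamma>)"
    proof eventually_elim
      case (elim k)
      then show ?case using tk[of t k] that by (intro K_diff) auto
    qed
  qed simp
  have hd: "hdelta S J s t = K s t" if "0 < s" "s \<le> t" "t \<le> T" for s t
  proof -
    \<comment> \<open>The starting times \<open>s * (1 / 2) ^ k\<close> are the ones that define
      \<open>J s\<close>; with the limit known along them too, additivity passes to the limit on
      both sides.\<close>
    have lim1: "(\<lambda>k. K (s * (1 / 2) ^ k) t) \<longlonglongrightarrow> J t"
    proof -
      have "(\<lambda>k. J t - K (s * (1 / 2) ^ k) t) \<longlonglongrightarrow> 0"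
      proof (rule Lim_null_comparison)
        show "\<forall>\<^sub>F k in sequentially. norm (J t - K (s * (1 / 2) ^ k) t) \<le> L * B * (s * (1 / 2) ^ k) powr (\<eta> - \<gamma>)"
          using order_trans[OF tk(2)[OF that(1)] that(2)] tk(1)[OF that(1)] that
          by (intro always_eventually allI JK) auto
      qed (rule powr_lim[OF that(1)])
      from tendsto_diff[OF tendsto_const[of "J t"] this] show ?thesis by simp
    qed
    have "(\<lambda>k. S (t - s) (K (s * (1 / 2) ^ k) s)) \<longlonglongrightarrow> S (t - s) (J s)"
      using that by (intro bounded_linear.tendsto[OF S_bounded_linear] J_lim) auto
    then have "(\<lambda>k. K s t + S (t - s) (K (s * (1 / 2) ^ k) s)) \<longlonglongrightarrow> K s t + S (t - s) (J s)"
      by (intro tendsto_intros)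
    moreover have "K s t + S (t - s) (K (s * (1 / 2) ^ k) s) = K (s * (1 / 2) ^ k) t" for k
      using chenD[OF K, of "s * (1 / 2) ^ k" s t] tk[OF that(1)] that by simp
    ultimately have "J t = K s t + S (t - s) (J s)"
      using LIMSEQ_unique[OF lim1] by simp
    then show ?thesis by (simp add: hdelta_def)
  qed
  have "davie \<gamma> T (sewing_const * (P + Q)) x \<phi> (hdelta S J)"
    unfolding davie_def using davieD[OF d] hd by auto
  moreover have "(J \<longlongrightarrow> 0) (at_right 0)"
  proof (rule Lim_null_comparison)
    have "norm (J t) \<le> L * B * \<bar>t - 0\<bar> powr (\<eta> - \<gamma>)" if "0 < t" "t \<le> T" for t
    proof -
      show ?thesis using JK[of t t] chen_diag[OF K that] that by simp
    qed
    then show "\<forall>\<^sub>F t in at_right 0. norm (J t) \<le> L * B * \<bar>t - 0\<bar> powr (\<eta> - \<gamma>)"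
      unfolding eventually_at_right_field using T by (intro exI[of _ T]) auto
    show "((\<lambda>t. L * B * \<bar>t - 0\<bar> powr (\<eta> - \<gamma>)) \<longlongrightarrow> 0) (at_right 0)"
      using tendsto_mult_left[OF powr_tendsto_zero[OF \<kappa>, of 0 "{0<..}"], of "L * B"] by simp
  qed
  ultimately show ?thesis by (intro exI[of _ J]) (simp add: J_def)
qed

text \<open>Write \<open>J t\<close> as \<open>hdelta S J s t + S (t - s) (J s)\<close> and let
  \<open>s\<close> tend to 0. For \<open>s \<le> t / 2\<close> the propagator smooths with a
  constant depending on \<open>t\<close> only, so ambient convergence of \<open>J s\<close> to 0
  removes the second term in the scale norm.\<close>

lemma path_bound:
  assumes c: "ctrl \<gamma> T P Q \<phi>" and P: "0 \<le> P" and Q: "0 \<le> Q" and T: "T \<le> 1" and \<gamma>: "0 \<le> \<gamma>" "\<gamma> < \<eta>"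
    and x: "holder_line \<eta> H x" and d: "davie \<gamma> T C x \<phi> (hdelta S J)"
    and J: "(J \<longlongrightarrow> 0) (at_right 0)" and t: "0 < t" "t \<le> T"
  shows "J t \<in> V" and "n (J t) \<le> decay_const \<gamma> * (P + Q) * t powr (\<eta> - \<gamma>)"
proof -
  note K = chen_hdelta[of T J]
  have S': "S (t - s) (J s) \<in> V \<and> n (S (t - s) (J s)) \<le> L * (t / 2) powr - \<alpha> * norm (J s)"
    if "0 < s" "s \<le> t / 2" for s
  proof -
    have ts: "0 < t - s" "t - s \<le> 1" using that t T by auto
    have "n (S (t - s) (J s)) \<le> L * (t - s) powr - \<alpha> * norm (J s)"
      by (rule S_smooth[OF ts])
    also have "\<dots> \<le> L * (t / 2) powr - \<alpha> * norm (J s)"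
      using L \<alpha> that t by (intro mult_right_mono mult_left_mono powr_mono2') auto
    finally show ?thesis using S_smooth_V[OF ts] by blast
  qed
  have eq: "J t = hdelta S J s t + S (t - s) (J s)" for s by (simp add: hdelta_def)
  have hV: "hdelta S J s t \<in> V" if "0 < s" "s \<le> t / 2" for s
    by (rule kernel_V[OF c P Q T \<gamma>(1) x K d]) (use that t in auto)
  show "J t \<in> V"
    unfolding eq[of "t / 2"] using t by (intro V_plus hV conjunct1[OF S']) auto
  have bound: "n (J t) \<le> decay_const \<gamma> * (P + Q) * t powr (\<eta> - \<gamma>) + L * (t / 2) powr - \<alpha> * norm (J s)"
    if "0 < s" "s \<le> t / 2" for s
  proof -
    have "n (J t) \<le> n (hdelta S J s t) + n (S (t - s) (J s))"
      unfolding eq[of s] by (rule n_triangle) (use hV[OF that] S'[OF that] in auto)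
    also have "\<dots> \<le> decay_const \<gamma> * (P + Q) * t powr (\<eta> - \<gamma>) + L * (t / 2) powr - \<alpha> * norm (J s)"
      using kernel_total[OF c P Q T \<gamma> x K d, of s t] S'[OF that] that t by (intro add_mono) auto
    finally show ?thesis .
  qed
  show "n (J t) \<le> decay_const \<gamma> * (P + Q) * t powr (\<eta> - \<gamma>)"
  proof (rule tendsto_lowerbound)
    show "((\<lambda>s. decay_const \<gamma> * (P + Q) * t powr (\<eta> - \<gamma>) + L * (t / 2) powr - \<alpha> * norm (J s)) \<longlongrightarrow>
        decay_const \<gamma> * (P + Q) * t powr (\<eta> - \<gamma>)) (at_right 0)"
      using tendsto_add[OF tendsto_const tendsto_mult_left[OF tendsto_norm_zero[OF J]]] by simp
    show "\<forall>\<^sub>F s in at_right 0. n (J t) \<le>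
        decay_const \<gamma> * (P + Q) * t powr (\<eta> - \<gamma>) + L * (t / 2) powr - \<alpha> * norm (J s)"
      unfolding eventually_at_right_field using bound t by (intro exI[of _ "t / 2"]) auto
  qed simp
qed

text \<open>The ambient bound carries no weight, because the four-point estimate for \<sigma> is
  local on balls of the ambient space and must be usable up to time 0.\<close>

definition adm :: "real \<Rightarrow> real \<Rightarrow> real \<Rightarrow> (real \<Rightarrow> 'a) \<Rightarrow> bool" where
  "adm \<gamma> T R y \<longleftrightarrow> ctrl \<gamma> T R R y \<and> (\<forall>t. 0 < t \<and> t \<le> T \<longrightarrow> norm (y t) \<le> R)"

definition "path_const \<gamma> = L * (decay_const \<gamma> + holder_const \<gamma>)"

lemma path_const: "\<gamma> < \<eta> \<Longrightarrow> 0 \<le> path_const \<gamma>"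
  using decay_const holder_const L by (simp add: path_const_def)

text \<open>The integral of a weighted integrand is itself unweighted: its order
  \<open>\<eta> - \<gamma>\<close> exceeds \<alpha>, and the surplus becomes the power of
  \<open>T\<close> that drives both the self-map and the contraction.\<close>

lemma path_adm:
  assumes c: "ctrl \<gamma> T P Q \<phi>" and P: "0 \<le> P" and Q: "0 \<le> Q" and T: "0 < T" "T \<le> 1"
    and \<gamma>: "0 \<le> \<gamma>" "\<alpha> + \<gamma> < \<eta>"
    and x: "holder_line \<eta> H x" and d: "davie \<gamma> T C x \<phi> (hdelta S J)"
    and J: "(J \<longlongrightarrow> 0) (at_right 0)"
  shows "adm 0 T (path_const \<gamma> * (P + Q) * T powr (\<eta> - \<gamma> - \<alpha>)) J"
proof -
  have \<gamma>': "\<gamma> < \<eta>" using \<gamma> \<alpha> by simp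
  note bound = path_bound[OF c P Q T(2) \<gamma>(1) \<gamma>' x d J]
  define E where "E = (P + Q) * T powr (\<eta> - \<gamma> - \<alpha>)"
  have E: "0 \<le> E" using P Q by (simp add: E_def)
  have nonneg: "0 \<le> decay_const \<gamma>" "0 \<le> holder_const \<gamma>" using decay_const holder_const \<gamma>' by auto
  have le_E: "(P + Q) * r powr (\<eta> - \<gamma>) \<le> E * r powr \<alpha>" if "0 \<le> r" "r \<le> T" for r
  proof -
    have "r powr (\<eta> - \<gamma>) = r powr (\<eta> - \<gamma> - \<alpha>) * r powr \<alpha>" by (simp add: powr_add[symmetric])
    also have "\<dots> \<le> T powr (\<eta> - \<gamma> - \<alpha>) * r powr \<alpha>"
      using that \<gamma> by (intro mult_right_mono powr_mono2) auto
    finally show ?thesis using P Q by (simp add: E_def mult.assoc mult_left_mono)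
  qed
  have nJ: "n (J t) \<le> decay_const \<gamma> * E" if "0 < t" "t \<le> T" for t
  proof -
    have "n (J t) \<le> decay_const \<gamma> * ((P + Q) * t powr (\<eta> - \<gamma>))"
      using bound(2)[OF that] by (simp add: mult.assoc)
    also have "\<dots> \<le> decay_const \<gamma> * (E * t powr \<alpha>)" using le_E that nonneg by (intro mult_left_mono) auto
    also have "\<dots> \<le> decay_const \<gamma> * (E * 1)"
      using nonneg E that T \<alpha> by (intro mult_left_mono powr_le1) auto
    finally show ?thesis by simp
  qed
  have c5_alt: "path_const \<gamma> * (P + Q) * T powr (\<eta> - \<gamma> - \<alpha>) = L * (decay_const \<gamma> * E) + L * (holder_const \<gamma> * E)"
    by (simp add: path_const_def E_def algebra_simps)
  have L_le: "a \<le> L * a + L * (holder_const \<gamma> * E)" "L * a \<le> L * a + L * (holder_const \<gamma> * E)" if "0 \<le> a" for a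
  proof -
    have "0 \<le> L * (holder_const \<gamma> * E)" using L nonneg E by simp
    moreover have "a \<le> L * a" using L that mult_right_mono[OF L that] by simp
    ultimately show "a \<le> L * a + L * (holder_const \<gamma> * E)" "L * a \<le> L * a + L * (holder_const \<gamma> * E)" by linarith+
  qed
  show ?thesis
    unfolding adm_def ctrl_def
  proof (intro conjI allI impI)
    fix t assume "0 < t \<and> t \<le> T"
    then have t: "0 < t" "t \<le> T" by auto
    show "J t \<in> V" by (rule bound(1)[OF t])
    have c3E: "0 \<le> decay_const \<gamma> * E" using nonneg E by simp
    show "n (J t) \<le> path_const \<gamma> * (P + Q) * T powr (\<eta> - \<gamma> - \<alpha>) * t powr - 0"
      using nJ[OF t] L_le(1)[OF c3E] t by (simp add: c5_alt)
    have "norm (J t) \<le> L * n (J t)" by (rule V_norm[OF bound(1)[OF t]])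
    also have "\<dots> \<le> L * (decay_const \<gamma> * E)" using nJ[OF t] L by (intro mult_left_mono) auto
    finally show "norm (J t) \<le> path_const \<gamma> * (P + Q) * T powr (\<eta> - \<gamma> - \<alpha>)"
      using L_le(2)[OF c3E] by (simp add: c5_alt)
  next
    fix s t assume "0 < s \<and> s \<le> t \<and> t \<le> T"
    then have st: "0 < s" "s \<le> t" "t \<le> T" by auto
    have "norm (J t - J s) \<le> norm (hdelta S J s t) + norm (S (t - s) (J s) - J s)"
      using norm_triangle_ineq[of "hdelta S J s t" "S (t - s) (J s) - J s"] by (simp add: hdelta_def)
    also have "\<dots> \<le> L * (holder_const \<gamma> * (E * (t - s) powr \<alpha>)) + L * (t - s) powr \<alpha> * (decay_const \<gamma> * E)"
    proof (rule add_mono)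
      have "norm (hdelta S J s t) \<le> L * n (hdelta S J s t)"
        by (rule V_norm) (rule kernel_V[OF c P Q T(2) \<gamma>(1) x chen_hdelta d st])
      also have "\<dots> \<le> L * (holder_const \<gamma> * ((P + Q) * (t - s) powr (\<eta> - \<gamma>)))"
        using kernel_holder[OF c P Q T(2) \<gamma>(1) \<gamma>' x chen_hdelta d st] L
        by (intro mult_left_mono) (auto simp: mult.assoc)
      also have "\<dots> \<le> L * (holder_const \<gamma> * (E * (t - s) powr \<alpha>))"
        using L nonneg le_E[of "t - s"] st by (intro mult_left_mono) auto
      finally show "norm (hdelta S J s t) \<le> L * (holder_const \<gamma> * (E * (t - s) powr \<alpha>))" .
      have "norm (S (t - s) (J s) - J s) \<le> L * (t - s) powr \<alpha> * n (J s)"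
        by (rule S_id) (use st T bound(1) in auto)
      also have "\<dots> \<le> L * (t - s) powr \<alpha> * (decay_const \<gamma> * E)"
        using nJ[of s] st L by (intro mult_left_mono) auto
      finally show "norm (S (t - s) (J s) - J s) \<le> L * (t - s) powr \<alpha> * (decay_const \<gamma> * E)" .
    qed
    also have "\<dots> = path_const \<gamma> * (P + Q) * T powr (\<eta> - \<gamma> - \<alpha>) * s powr - 0 * (t - s) powr \<alpha>"
      unfolding c5_alt using st by (simp add: algebra_simps)
    finally show "norm (J t - J s) \<le> path_const \<gamma> * (P + Q) * T powr (\<eta> - \<gamma> - \<alpha>) * s powr - 0 * (t - s) powr \<alpha>" .
  qed
qed

end

subsection \<open>Local existence\<close>

lemma small_powr:
  fixes A c e :: real
  assumes "0 < e" "0 < c" "0 \<le> A"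
  shows "\<exists>T0. 0 < T0 \<and> T0 \<le> 1 \<and> (\<forall>T. 0 < T \<and> T \<le> T0 \<longrightarrow> A * T powr e \<le> c)"
proof -
  have "((\<lambda>t. A * \<bar>t - 0\<bar> powr e) \<longlongrightarrow> A * 0) (at_right 0)"
    by (intro tendsto_intros powr_tendsto_zero assms)
  then have "\<forall>\<^sub>F t in at_right 0. A * \<bar>t - 0\<bar> powr e < c"
    using assms by (intro order_tendstoD) auto
  then obtain b where b: "0 < b" "\<And>t. 0 < t \<Longrightarrow> t < b \<Longrightarrow> A * \<bar>t - 0\<bar> powr e < c"
    unfolding eventually_at_right_field by blast
  have "A * T powr e \<le> c" if "0 < T" "T \<le> min 1 (b / 2)" for T
    using b(2)[of T] that b(1) by (auto simp: min_def split: if_splits)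
  then show ?thesis using b(1) by (intro exI[of _ "min 1 (b / 2)"]) auto
qed

lemma convergent_geometric:
  fixes u :: "nat \<Rightarrow> 'a::banach"
  assumes "\<And>k. norm (u (Suc k) - u k) \<le> c * q ^ k" "0 \<le> q" "q < 1"
  shows "convergent u"
proof -
  have "summable (\<lambda>k. u (Suc k) - u k)"
    by (rule summable_comparison_test'[where N = 0 and g = "\<lambda>k. c * q ^ k"])
      (use assms in \<open>auto intro!: summable_mult summable_geometric\<close>)
  then have "convergent (\<lambda>m. \<Sum>k<m. u (Suc k) - u k)"
    by (simp add: summable_iff_convergent)
  then have "convergent (\<lambda>m. (u m - u 0) + u 0)"
    unfolding sum_lessThan_telescope by (intro convergent_add convergent_const)
  then show ?thesis by simp
qed

context smoothing
begin

section \<open>Operations on controlled and admissible paths\<close>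

lemma weight_ge_1: "0 < s \<Longrightarrow> s \<le> 1 \<Longrightarrow> 0 \<le> \<gamma> \<Longrightarrow> 1 \<le> s powr - \<gamma>" for s \<gamma> :: real
  using powr_mono'[of "- \<gamma>" 0 s] by simp

lemma adm_ctrl: "adm \<gamma> T R y \<Longrightarrow> ctrl \<gamma> T R R y"
  and adm_norm: "adm \<gamma> T R y \<Longrightarrow> 0 < t \<Longrightarrow> t \<le> T \<Longrightarrow> norm (y t) \<le> R"
  by (auto simp: adm_def)

lemma adm_mono:
  assumes "adm \<gamma> T R y" "R \<le> R'" "T' \<le> T"
  shows "adm \<gamma> T' R' y"
proof -
  have *: "a \<le> R * b \<Longrightarrow> a \<le> R' * b" "a \<le> R * b * c \<Longrightarrow> a \<le> R' * b * c"
    if "0 \<le> b" "0 \<le> c" for a b c :: real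
    using assms(2) that by (meson mult_right_mono order_trans)+
  show ?thesis
    using assms unfolding adm_def ctrl_def by (auto intro!: * intro: order_trans)
qed

lemma ctrl_weaken:
  assumes "ctrl \<gamma> T P Q \<phi>" "P \<le> P'" "Q \<le> Q'" "0 \<le> P'" "0 \<le> Q'" "\<gamma> \<le> \<gamma>'" "T \<le> 1"
  shows "ctrl \<gamma>' T P' Q' \<phi>"
proof -
  have *: "a * s powr - \<gamma> \<le> b * s powr - \<gamma>'" if "0 < s" "s \<le> T" "a \<le> b" "0 \<le> b" for a b s
    using that assms by (intro mult_mono powr_mono') auto
  have "norm (\<phi> t - \<phi> s) \<le> Q' * s powr - \<gamma>' * (t - s) powr \<alpha>" if "0 < s" "s \<le> t" "t \<le> T" for s t
    using ctrl_holder[OF assms(1) that] mult_right_mono[OF *[of s Q Q'], of "(t - s) powr \<alpha>"] that assms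
    by auto
  moreover have "n (\<phi> s) \<le> P' * s powr - \<gamma>'" if "0 < s" "s \<le> T" for s
    using ctrl_n[OF assms(1) that] *[of s P P'] that assms by auto
  ultimately show ?thesis using assms(1) by (auto simp: ctrl_def)
qed

lemma ctrl_combine:
  assumes "ctrl \<gamma> T P Q \<phi>" "ctrl \<gamma> T P' Q' \<phi>'"
  shows "ctrl \<gamma> T (P + P') (Q + Q') (\<lambda>t. \<phi> t + \<phi>' t)" and "ctrl \<gamma> T (P + P') (Q + Q') (\<lambda>t. \<phi> t - \<phi>' t)"
proof -
  have n: "n (\<phi> s) + n (\<phi>' s) \<le> (P + P') * s powr - \<gamma>" if "0 < s" "s \<le> T" for s
    using ctrl_n[OF assms(1) that] ctrl_n[OF assms(2) that] by (simp add: algebra_simps)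
  have h: "norm (\<phi> t - \<phi> s) + norm (\<phi>' t - \<phi>' s) \<le> (Q + Q') * s powr - \<gamma> * (t - s) powr \<alpha>"
    if "0 < s" "s \<le> t" "t \<le> T" for s t
    using ctrl_holder[OF assms(1) that] ctrl_holder[OF assms(2) that] by (simp add: algebra_simps)
  show "ctrl \<gamma> T (P + P') (Q + Q') (\<lambda>t. \<phi> t + \<phi>' t)"
    unfolding ctrl_def
  proof (intro conjI allI impI)
    fix s assume s: "0 < s \<and> s \<le> T"
    note sV = ctrl_V[OF assms(1), of s] ctrl_V[OF assms(2), of s]
    show "\<phi> s + \<phi>' s \<in> V" using sV s by (simp add: V_plus)
    show "n (\<phi> s + \<phi>' s) \<le> (P + P') * s powr - \<gamma>"
      using n[of s] n_triangle[of "\<phi> s" "\<phi>' s"] sV s by auto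
  next
    fix s t assume "0 < s \<and> s \<le> t \<and> t \<le> T"
    then show "norm (\<phi> t + \<phi>' t - (\<phi> s + \<phi>' s)) \<le> (Q + Q') * s powr - \<gamma> * (t - s) powr \<alpha>"
      using h[of s t] norm_triangle_ineq[of "\<phi> t - \<phi> s" "\<phi>' t - \<phi>' s"] by (simp add: algebra_simps)
  qed
  show "ctrl \<gamma> T (P + P') (Q + Q') (\<lambda>t. \<phi> t - \<phi>' t)"
    unfolding ctrl_def
  proof (intro conjI allI impI)
    fix s assume s: "0 < s \<and> s \<le> T"
    note sV = ctrl_V[OF assms(1), of s] ctrl_V[OF assms(2), of s]
    show "\<phi> s - \<phi>' s \<in> V" using sV s by (simp add: V_diff)
    show "n (\<phi> s - \<phi>' s) \<le> (P + P') * s powr - \<gamma>"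
      using n[of s] n_triangle4[of "\<phi> s" "\<phi>' s"] sV s by auto
  next
    fix s t assume "0 < s \<and> s \<le> t \<and> t \<le> T"
    then show "norm (\<phi> t - \<phi>' t - (\<phi> s - \<phi>' s)) \<le> (Q + Q') * s powr - \<gamma> * (t - s) powr \<alpha>"
      using h[of s t] norm_triangle_ineq4[of "\<phi> t - \<phi> s" "\<phi>' t - \<phi>' s"] by (simp add: algebra_simps)
  qed
qed

lemma adm_add:
  assumes "adm \<gamma> T R y" "adm 0 T R' z" "0 \<le> R'" "0 \<le> \<gamma>" "T \<le> 1"
  shows "adm \<gamma> T (R + R') (\<lambda>t. y t + z t)"
  unfolding adm_def
proof (intro conjI allI impI)
  have "ctrl \<gamma> T R' R' z"
    by (rule ctrl_weaken[OF adm_ctrl[OF assms(2)]]) (use assms in auto)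
  then show "ctrl \<gamma> T (R + R') (R + R') (\<lambda>t. y t + z t)"
    using ctrl_combine(1)[OF adm_ctrl[OF assms(1)]] by blast
  fix t assume "0 < t \<and> t \<le> T"
  then show "norm (y t + z t) \<le> R + R'"
    using adm_norm[OF assms(1), of t] adm_norm[OF assms(2), of t] by (intro norm_triangle_le) auto
qed

lemma ctrl_shift:
  assumes "ctrl \<gamma> T P Q \<phi>" "0 \<le> \<tau>" "0 \<le> \<gamma>" "0 \<le> P" "0 \<le> Q"
  shows "ctrl \<gamma> (T - \<tau>) P Q (\<lambda>t. \<phi> (\<tau> + t))"
  unfolding ctrl_def
proof (intro conjI allI impI)
  fix s assume s: "0 < s \<and> s \<le> T - \<tau>"
  show "\<phi> (\<tau> + s) \<in> V" by (rule ctrl_V[OF assms(1)]) (use s assms in auto)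
  have "n (\<phi> (\<tau> + s)) \<le> P * (\<tau> + s) powr - \<gamma>" by (rule ctrl_n[OF assms(1)]) (use s assms in auto)
  also have "\<dots> \<le> P * s powr - \<gamma>" by (rule weight_mono) (use s assms in auto)
  finally show "n (\<phi> (\<tau> + s)) \<le> P * s powr - \<gamma>" .
next
  fix s t assume st: "0 < s \<and> s \<le> t \<and> t \<le> T - \<tau>"
  have "norm (\<phi> (\<tau> + t) - \<phi> (\<tau> + s)) \<le> Q * (\<tau> + s) powr - \<gamma> * ((\<tau> + t) - (\<tau> + s)) powr \<alpha>"
    by (rule ctrl_holder[OF assms(1)]) (use st assms in auto)
  also have "\<dots> \<le> Q * s powr - \<gamma> * ((\<tau> + t) - (\<tau> + s)) powr \<alpha>"
    by (intro mult_right_mono weight_mono) (use st assms in auto)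
  finally show "norm (\<phi> (\<tau> + t) - \<phi> (\<tau> + s)) \<le> Q * s powr - \<gamma> * (t - s) powr \<alpha>" by simp
qed

lemma adm_shift:
  assumes "adm \<gamma> T R y" "0 \<le> \<tau>" "0 \<le> \<gamma>" "0 \<le> R"
  shows "adm \<gamma> (T - \<tau>) R (\<lambda>t. y (\<tau> + t))"
  using ctrl_shift[OF adm_ctrl[OF assms(1)] assms(2,3,4,4)] assms unfolding adm_def by auto

lemma davie_weaken:
  assumes "davie \<gamma> T C x \<phi> K" "C \<le> C'" "0 \<le> C'" "\<gamma> \<le> \<gamma>'" "T' \<le> T" "T \<le> 1"
  shows "davie \<gamma>' T' C' x \<phi> K"
  unfolding davie_def
proof (intro allI impI)
  fix s t assume st: "0 < s \<and> s \<le> t \<and> t \<le> T'"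
  have "norm (K s t - (x t - x s) *\<^sub>R S (t - s) (\<phi> s)) \<le> C * s powr - \<gamma> * (t - s) powr (\<eta> + \<alpha>)"
    using davieD[OF assms(1)] st assms by auto
  also have "\<dots> \<le> C' * s powr - \<gamma>' * (t - s) powr (\<eta> + \<alpha>)"
    using st assms by (intro mult_right_mono mult_mono powr_mono') auto
  finally show "norm (K s t - (x t - x s) *\<^sub>R S (t - s) (\<phi> s)) \<le> C' * s powr - \<gamma>' * (t - s) powr (\<eta> + \<alpha>)" .
qed

lemma davie_diff:
  assumes "davie \<gamma> T C x \<phi> (hdelta S J)" "davie \<gamma> T C' x \<phi>' (hdelta S J')"
  shows "davie \<gamma> T (C + C') x (\<lambda>t. \<phi> t - \<phi>' t) (hdelta S (\<lambda>t. J t - J' t))"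
  unfolding davie_def
proof (intro allI impI)
  fix s t assume st: "0 < s \<and> s \<le> t \<and> t \<le> T"
  let ?M = "hdelta S J s t - (x t - x s) *\<^sub>R S (t - s) (\<phi> s)"
  let ?M' = "hdelta S J' s t - (x t - x s) *\<^sub>R S (t - s) (\<phi>' s)"
  have "hdelta S (\<lambda>t. J t - J' t) s t - (x t - x s) *\<^sub>R S (t - s) (\<phi> s - \<phi>' s) = ?M - ?M'"
    using st by (simp add: hdelta_def S_diff algebra_simps)
  also have "norm \<dots> \<le> norm ?M + norm ?M'" by (rule norm_triangle_ineq4)
  also have "\<dots> \<le> (C + C') * s powr - \<gamma> * (t - s) powr (\<eta> + \<alpha>)"
    using davieD[OF assms(1), of s t] davieD[OF assms(2), of s t] st by (simp add: algebra_simps)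
  finally show "norm (hdelta S (\<lambda>t. J t - J' t) s t - (x t - x s) *\<^sub>R S (t - s) (\<phi> s - \<phi>' s)) \<le>
      (C + C') * s powr - \<gamma> * (t - s) powr (\<eta> + \<alpha>)" .
qed

lemma davie_shift:
  assumes "davie \<gamma> T C x \<phi> (hdelta S J)" "0 \<le> \<tau>" "0 \<le> \<gamma>" "0 \<le> C"
  shows "davie \<gamma> (T - \<tau>) C (\<lambda>t. x (\<tau> + t)) (\<lambda>t. \<phi> (\<tau> + t)) (hdelta S (\<lambda>t. J (\<tau> + t)))"
  unfolding davie_def
proof (intro allI impI)
  fix s t assume st: "0 < s \<and> s \<le> t \<and> t \<le> T - \<tau>"
  have "norm (hdelta S J (\<tau> + s) (\<tau> + t) - (x (\<tau> + t) - x (\<tau> + s)) *\<^sub>R S ((\<tau> + t) - (\<tau> + s)) (\<phi> (\<tau> + s)))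
      \<le> C * (\<tau> + s) powr - \<gamma> * ((\<tau> + t) - (\<tau> + s)) powr (\<eta> + \<alpha>)"
    by (rule davieD[OF assms(1)]) (use st assms in auto)
  also have "\<dots> \<le> C * s powr - \<gamma> * ((\<tau> + t) - (\<tau> + s)) powr (\<eta> + \<alpha>)"
    by (intro mult_right_mono weight_mono) (use st assms in auto)
  finally show "norm (hdelta S (\<lambda>t. J (\<tau> + t)) s t - (x (\<tau> + t) - x (\<tau> + s)) *\<^sub>R S (t - s) (\<phi> (\<tau> + s)))
      \<le> C * s powr - \<gamma> * (t - s) powr (\<eta> + \<alpha>)" by (simp add: hdelta_def)
qed

text \<open>A free orbit has zero \<open>hdelta\<close>, so the remainder condition does not
  distinguish a solution from its integral part.\<close>

lemma hdelta_minus_free: "0 \<le> s \<Longrightarrow> s \<le> t \<Longrightarrow> hdelta S (\<lambda>t. y t - S t \<psi>) s t = hdelta S y s t"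
  using S_add[of s "t - s" \<psi>] by (simp add: hdelta_def S_diff)

lemma davie_minus_free:
  "davie \<gamma> T C x \<phi> (hdelta S (\<lambda>t. y t - S t \<psi>)) \<longleftrightarrow> davie \<gamma> T C x \<phi> (hdelta S y)"
  unfolding davie_def by (auto simp: hdelta_minus_free)

text \<open>The datum enters only through its orbit: smoothing from \<open>Xs \<theta>\<close> gives
  this bound with \<open>\<gamma> = \<alpha> - \<theta>\<close>, although \<psi> itself may lie
  outside \<open>V\<close>.\<close>

definition init :: "real \<Rightarrow> real \<Rightarrow> 'a \<Rightarrow> bool" where
  "init \<gamma> R \<psi> \<longleftrightarrow> 0 \<le> R \<and> (\<forall>t. 0 < t \<and> t \<le> 1 \<longrightarrow> n (S t \<psi>) \<le> R * t powr - \<gamma> \<and> norm (S t \<psi>) \<le> R)"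

lemma init_V:
  assumes "\<psi> \<in> V" "n \<psi> \<le> R"
  shows "init 0 (L * L * R) \<psi>"
proof -
  have R: "0 \<le> R" using n_nonneg assms by force
  have "n (S t \<psi>) \<le> L * L * R \<and> norm (S t \<psi>) \<le> L * L * R" if "0 < t" "t \<le> 1" for t
  proof
    have "n (S t \<psi>) \<le> L * n \<psi>" using that assms by (intro S_n) auto
    also have "\<dots> \<le> L * R" using assms L by (intro mult_left_mono) auto
    also have "\<dots> \<le> L * (L * R)" using L R mult_right_mono[OF L R] by (intro mult_left_mono) auto
    finally show "n (S t \<psi>) \<le> L * L * R" by (simp add: mult_ac)
    have "norm (S t \<psi>) \<le> L * norm \<psi>" using that by (intro S_norm) auto
    also have "\<dots> \<le> L * (L * R)"
      using V_norm[OF assms(1)] assms(2) L by (intro mult_left_mono order_trans[OF V_norm[OF assms(1)]]) auto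
    finally show "norm (S t \<psi>) \<le> L * L * R" by (simp add: mult_ac)
  qed
  then show ?thesis using R L by (auto simp: init_def)
qed

lemma free_adm:
  assumes "init \<gamma> R \<psi>" "T \<le> 1"
  shows "adm \<gamma> T (L * R) (\<lambda>t. S t \<psi>)"
  unfolding adm_def ctrl_def
proof (intro conjI allI impI)
  have R: "0 \<le> R" and i: "\<And>t. 0 < t \<Longrightarrow> t \<le> 1 \<Longrightarrow> n (S t \<psi>) \<le> R * t powr - \<gamma>"
    "\<And>t. 0 < t \<Longrightarrow> t \<le> 1 \<Longrightarrow> norm (S t \<psi>) \<le> R"
    using assms by (auto simp: init_def)
  have RL: "R \<le> L * R" using mult_right_mono[OF L R] by simp
  fix s
  {
    assume s: "0 < s \<and> s \<le> T"
    show "S s \<psi> \<in> V" using s assms by (intro S_smooth_V) auto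
    have "n (S s \<psi>) \<le> R * s powr - \<gamma>" using i(1) s assms by auto
    also have "\<dots> \<le> L * R * s powr - \<gamma>" using RL by (intro mult_right_mono) auto
    finally show "n (S s \<psi>) \<le> L * R * s powr - \<gamma>" .
    show "norm (S s \<psi>) \<le> L * R" using i(2)[of s] RL s assms by auto
  }
  fix t assume st: "0 < s \<and> s \<le> t \<and> t \<le> T"
  have "S t \<psi> - S s \<psi> = S (t - s) (S s \<psi>) - S s \<psi>" using S_add[of s "t - s" \<psi>] st by simp
  also have "norm \<dots> \<le> L * (t - s) powr \<alpha> * n (S s \<psi>)"
    using st assms by (intro S_id S_smooth_V) auto
  also have "\<dots> \<le> L * (t - s) powr \<alpha> * (R * s powr - \<gamma>)"
    using i(1)[of s] st assms L by (intro mult_left_mono) auto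
  finally show "norm (S t \<psi> - S s \<psi>) \<le> L * R * s powr - \<gamma> * (t - s) powr \<alpha>" by (simp add: mult_ac)
qed

end

text \<open>
  The last assumption is what a locally Lipschitz derivative is used for: it bounds the increments
  of \<open>\<sigma> \<circ> y - \<sigma> \<circ> z\<close> by those of \<open>y - z\<close>.
\<close>

locale rough_nonlinearity = smoothing +
  fixes \<sigma> :: "'a \<Rightarrow> 'a" and \<omega> \<Lambda> B :: real
  assumes \<omega>: "0 \<le> \<omega>" and \<Lambda>: "0 \<le> \<Lambda>" and B: "0 \<le> B"
    and \<sigma>_V: "u \<in> V \<Longrightarrow> \<sigma> u \<in> V"
    and \<sigma>_growth: "u \<in> V \<Longrightarrow> n (\<sigma> u) \<le> \<Lambda> * (1 + n u)"
    and \<sigma>_local: "0 < R \<Longrightarrow> u \<in> V \<Longrightarrow> v \<in> V \<Longrightarrow> n u \<le> R \<Longrightarrow> n v \<le> R \<Longrightarrow>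
      n (\<sigma> u - \<sigma> v) \<le> \<Lambda> * (1 + R) powr \<omega> * n (u - v)"
    and \<sigma>_lipschitz: "norm (\<sigma> u - \<sigma> v) \<le> B * norm (u - v)"
    and \<sigma>_four_point: "0 < R \<Longrightarrow> \<exists>K\<ge>0. \<forall>a b c d. norm a \<le> R \<longrightarrow> norm b \<le> R \<longrightarrow> norm c \<le> R \<longrightarrow> norm d \<le> R \<longrightarrow>
      norm ((\<sigma> a - \<sigma> b) - (\<sigma> c - \<sigma> d)) \<le>
        B * norm ((a - b) - (c - d)) + K * (norm (a - c) + norm (b - d)) * norm (c - d)"
begin

text \<open>Both constants are affine in \<open>R\<close>, by linear growth in \<open>V\<close> and
  the global Lipschitz bound in the ambient space; the a priori estimate depends on this. The
  constant 1 in the growth bound is absorbed by the weight, which is at least 1.\<close>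

lemma \<sigma>_ctrl:
  assumes a: "adm \<gamma> T R y" and T: "T \<le> 1" and \<gamma>: "0 \<le> \<gamma>" and R: "0 \<le> R"
  shows "ctrl \<gamma> T (\<Lambda> * (1 + R)) (B * R) (\<lambda>t. \<sigma> (y t))"
  unfolding ctrl_def
proof (intro conjI allI impI)
  note c = adm_ctrl[OF a]
  fix s assume s: "0 < s \<and> s \<le> T"
  show "\<sigma> (y s) \<in> V" using ctrl_V[OF c] s by (intro \<sigma>_V) auto
  have "n (\<sigma> (y s)) \<le> \<Lambda> * (1 + n (y s))" using ctrl_V[OF c] s by (intro \<sigma>_growth) auto
  also have "\<dots> \<le> \<Lambda> * (s powr - \<gamma> + R * s powr - \<gamma>)"
    using ctrl_n[OF c, of s] weight_ge_1[of s \<gamma>] s T \<gamma> \<Lambda> by (intro mult_left_mono add_mono) auto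
  also have "\<dots> = \<Lambda> * (1 + R) * s powr - \<gamma>" by (simp add: algebra_simps)
  finally show "n (\<sigma> (y s)) \<le> \<Lambda> * (1 + R) * s powr - \<gamma>" .
next
  fix s t assume st: "0 < s \<and> s \<le> t \<and> t \<le> T"
  have "norm (\<sigma> (y t) - \<sigma> (y s)) \<le> B * norm (y t - y s)" by (rule \<sigma>_lipschitz)
  also have "\<dots> \<le> B * (R * s powr - \<gamma> * (t - s) powr \<alpha>)"
    using ctrl_holder[OF adm_ctrl[OF a], of s t] st B by (intro mult_left_mono) auto
  finally show "norm (\<sigma> (y t) - \<sigma> (y s)) \<le> B * R * s powr - \<gamma> * (t - s) powr \<alpha>"
    by (simp add: mult_ac)
qed

text \<open>Differences of solutions are not singular at \<open>0\<close>, but the local Lipschitz constant of \<open>\<sigma>\<close>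
  on \<open>V\<close> blows up along the solutions; this is where the weight \<open>(1 + \<omega>) * \<gamma>\<close> comes from.\<close>

lemma \<sigma>_diff_ctrl:
  assumes R: "0 < R"
  shows "\<exists>C\<ge>0. \<forall>\<gamma> T y z d. 0 \<le> \<gamma> \<longrightarrow> T \<le> 1 \<longrightarrow> 0 \<le> d \<longrightarrow> adm \<gamma> T R y \<longrightarrow> adm \<gamma> T R z \<longrightarrow>
    adm 0 T d (\<lambda>t. y t - z t) \<longrightarrow> ctrl ((1 + \<omega>) * \<gamma>) T (C * d) (C * d) (\<lambda>t. \<sigma> (y t) - \<sigma> (z t))"
proof -
  obtain K where K: "0 \<le> K" and four: "\<And>a b c d. norm a \<le> R \<Longrightarrow> norm b \<le> R \<Longrightarrow> norm c \<le> R \<Longrightarrow> norm d \<le> R \<Longrightarrow>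
      norm ((\<sigma> a - \<sigma> b) - (\<sigma> c - \<sigma> d)) \<le>
        B * norm ((a - b) - (c - d)) + K * (norm (a - c) + norm (b - d)) * norm (c - d)"
    using \<sigma>_four_point[OF R] by blast
  define C1 where "C1 = \<Lambda> * (1 + R) powr \<omega>"
  define C2 where "C2 = B + 2 * K * R"
  have C: "0 \<le> C1" "0 \<le> C2" using \<Lambda> B K R by (auto simp: C1_def C2_def)
  have "ctrl ((1 + \<omega>) * \<gamma>) T ((C1 + C2) * d) ((C1 + C2) * d) (\<lambda>t. \<sigma> (y t) - \<sigma> (z t))"
    if \<gamma>: "0 \<le> \<gamma>" and T: "T \<le> 1" and d: "0 \<le> d" and y: "adm \<gamma> T R y" and z: "adm \<gamma> T R z"
      and yz: "adm 0 T d (\<lambda>t. y t - z t)" for \<gamma> T y z d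
  proof -
    note cy = adm_ctrl[OF y] and cz = adm_ctrl[OF z] and cyz = adm_ctrl[OF yz]
    have "ctrl ((1 + \<omega>) * \<gamma>) T (C1 * d) (C2 * d) (\<lambda>t. \<sigma> (y t) - \<sigma> (z t))"
      unfolding ctrl_def
    proof (intro conjI allI impI)
      fix s assume "0 < s \<and> s \<le> T"
      then have s: "0 < s" "s \<le> T" by auto
      note yV = ctrl_V[OF cy s] and zV = ctrl_V[OF cz s]
      show "\<sigma> (y s) - \<sigma> (z s) \<in> V" by (intro V_diff \<sigma>_V yV zV)
      have s1: "1 \<le> s powr - \<gamma>" using s T \<gamma> by (intro weight_ge_1) auto
      have nd: "n (y s - z s) \<le> d" using ctrl_n[OF cyz s] s by simp
      \<comment> \<open>The local Lipschitz bound is used on the ball of radius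
        \<open>R * s powr - \<gamma>\<close>, so its constant contributes a weight of exponent
        \<open>\<omega> * \<gamma>\<close>; the difference \<open>y - z\<close> has none.\<close>
      have "n (\<sigma> (y s) - \<sigma> (z s)) \<le> \<Lambda> * (1 + R * s powr - \<gamma>) powr \<omega> * n (y s - z s)"
        by (rule \<sigma>_local[OF _ yV zV ctrl_n[OF cy s] ctrl_n[OF cz s]]) (use R s in simp)
      also have "\<dots> \<le> \<Lambda> * ((1 + R) * s powr - \<gamma>) powr \<omega> * d"
        using R s1 \<omega> \<Lambda> nd n_nonneg[OF V_diff[OF yV zV]]
        by (intro mult_mono mult_left_mono powr_mono2) (auto simp: algebra_simps)
      also have "\<dots> = C1 * d * s powr (- (\<omega> * \<gamma>))"
        using R by (simp add: powr_mult powr_powr C1_def mult_ac)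
      also have "\<dots> \<le> C1 * d * s powr (- ((1 + \<omega>) * \<gamma>))"
        using C d s T \<gamma> by (intro mult_left_mono powr_mono') (auto simp: algebra_simps)
      finally show "n (\<sigma> (y s) - \<sigma> (z s)) \<le> C1 * d * s powr - ((1 + \<omega>) * \<gamma>)" .
    next
      fix s t assume "0 < s \<and> s \<le> t \<and> t \<le> T"
      then have st: "0 < s" "s \<le> t" "t \<le> T" by auto
      have s1: "1 \<le> s powr - \<gamma>" using st T \<gamma> by (intro weight_ge_1) auto
      let ?a = "(t - s) powr \<alpha>"
      have "norm (\<sigma> (y t) - \<sigma> (z t) - (\<sigma> (y s) - \<sigma> (z s))) = norm ((\<sigma> (y t) - \<sigma> (y s)) - (\<sigma> (z t) - \<sigma> (z s)))"
        by (simp add: algebra_simps)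
      \<comment> \<open>Four-point estimate for the increments over \<open>[s, t]\<close>. The
        Hoelder increment of \<open>z\<close> brings the exponent \<gamma>, which is covered by
        \<open>(1 + \<omega>) * \<gamma>\<close> as well.\<close>
      also have "\<dots> \<le> B * norm ((y t - y s) - (z t - z s)) +
          K * (norm (y t - z t) + norm (y s - z s)) * norm (z t - z s)"
        by (rule four) (use st adm_norm[OF y] adm_norm[OF z] in auto)
      also have "(y t - y s) - (z t - z s) = (y t - z t) - (y s - z s)"
        by simp
      also have "B * norm ((y t - z t) - (y s - z s)) + K * (norm (y t - z t) + norm (y s - z s)) * norm (z t - z s)
          \<le> B * (d * ?a) + K * (d + d) * (R * s powr - \<gamma> * ?a)"
        using ctrl_holder[OF cyz st] ctrl_holder[OF cz st] adm_norm[OF yz, of s] adm_norm[OF yz, of t] st B K d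
        by (intro add_mono mult_mono mult_left_mono) auto
      also have "\<dots> \<le> B * (d * (s powr - \<gamma> * ?a)) + K * (d + d) * (R * s powr - \<gamma> * ?a)"
        using s1 B d mult_right_mono[OF s1, of ?a] by (intro add_right_mono mult_left_mono) auto
      also have "\<dots> = C2 * d * s powr - \<gamma> * ?a" by (simp add: C2_def algebra_simps)
      also have "\<dots> \<le> C2 * d * s powr - ((1 + \<omega>) * \<gamma>) * ?a"
        using C d st T \<gamma> \<omega> by (intro mult_right_mono mult_left_mono powr_mono') (auto simp: algebra_simps)
      finally show "norm (\<sigma> (y t) - \<sigma> (z t) - (\<sigma> (y s) - \<sigma> (z s))) \<le> C2 * d * s powr - ((1 + \<omega>) * \<gamma>) * ?a" .
    qed
    then show ?thesis
      by (rule ctrl_weaken) (use C d T in \<open>auto intro!: mult_right_mono\<close>)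
  qed
  then show ?thesis using C by (intro exI[of _ "C1 + C2"]) auto
qed

text \<open>\<open>C\<close> is fixed before driver, time and paths, so one value serves all
  translates. The remainder constant \<open>D\<close> is arbitrary, since the sharp bound replaces
  it.\<close>

definition contracts :: "real \<Rightarrow> real \<Rightarrow> real \<Rightarrow> bool" where
  "contracts \<gamma> R C \<longleftrightarrow> (\<forall>x T y z d J D. holder_line \<eta> H x \<longrightarrow> 0 < T \<longrightarrow> T \<le> 1 \<longrightarrow> 0 \<le> d \<longrightarrow>
    adm \<gamma> T R y \<longrightarrow> adm \<gamma> T R z \<longrightarrow> adm 0 T d (\<lambda>t. y t - z t) \<longrightarrow>
    davie ((1 + \<omega>) * \<gamma>) T D x (\<lambda>t. \<sigma> (y t) - \<sigma> (z t)) (hdelta S J) \<longrightarrow> (J \<longlongrightarrow> 0) (at_right 0) \<longrightarrow>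
    adm 0 T (C * T powr (\<eta> - (1 + \<omega>) * \<gamma> - \<alpha>) * d) J)"

lemmas contractsD = contracts_def[THEN iffD1, rule_format]

lemma contraction:
  assumes R: "0 < R" and \<gamma>: "0 \<le> \<gamma>" "\<alpha> + (1 + \<omega>) * \<gamma> < \<eta>"
  shows "\<exists>C\<ge>0. contracts \<gamma> R C"
proof -
  from \<sigma>_diff_ctrl[OF R] obtain C where C': "0 \<le> C \<and> (\<forall>\<gamma> T y z d. 0 \<le> \<gamma> \<longrightarrow> T \<le> 1 \<longrightarrow> 0 \<le> d \<longrightarrow>
    adm \<gamma> T R y \<longrightarrow> adm \<gamma> T R z \<longrightarrow> adm 0 T d (\<lambda>t. y t - z t) \<longrightarrow>
    ctrl ((1 + \<omega>) * \<gamma>) T (C * d) (C * d) (\<lambda>t. \<sigma> (y t) - \<sigma> (z t)))" ..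
  note C = conjunct1[OF C'] and ctrl = conjunct2[OF C', rule_format]
  define \<gamma>' where "\<gamma>' = (1 + \<omega>) * \<gamma>"
  have \<gamma>': "0 \<le> \<gamma>'" "\<alpha> + \<gamma>' < \<eta>" using \<gamma> \<omega> by (auto simp: \<gamma>'_def)
  have "contracts \<gamma> R (path_const \<gamma>' * (2 * C))"
    unfolding contracts_def
  proof (intro allI impI)
    fix x T y z d J D
    assume *: "holder_line \<eta> H x" "0 < T" "T \<le> 1" "0 \<le> d" "adm \<gamma> T R y" "adm \<gamma> T R z"
      "adm 0 T d (\<lambda>t. y t - z t)" "davie ((1 + \<omega>) * \<gamma>) T D x (\<lambda>t. \<sigma> (y t) - \<sigma> (z t)) (hdelta S J)"
      "(J \<longlongrightarrow> 0) (at_right 0)"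
    have Cd: "0 \<le> C * d" using C *(4) by simp
    have "adm 0 T (path_const \<gamma>' * (C * d + C * d) * T powr (\<eta> - \<gamma>' - \<alpha>)) J"
      by (rule path_adm[OF ctrl[OF \<gamma>(1) *(3,4,5,6,7), folded \<gamma>'_def] Cd Cd *(2,3) \<gamma>' *(1)
            *(8)[folded \<gamma>'_def] *(9)])
    then show "adm 0 T (path_const \<gamma>' * (2 * C) * T powr (\<eta> - (1 + \<omega>) * \<gamma> - \<alpha>) * d) J"
      by (simp add: \<gamma>'_def mult_ac)
  qed
  moreover have "0 \<le> path_const \<gamma>' * (2 * C)" using path_const[of \<gamma>'] \<gamma>' \<alpha> C by simp
  ultimately show ?thesis by blast
qed

text \<open>\<open>R\<close> need only be finite, because the sharp remainder bound recovers the
  right constant. The value at 0 is prescribed separately, as it does not follow from the limit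
  condition.\<close>

definition sol :: "real \<Rightarrow> real \<Rightarrow> (real \<Rightarrow> real) \<Rightarrow> 'a \<Rightarrow> (real \<Rightarrow> 'a) \<Rightarrow> real \<Rightarrow> bool" where
  "sol \<gamma> T x \<psi> y R \<longleftrightarrow> 0 \<le> R \<and> y 0 = \<psi> \<and> adm \<gamma> T R y \<and>
     davie \<gamma> T R x (\<lambda>t. \<sigma> (y t)) (hdelta S y) \<and> ((\<lambda>t. y t - S t \<psi>) \<longlongrightarrow> 0) (at_right 0)"

lemma \<sigma>_tendsto: "(f \<longlongrightarrow> l) F \<Longrightarrow> ((\<lambda>t. \<sigma> (f t)) \<longlongrightarrow> \<sigma> l) F"
proof -
  assume "(f \<longlongrightarrow> l) F"
  then have *: "((\<lambda>t. f t - l) \<longlongrightarrow> 0) F" by (rule LIM_zero)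
  have "((\<lambda>t. \<sigma> (f t) - \<sigma> l) \<longlongrightarrow> 0) F"
  proof (rule Lim_null_comparison)
    show "\<forall>\<^sub>F t in F. norm (\<sigma> (f t) - \<sigma> l) \<le> B * norm (f t - l)"
      by (rule always_eventually) (simp add: \<sigma>_lipschitz)
    show "((\<lambda>t. B * norm (f t - l)) \<longlongrightarrow> 0) F"
      using tendsto_mult_left[OF tendsto_norm_zero[OF *], of B] by simp
  qed
  then show ?thesis by (simp add: LIM_zero_iff)
qed

lemma exponent_gap: "0 \<le> \<gamma> \<Longrightarrow> \<alpha> + (1 + \<omega>) * \<gamma> < \<eta> \<Longrightarrow> \<alpha> + \<gamma> < \<eta>"
  using mult_nonneg_nonneg[OF \<omega>, of \<gamma>] by (simp add: algebra_simps)

text \<open>The order of quantifiers matters: \<open>T\<close> depends on the size \<open>R0\<close>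
  of the datum but not on the datum or the driver, so one step length can be reused at every
  restart.\<close>

theorem local_existence:
  assumes \<gamma>: "0 \<le> \<gamma>" "\<alpha> + (1 + \<omega>) * \<gamma> < \<eta>" and R0: "0 \<le> R0"
  shows "\<exists>T. 0 < T \<and> T \<le> 1 \<and> (\<forall>x \<psi>. holder_line \<eta> H x \<longrightarrow> init \<gamma> R0 \<psi> \<longrightarrow> (\<exists>y R. sol \<gamma> T x \<psi> y R))"
proof -
  note gap = exponent_gap[OF \<gamma>]
  have \<gamma>\<eta>: "\<gamma> < \<eta>" using gap \<alpha> by simp
  \<comment> \<open>Radius of the ball preserved by the iteration: \<open>L * R0\<close> for the
    free orbit, 1 for the integral part. Below, \<open>T1\<close> keeps the integral part at most 1
    and \<open>T2\<close> makes the map halve differences.\<close>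
  define R where "R = L * R0 + 1"
  have R: "0 < R" "0 \<le> R" using R0 L by (auto simp: R_def add_nonneg_pos)
  define P where "P = \<Lambda> * (1 + R)"
  define Q where "Q = B * R"
  have PQ: "0 \<le> P" "0 \<le> Q" using R \<Lambda> B by (auto simp: P_def Q_def)
  obtain C where C: "0 \<le> C" and contr: "contracts \<gamma> R C"
    using contraction[OF R(1) \<gamma>] by blast
  obtain T1 where T1: "0 < T1" "T1 \<le> 1" "\<And>T. 0 < T \<Longrightarrow> T \<le> T1 \<Longrightarrow> path_const \<gamma> * (P + Q) * T powr (\<eta> - \<gamma> - \<alpha>) \<le> 1"
    using small_powr[of "\<eta> - \<gamma> - \<alpha>" 1 "path_const \<gamma> * (P + Q)"] gap path_const[OF \<gamma>\<eta>] PQ by auto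
  obtain T2 where T2: "0 < T2" "T2 \<le> 1" "\<And>T. 0 < T \<Longrightarrow> T \<le> T2 \<Longrightarrow> C * T powr (\<eta> - (1 + \<omega>) * \<gamma> - \<alpha>) \<le> 1 / 2"
    using small_powr[of "\<eta> - (1 + \<omega>) * \<gamma> - \<alpha>" "1 / 2" C] \<gamma> C by auto
  define T where "T = min T1 T2"
  have T: "0 < T" "T \<le> 1" using T1 T2 by (auto simp: T_def)
  have TC: "path_const \<gamma> * (P + Q) * T powr (\<eta> - \<gamma> - \<alpha>) \<le> 1" "C * T powr (\<eta> - (1 + \<omega>) * \<gamma> - \<alpha>) \<le> 1 / 2"
    using T1(3)[of T] T2(3)[of T] T by (auto simp: T_def)
  have "\<exists>y R. sol \<gamma> T x \<psi> y R" if x: "holder_line \<eta> H x" and \<psi>: "init \<gamma> R0 \<psi>" for x \<psi>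
  proof -
    define good where "good = (\<lambda>y J. J 0 = 0 \<and> davie \<gamma> T (sewing_const * (P + Q)) x (\<lambda>t. \<sigma> (y t)) (hdelta S J) \<and>
      (J \<longlongrightarrow> 0) (at_right 0))"
    \<comment> \<open>The integral path is only known to exist, so one is selected for each iterate.
      \<open>good\<close> includes \<open>J 0 = 0\<close>, which pins every iterate to \<psi> at
      time 0.\<close>
    define pick where "pick = (\<lambda>y. SOME J. good y J)"
    define Y where "Y = (\<lambda>k. ((\<lambda>y t. S t \<psi> + pick y t) ^^ k) (\<lambda>t. S t \<psi>))"
    have Y0: "Y 0 = (\<lambda>t. S t \<psi>)" and YS: "Y (Suc k) = (\<lambda>t. S t \<psi> + pick (Y k) t)" for k
      by (simp_all add: Y_def)
    have good: "good y (pick y)" if "adm \<gamma> T R y" for y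
    proof -
      have "ctrl \<gamma> T P Q (\<lambda>t. \<sigma> (y t))"
        unfolding P_def Q_def by (rule \<sigma>_ctrl[OF that T(2) \<gamma>(1) R(2)])
      from path_exists[OF this PQ T \<gamma>(1) \<gamma>\<eta> x] show ?thesis
        unfolding pick_def good_def by (rule someI_ex)
    qed
    have small: "adm 0 T 1 (pick y)" if y: "adm \<gamma> T R y" for y
    proof -
      have c: "ctrl \<gamma> T P Q (\<lambda>t. \<sigma> (y t))"
        unfolding P_def Q_def by (rule \<sigma>_ctrl[OF that T(2) \<gamma>(1) R(2)])
      have "adm 0 T (path_const \<gamma> * (P + Q) * T powr (\<eta> - \<gamma> - \<alpha>)) (pick y)"
        using good[OF y] unfolding good_def by (intro path_adm[OF c PQ T \<gamma>(1) gap x]) auto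
      then show ?thesis by (rule adm_mono) (use TC in auto)
    qed
    have free: "adm \<gamma> T (L * R0) (\<lambda>t. S t \<psi>)" by (rule free_adm[OF \<psi> T(2)])
    have Y: "adm \<gamma> T R (Y k)" for k
    proof (induction k)
      case 0
      show ?case unfolding Y0 by (rule adm_mono[OF free]) (auto simp: R_def)
    next
      case (Suc k)
      show ?case unfolding YS R_def by (rule adm_add[OF free small[OF Suc]]) (use \<gamma> T in auto)
    qed
    note g = good[OF Y, unfolded good_def]
    have YY: "adm 0 T ((1 / 2) ^ k) (\<lambda>t. Y (Suc k) t - Y k t)" for k
    proof (induction k)
      case 0
      show ?case using small[OF Y[of 0]] by (simp add: YS Y0)
    next
      case (Suc k)
      let ?J = "\<lambda>t. pick (Y (Suc k)) t - pick (Y k) t"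
      have d: "davie \<gamma> T (sewing_const * (P + Q) + sewing_const * (P + Q)) x (\<lambda>t. \<sigma> (Y (Suc k) t) - \<sigma> (Y k t)) (hdelta S ?J)"
        using g[of "Suc k"] g[of k] by (intro davie_diff) auto
      have "davie ((1 + \<omega>) * \<gamma>) T (sewing_const * (P + Q) + sewing_const * (P + Q)) x (\<lambda>t. \<sigma> (Y (Suc k) t) - \<sigma> (Y k t)) (hdelta S ?J)"
        by (rule davie_weaken[OF d]) (use sewing_const PQ T \<omega> \<gamma> in \<open>auto simp: algebra_simps\<close>)
      moreover have "(?J \<longlongrightarrow> 0) (at_right 0)"
        using tendsto_diff[of "pick (Y (Suc k))" 0 _ "pick (Y k)" 0] g[of "Suc k"] g[of k] by auto
      ultimately have "adm 0 T (C * T powr (\<eta> - (1 + \<omega>) * \<gamma> - \<alpha>) * (1 / 2) ^ k) ?J"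
        using contractsD[OF contr x T _ Y Y Suc] by auto
      moreover have "C * T powr (\<eta> - (1 + \<omega>) * \<gamma> - \<alpha>) * (1 / 2) ^ k \<le> (1 / 2) ^ Suc k"
        using mult_right_mono[OF TC(2), of "(1 / 2) ^ k"] by simp
      ultimately have "adm 0 T ((1 / 2) ^ Suc k) ?J" by (rule adm_mono) auto
      then show ?case by (simp add: YS)
    qed
    define y where "y = (\<lambda>t. lim (\<lambda>k. Y k t))"
    have Y_at_0: "Y k 0 = \<psi>" for k
      by (cases k) (use g in \<open>auto simp: YS Y0 S_zero\<close>)
    have y0: "y 0 = \<psi>" unfolding y_def Y_at_0 by (simp add: limI)
    have lim: "(\<lambda>k. Y k t) \<longlonglongrightarrow> y t" if "0 < t" "t \<le> T" for t
    proof -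
      have "convergent (\<lambda>k. Y k t)"
        by (rule convergent_geometric[where c = 1 and q = "1 / 2"]) (use adm_norm[OF YY that] in auto)
      then show ?thesis by (simp add: y_def convergent_LIMSEQ_iff)
    qed
    \<comment> \<open>The bound 2 is the sum of the steps \<open>(1 / 2) ^ k\<close>. Ambient
      convergence alone would not carry the scale-norm bound of the iterates over to the
      limit.\<close>
    have yV: "y t \<in> V \<and> n (y t - Y 0 t) \<le> 2" if "0 < t" "t \<le> T" for t
    proof -
      have *: "Y k t \<in> V" "n (Y (Suc k) t - Y k t) \<le> 1 * (1 / 2) ^ k" for k
        using ctrl_V[OF adm_ctrl[OF Y] that] ctrl_n[OF adm_ctrl[OF YY] that] that by auto
      show ?thesis using V_geometric_limit(1)[OF * _ _ lim[OF that]]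
          V_geometric_limit(2)[OF * _ _ lim[OF that], where k = 0] by auto
    qed
    define R' where "R' = R + 2 + sewing_const * (P + Q)"
    have R': "R + 2 \<le> R'" "sewing_const * (P + Q) \<le> R'" "0 \<le> R'" using R sewing_const PQ by (auto simp: R'_def)
    have "adm \<gamma> T (R + 2) y"
      unfolding adm_def ctrl_def
    proof (intro conjI allI impI)
      fix t assume "0 < t \<and> t \<le> T"
      then have t: "0 < t" "t \<le> T" by auto
      show "y t \<in> V" using yV[OF t] by simp
      have Y0V: "Y 0 t \<in> V" by (rule ctrl_V[OF adm_ctrl[OF Y] t])
      have "n (y t) \<le> n (y t - Y 0 t) + n (Y 0 t)"
        using n_triangle[of "y t - Y 0 t" "Y 0 t"] V_diff yV[OF t] Y0V by simp
      also have "\<dots> \<le> 2 * t powr - \<gamma> + R * t powr - \<gamma>"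
        using yV[OF t] ctrl_n[OF adm_ctrl[OF Y] t, of 0] weight_ge_1[of t \<gamma>] t T \<gamma>
        by (intro add_mono) auto
      finally show "n (y t) \<le> (R + 2) * t powr - \<gamma>" by (simp add: algebra_simps)
      have "norm (y t) \<le> R"
        by (rule tendsto_upperbound[OF tendsto_norm[OF lim[OF t]]]) (use adm_norm[OF Y t] in auto)
      then show "norm (y t) \<le> R + 2" by simp
    next
      fix s t assume "0 < s \<and> s \<le> t \<and> t \<le> T"
      then have st: "0 < s" "s \<le> t" "t \<le> T" by auto
      have "norm (y t - y s) \<le> R * s powr - \<gamma> * (t - s) powr \<alpha>"
        by (rule tendsto_upperbound[OF tendsto_norm[OF tendsto_diff[OF lim lim]]])
          (use ctrl_holder[OF adm_ctrl[OF Y] st] st in auto)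
      also have "\<dots> \<le> (R + 2) * s powr - \<gamma> * (t - s) powr \<alpha>"
        by (intro mult_right_mono) auto
      finally show "norm (y t - y s) \<le> (R + 2) * s powr - \<gamma> * (t - s) powr \<alpha>" .
    qed
    then have 1: "adm \<gamma> T R' y" by (rule adm_mono) (use R' in auto)
    \<comment> \<open>Only ambient norms occur in the remainder, so pointwise convergence suffices;
      the iterate of index \<open>k\<close> sits inside \<sigma>, the next one outside.\<close>
    have "davie \<gamma> T (sewing_const * (P + Q)) x (\<lambda>t. \<sigma> (y t)) (hdelta S y)"
      unfolding davie_def
    proof (intro allI impI)
      fix s t assume "0 < s \<and> s \<le> t \<and> t \<le> T"
      then have st: "0 < s" "s \<le> t" "t \<le> T" by auto
      have bl: "bounded_linear (S (t - s))" using st by (intro S_bounded_linear) auto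
      have "(\<lambda>k. Y (Suc k) t - S (t - s) (Y (Suc k) s) - (x t - x s) *\<^sub>R S (t - s) (\<sigma> (Y k s))) \<longlonglongrightarrow>
          y t - S (t - s) (y s) - (x t - x s) *\<^sub>R S (t - s) (\<sigma> (y s))"
        using st by (intro tendsto_intros bounded_linear.tendsto[OF bl] LIMSEQ_Suc lim \<sigma>_tendsto) auto
      then show "norm (hdelta S y s t - (x t - x s) *\<^sub>R S (t - s) (\<sigma> (y s))) \<le>
          sewing_const * (P + Q) * s powr - \<gamma> * (t - s) powr (\<eta> + \<alpha>)"
        unfolding hdelta_def
      proof (rule tendsto_upperbound[OF tendsto_norm])
        have "norm (Y (Suc k) t - S (t - s) (Y (Suc k) s) - (x t - x s) *\<^sub>R S (t - s) (\<sigma> (Y k s))) \<le>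
          sewing_const * (P + Q) * s powr - \<gamma> * (t - s) powr (\<eta> + \<alpha>)" for k
        proof -
          have "davie \<gamma> T (sewing_const * (P + Q)) x (\<lambda>t. \<sigma> (Y k t)) (hdelta S (\<lambda>t. Y (Suc k) t - S t \<psi>))"
            using g[of k] by (simp add: YS)
          then show ?thesis
            unfolding davie_minus_free using st by (auto dest!: davieD[of _ _ _ _ _ _ s t] simp: hdelta_def)
        qed
        then show "\<forall>\<^sub>F k in sequentially. norm (Y (Suc k) t - S (t - s) (Y (Suc k) s) -
            (x t - x s) *\<^sub>R S (t - s) (\<sigma> (Y k s))) \<le> sewing_const * (P + Q) * s powr - \<gamma> * (t - s) powr (\<eta> + \<alpha>)"
          by simp
      qed simp
    qed
    then have 2: "davie \<gamma> T R' x (\<lambda>t. \<sigma> (y t)) (hdelta S y)"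
      by (rule davie_weaken) (use R' T in auto)
    have bound: "norm (y t - S t \<psi>) \<le> L * (decay_const \<gamma> * (P + Q)) * \<bar>t - 0\<bar> powr (\<eta> - \<gamma>)" if "0 < t" "t \<le> T" for t
    proof (rule tendsto_upperbound[OF tendsto_norm[OF tendsto_diff[OF LIMSEQ_Suc[OF lim[OF that]] tendsto_const]]])
      have "norm (Y (Suc k) t - S t \<psi>) \<le> L * (decay_const \<gamma> * (P + Q)) * \<bar>t - 0\<bar> powr (\<eta> - \<gamma>)" for k
      proof -
        have c: "ctrl \<gamma> T P Q (\<lambda>t. \<sigma> (Y k t))"
          unfolding P_def Q_def by (rule \<sigma>_ctrl[OF Y T(2) \<gamma>(1) R(2)])
        have *: "pick (Y k) t \<in> V \<and> n (pick (Y k) t) \<le> decay_const \<gamma> * (P + Q) * t powr (\<eta> - \<gamma>)"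
          using path_bound[OF c PQ T(2) \<gamma>(1) \<gamma>\<eta> x _ _ that] g[of k] by blast
        then have "norm (pick (Y k) t) \<le> L * n (pick (Y k) t)" by (intro V_norm) auto
        also have "\<dots> \<le> L * (decay_const \<gamma> * (P + Q) * t powr (\<eta> - \<gamma>))"
          using * L by (intro mult_left_mono) auto
        finally show ?thesis using that by (simp add: YS mult_ac)
      qed
      then show "\<forall>\<^sub>F k in sequentially. norm (Y (Suc k) t - S t \<psi>) \<le> L * (decay_const \<gamma> * (P + Q)) * \<bar>t - 0\<bar> powr (\<eta> - \<gamma>)"
        by simp
    qed simp
    have 3: "((\<lambda>t. y t - S t \<psi>) \<longlongrightarrow> 0) (at_right 0)"
    proof (rule Lim_null_comparison)
      show "\<forall>\<^sub>F t in at_right 0. norm (y t - S t \<psi>) \<le> L * (decay_const \<gamma> * (P + Q)) * \<bar>t - 0\<bar> powr (\<eta> - \<gamma>)"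
        unfolding eventually_at_right_field using bound T by (intro exI[of _ T]) auto
      show "((\<lambda>t. L * (decay_const \<gamma> * (P + Q)) * \<bar>t - 0\<bar> powr (\<eta> - \<gamma>)) \<longlongrightarrow> 0) (at_right 0)"
        using tendsto_mult_left[OF powr_tendsto_zero[of "\<eta> - \<gamma>" 0 "{0<..}"], of "L * (decay_const \<gamma> * (P + Q))"] \<gamma>\<eta>
        by simp
    qed
    show ?thesis
      using 1 2 3 y0 R' unfolding sol_def by blast
  qed
  then show ?thesis using T by blast
qed

end

subsection \<open>Uniqueness and continuation\<close>

context rough_nonlinearity
begin

lemma solD:
  assumes "sol \<gamma> T x \<psi> y R"
  shows "0 \<le> R" "y 0 = \<psi>" "adm \<gamma> T R y" "davie \<gamma> T R x (\<lambda>t. \<sigma> (y t)) (hdelta S y)"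
    "((\<lambda>t. y t - S t \<psi>) \<longlongrightarrow> 0) (at_right 0)"
  using assms by (auto simp: sol_def)

lemma sol_restrict:
  assumes s: "sol \<gamma> T x \<psi> y R" and T: "T' \<le> T" "T \<le> 1"
  shows "sol \<gamma> T' x \<psi> y R"
  using solD[OF s] adm_mono[OF solD(3)[OF s] order_refl T(1)]
    davie_weaken[OF solD(4)[OF s] order_refl solD(1)[OF s] order_refl T]
  unfolding sol_def by blast

text \<open>The free orbits cancel, so the difference is an integral path with a finite unweighted
  bound. The integrands are bounded separately; finiteness is all that the contraction needs to
  start.\<close>

lemma sol_difference_adm:
  assumes y: "sol \<gamma> T x \<psi> y R" and z: "sol \<gamma> T x \<psi> z R'" and x: "holder_line \<eta> H x"
    and T: "0 < T" "T \<le> 1" and \<gamma>: "0 \<le> \<gamma>" "\<alpha> + \<gamma> < \<eta>"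
  shows "\<exists>d\<ge>0. adm 0 T d (\<lambda>t. y t - z t)"
    and "davie \<gamma> T (R + R') x (\<lambda>t. \<sigma> (y t) - \<sigma> (z t)) (hdelta S (\<lambda>t. y t - z t))"
    and "((\<lambda>t. y t - z t) \<longlongrightarrow> 0) (at_right 0)"
proof -
  show d: "davie \<gamma> T (R + R') x (\<lambda>t. \<sigma> (y t) - \<sigma> (z t)) (hdelta S (\<lambda>t. y t - z t))"
    by (rule davie_diff[OF solD(4)[OF y] solD(4)[OF z]])
  show l: "((\<lambda>t. y t - z t) \<longlongrightarrow> 0) (at_right 0)"
    using tendsto_diff[OF solD(5)[OF y] solD(5)[OF z]] by simp
  note c = ctrl_combine(2)[OF \<sigma>_ctrl[OF solD(3)[OF y] T(2) \<gamma>(1) solD(1)[OF y]]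
      \<sigma>_ctrl[OF solD(3)[OF z] T(2) \<gamma>(1) solD(1)[OF z]]]
  have P: "0 \<le> \<Lambda> * (1 + R) + \<Lambda> * (1 + R')" and Q: "0 \<le> B * R + B * R'"
    using \<Lambda> B solD(1)[OF y] solD(1)[OF z] by auto
  have "0 \<le> path_const \<gamma>" using path_const \<gamma> \<alpha> by simp
  then have "0 \<le> path_const \<gamma> * (\<Lambda> * (1 + R) + \<Lambda> * (1 + R') + (B * R + B * R')) * T powr (\<eta> - \<gamma> - \<alpha>)"
    using P Q by simp
  with path_adm[OF c P Q T \<gamma> x d l]
  show "\<exists>d\<ge>0. adm 0 T d (\<lambda>t. y t - z t)" by blast
qed

text \<open>On length \<open>h\<close> the contraction halves any bound for the difference, and a
  finite one exists, so the difference vanishes. The argument restarts at multiples of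
  \<open>h\<close> with translated data; \<open>h\<close> does not shrink because the radius
  \<open>R1\<close> is global.\<close>

theorem solution_unique:
  assumes y: "sol \<gamma> T x \<psi> y R" and z: "sol \<gamma> T x \<psi> z R'" and x: "holder_line \<eta> H x"
    and T: "0 < T" "T \<le> 1" and \<gamma>: "0 \<le> \<gamma>" "\<alpha> + (1 + \<omega>) * \<gamma> < \<eta>"
    and t: "0 \<le> t" "t \<le> T"
  shows "y t = z t"
proof -
  note gap = exponent_gap[OF \<gamma>]
  note diff = sol_difference_adm[OF y z x T \<gamma>(1) gap]
  define w where "w = (\<lambda>t. y t - z t)"
  obtain d where d: "0 \<le> d" "adm 0 T d w" using diff(1) unfolding w_def by blast
  define R1 where "R1 = R + R' + 1"
  have R1: "0 < R1" "R \<le> R1" "R' \<le> R1" using solD(1)[OF y] solD(1)[OF z] by (auto simp: R1_def)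
  have yR: "adm \<gamma> T R1 y" and zR: "adm \<gamma> T R1 z"
    using adm_mono[OF solD(3)[OF y] R1(2) order_refl] adm_mono[OF solD(3)[OF z] R1(3) order_refl] by auto
  obtain C where C: "0 \<le> C" and contr: "contracts \<gamma> R1 C"
    using contraction[OF R1(1) \<gamma>] by blast
  define e where "e = \<eta> - (1 + \<omega>) * \<gamma> - \<alpha>"
  obtain h where h: "0 < h" "h \<le> 1" "\<And>T. 0 < T \<Longrightarrow> T \<le> h \<Longrightarrow> C * T powr e \<le> 1 / 2"
    using small_powr[of e "1 / 2" C] \<gamma> C by (auto simp: e_def)
  have \<gamma>': "\<gamma> \<le> (1 + \<omega>) * \<gamma>" using \<gamma> \<omega> by (simp add: algebra_simps)
  have dw: "davie ((1 + \<omega>) * \<gamma>) T (R + R') x (\<lambda>t. \<sigma> (y t) - \<sigma> (z t)) (hdelta S w)"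
    unfolding w_def by (rule davie_weaken[OF diff(2)]) (use \<gamma>' T solD(1)[OF y] solD(1)[OF z] in auto)
  have "\<forall>t. 0 \<le> t \<and> t \<le> T \<and> t \<le> real k * h \<longrightarrow> w t = 0" for k
  proof (induction k)
    case 0
    have "w 0 = 0" using solD(2)[OF y] solD(2)[OF z] by (simp add: w_def)
    then show ?case by (metis mult_zero_left of_nat_0 order_antisym)
  next
    case (Suc k)
    define \<tau> where "\<tau> = real k * h"
    have \<tau>: "0 \<le> \<tau>" "real (Suc k) * h = \<tau> + h" using h by (simp_all add: \<tau>_def algebra_simps)
    show ?case
    proof (cases "\<tau> < T")
      case False
      then show ?thesis using Suc by (auto simp: \<tau>_def)
    next
      case True
      have w\<tau>: "w \<tau> = 0" using Suc True \<tau> by (simp add: \<tau>_def)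
      define T' where "T' = min h (T - \<tau>)"
      have T': "0 < T'" "T' \<le> h" "T' \<le> T - \<tau>" "T' \<le> 1" "T - \<tau> \<le> 1"
        using h True \<tau> T by (auto simp: T'_def)
      have sy: "adm \<gamma> T' R1 (\<lambda>t. y (\<tau> + t))" and sz: "adm \<gamma> T' R1 (\<lambda>t. z (\<tau> + t))"
        and sw: "adm 0 T' d (\<lambda>t. w (\<tau> + t))"
        using adm_mono[OF adm_shift[OF yR \<tau>(1) \<gamma>(1)] order_refl T'(3)]
          adm_mono[OF adm_shift[OF zR \<tau>(1) \<gamma>(1)] order_refl T'(3)]
          adm_mono[OF adm_shift[OF d(2) \<tau>(1) order_refl d(1)] order_refl T'(3)] R1 by auto
      have sd: "davie ((1 + \<omega>) * \<gamma>) T' (R + R') (\<lambda>t. x (\<tau> + t))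
          (\<lambda>t. \<sigma> (y (\<tau> + t)) - \<sigma> (z (\<tau> + t))) (hdelta S (\<lambda>t. w (\<tau> + t)))"
        by (rule davie_weaken[OF davie_shift[OF dw \<tau>(1)]])
          (use T' \<gamma> \<omega> solD(1)[OF y] solD(1)[OF z] in auto)
      \<comment> \<open>At a later restart the limit follows from Hoelder continuity of
        \<open>w\<close> and \<open>w \<tau> = 0\<close>; at time 0 it comes from the two initial
        conditions.\<close>
      have sl: "((\<lambda>t. w (\<tau> + t)) \<longlongrightarrow> 0) (at_right 0)"
      proof (cases "\<tau> = 0")
        case True
        then show ?thesis using diff(3) by (simp add: w_def)
      next
        case False
        show ?thesis
        proof (rule Lim_null_comparison)
          have "norm (w (\<tau> + t)) \<le> d * \<bar>t - 0\<bar> powr \<alpha>" if "0 < t" "t \<le> T'" for t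
            using ctrl_holder[OF adm_ctrl[OF d(2)], of \<tau> "\<tau> + t"] w\<tau> False \<tau> T' that by simp
          then show "\<forall>\<^sub>F t in at_right 0. norm (w (\<tau> + t)) \<le> d * \<bar>t - 0\<bar> powr \<alpha>"
            unfolding eventually_at_right_field using T' by (intro exI[of _ T']) auto
          show "((\<lambda>t. d * \<bar>t - 0\<bar> powr \<alpha>) \<longlongrightarrow> 0) (at_right 0)"
            using tendsto_mult_left[OF powr_tendsto_zero[OF \<alpha>(1), of 0 "{0<..}"], of d] by simp
        qed
      qed
      have half: "adm 0 T' (0 + 1 / 2 * Z) (\<lambda>t. w (\<tau> + t))" if Z: "0 \<le> Z" "adm 0 T' Z (\<lambda>t. w (\<tau> + t))" for Z
      proof -
        have "adm 0 T' (C * T' powr e * Z) (\<lambda>t. w (\<tau> + t))"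
          unfolding e_def
          by (rule contractsD[OF contr holder_line_shift[OF x] T'(1,4) Z(1) sy sz _ sd sl])
            (use Z(2) in \<open>simp add: w_def\<close>)
        moreover have "C * T' powr e * Z \<le> 0 + 1 / 2 * Z"
          using mult_right_mono[OF h(3)[OF T'(1,2)] Z(1)] by simp
        ultimately show ?thesis by (rule adm_mono) simp
      qed
      have small: "adm 0 T' (0 / (1 - 1 / 2) + (1 / 2) ^ m * (d - 0 / (1 - 1 / 2))) (\<lambda>t. w (\<tau> + t))" for m
        by (rule geometric_contraction[of "\<lambda>Z. adm 0 T' Z (\<lambda>t. w (\<tau> + t))"]) (use sw d half in auto)
      have zero: "w (\<tau> + t) = 0" if "0 < t" "t \<le> T'" for t
      proof -
        have "norm (w (\<tau> + t)) \<le> (1 / 2) ^ m * d" for m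
          using adm_norm[OF small[of m] that] by simp
        moreover have "(\<lambda>m. (1 / 2) ^ m * d) \<longlonglongrightarrow> 0"
          using tendsto_mult_right[OF LIMSEQ_power_zero[of "1 / 2 :: real"], of d] by simp
        ultimately have "norm (w (\<tau> + t)) \<le> 0"
          by (intro LIMSEQ_le_const) auto
        then show ?thesis by simp
      qed
      show ?thesis
      proof (intro allI impI)
        fix t assume t: "0 \<le> t \<and> t \<le> T \<and> t \<le> real (Suc k) * h"
        show "w t = 0"
        proof (cases "t \<le> \<tau>")
          case True
          then show ?thesis using Suc t by (auto simp: \<tau>_def)
        next
          case False
          then show ?thesis using zero[of "t - \<tau>"] t \<tau> by (auto simp: T'_def)
        qed
      qed
    qed
  qed
  moreover obtain k :: nat where "T < real k * h" using reals_Archimedean3[OF h(1)] by blast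
  ultimately have "w t = 0" using t by (meson order_trans less_imp_le)
  then show ?thesis by (simp add: w_def)
qed

text \<open>With weight 0 both bounds are uniform in the starting time \<open>s > 0\<close>, and the
  orbit of a datum in \<open>V\<close> converges to it, so \<open>s\<close> may tend to 0. Gluing
  needs these closed versions, its junction being the starting time of the second solution.\<close>

lemma solution_at_start:
  assumes s: "sol 0 T x \<psi> y R" and \<psi>: "\<psi> \<in> V" and t: "0 < t" "t \<le> T" and T: "T \<le> 1"
    and x: "holder_line \<eta> H x"
  shows "norm (y t - \<psi>) \<le> R * t powr \<alpha>"
    and "norm (y t - S t \<psi> - (x t - x 0) *\<^sub>R S t (\<sigma> \<psi>)) \<le> R * t powr (\<eta> + \<alpha>)"
proof -
  have S_lim: "((\<lambda>s. S s u) \<longlongrightarrow> u) (at_right 0)" if "u \<in> V" for u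
  proof -
    have "((\<lambda>s. S s u - u) \<longlongrightarrow> 0) (at_right 0)"
    proof (rule Lim_null_comparison)
      show "\<forall>\<^sub>F s in at_right 0. norm (S s u - u) \<le> L * n u * \<bar>s - 0\<bar> powr \<alpha>"
        unfolding eventually_at_right_field using S_id[OF _ _ that] by (intro exI[of _ 1]) (auto simp: mult_ac)
      show "((\<lambda>s. L * n u * \<bar>s - 0\<bar> powr \<alpha>) \<longlongrightarrow> 0) (at_right 0)"
        using tendsto_mult_left[OF powr_tendsto_zero[OF \<alpha>(1), of 0 "{0<..}"], of "L * n u"] by simp
    qed
    then show ?thesis by (rule LIM_zero_cancel)
  qed
  have y_lim: "(y \<longlongrightarrow> \<psi>) (at_right 0)"
    using tendsto_add[OF solD(5)[OF s] S_lim[OF \<psi>]] by simp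
  have near: "\<forall>\<^sub>F s in at_right 0. 0 < s \<and> s < t"
    unfolding eventually_at_right_field using t by blast
  have powr_lim: "((\<lambda>s. (t - s) powr e) \<longlongrightarrow> t powr e) (at_right 0)" for e
  proof -
    have "((\<lambda>s. (t - s) powr e) \<longlongrightarrow> (t - 0) powr e) (at_right 0)"
      using t by (intro tendsto_intros) auto
    then show ?thesis by simp
  qed
  have R_lim: "((\<lambda>s. R * (t - s) powr e) \<longlongrightarrow> R * t powr e) (at_right 0)" for e
    by (intro tendsto_mult_left powr_lim)
  show "norm (y t - \<psi>) \<le> R * t powr \<alpha>"
  proof (rule tendsto_le[OF _ R_lim[of \<alpha>] tendsto_norm[OF tendsto_diff[OF tendsto_const y_lim]]])
    show "\<forall>\<^sub>F s in at_right 0. norm (y t - y s) \<le> R * (t - s) powr \<alpha>"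
      using near
    proof eventually_elim
      case (elim s)
      then show ?case using ctrl_holder[OF adm_ctrl[OF solD(3)[OF s]], of s t] t by simp
    qed
  qed simp
  have bound: "norm (S (t - r) (u r) - S t l) \<le> L * norm (u r - S r l)" if "0 < r \<and> r < t" for r l and u :: "real \<Rightarrow> 'a"
  proof -
    have "S (t - r) (u r) - S t l = S (t - r) (u r - S r l)"
      using that S_add[of r "t - r" l] by (simp add: S_diff)
    also have "norm \<dots> \<le> L * norm (u r - S r l)" using that t T by (intro S_norm) auto
    finally show ?thesis .
  qed
  \<comment> \<open>It suffices that \<open>u s\<close> follows the orbit of \<open>l\<close>: since
    \<open>S (t - s) (S s l) = S t l\<close>, the moving propagator creates no error of its
    own.\<close>
  have lim: "((\<lambda>s. S (t - s) (u s)) \<longlongrightarrow> S t l) (at_right 0)"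
    if u: "((\<lambda>s. u s - S s l) \<longlongrightarrow> 0) (at_right 0)" for u l
  proof -
    have "((\<lambda>s. S (t - s) (u s) - S t l) \<longlongrightarrow> 0) (at_right 0)"
    proof (rule Lim_null_comparison)
      show "\<forall>\<^sub>F s in at_right 0. norm (S (t - s) (u s) - S t l) \<le> L * norm (u s - S s l)"
        using near by eventually_elim (rule bound)
      show "((\<lambda>s. L * norm (u s - S s l)) \<longlongrightarrow> 0) (at_right 0)"
        using tendsto_mult_left[OF tendsto_norm_zero[OF u], of L] by simp
    qed
    then show ?thesis by (rule LIM_zero_cancel)
  qed
  have \<sigma>_lim: "((\<lambda>s. \<sigma> (y s) - S s (\<sigma> \<psi>)) \<longlongrightarrow> 0) (at_right 0)"
    using tendsto_diff[OF \<sigma>_tendsto[OF y_lim] S_lim[OF \<sigma>_V[OF \<psi>]]] by simp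
  have x_lim: "(x \<longlongrightarrow> x 0) (at_right 0)"
    using holder_line_continuous_on[OF \<eta>(1) x, of UNIV]
    by (metis UNIV_I continuous_on_def filterlim_at_split filterlim_def order_refl tendsto_within_subset subset_UNIV)
  show "norm (y t - S t \<psi> - (x t - x 0) *\<^sub>R S t (\<sigma> \<psi>)) \<le> R * t powr (\<eta> + \<alpha>)"
  proof (rule tendsto_le[OF _ R_lim[of "\<eta> + \<alpha>"]])
    show "((\<lambda>s. norm (y t - S (t - s) (y s) - (x t - x s) *\<^sub>R S (t - s) (\<sigma> (y s)))) \<longlongrightarrow>
        norm (y t - S t \<psi> - (x t - x 0) *\<^sub>R S t (\<sigma> \<psi>))) (at_right 0)"
      by (intro tendsto_intros lim solD(5)[OF s] \<sigma>_lim x_lim)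
    show "\<forall>\<^sub>F s in at_right 0. norm (y t - S (t - s) (y s) - (x t - x s) *\<^sub>R S (t - s) (\<sigma> (y s))) \<le>
        R * (t - s) powr (\<eta> + \<alpha>)"
      using near
    proof eventually_elim
      case (elim s)
      then show ?case using davieD[OF solD(4)[OF s], of s t] t by (simp add: hdelta_def)
    qed
  qed simp
qed

section \<open>Shifting and gluing solutions\<close>

lemma sol_V: "sol \<gamma> T x \<psi> y R \<Longrightarrow> 0 < t \<Longrightarrow> t \<le> T \<Longrightarrow> y t \<in> V"
  by (rule ctrl_V[OF adm_ctrl[OF solD(3)]])

text \<open>Since \<open>y \<tau>\<close> lies in \<open>V\<close>, its orbit converges to it, and
  Hoelder continuity of \<open>y\<close> yields the initial condition at \<tau>.\<close>

lemma sol_shift: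
  assumes s: "sol 0 T x \<psi> y R" and \<tau>: "0 < \<tau>" "\<tau> < T" and T: "T \<le> 1"
  shows "sol 0 (T - \<tau>) (\<lambda>t. x (\<tau> + t)) (y \<tau>) (\<lambda>t. y (\<tau> + t)) R"
proof -
  note R = solD(1)[OF s]
  have yV: "y \<tau> \<in> V" by (rule sol_V[OF s]) (use \<tau> in auto)
  have "((\<lambda>t. y (\<tau> + t) - S t (y \<tau>)) \<longlongrightarrow> 0) (at_right 0)"
  proof (rule Lim_null_comparison)
    have "norm (y (\<tau> + t) - S t (y \<tau>)) \<le> (R + L * n (y \<tau>)) * \<bar>t - 0\<bar> powr \<alpha>" if "0 < t" "t \<le> T - \<tau>" for t
    proof -
      have "norm (y (\<tau> + t) - S t (y \<tau>)) \<le> norm (y (\<tau> + t) - y \<tau>) + norm (S t (y \<tau>) - y \<tau>)"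
        using norm_triangle_ineq4[of "y (\<tau> + t) - y \<tau>" "S t (y \<tau>) - y \<tau>"] by simp
      also have "\<dots> \<le> R * t powr \<alpha> + L * t powr \<alpha> * n (y \<tau>)"
        using ctrl_holder[OF adm_ctrl[OF solD(3)[OF s]], of \<tau> "\<tau> + t"] S_id[OF _ _ yV, of t] \<tau> that T
        by (intro add_mono) auto
      finally show ?thesis using that by (simp add: algebra_simps)
    qed
    then show "\<forall>\<^sub>F t in at_right 0. norm (y (\<tau> + t) - S t (y \<tau>)) \<le> (R + L * n (y \<tau>)) * \<bar>t - 0\<bar> powr \<alpha>"
      unfolding eventually_at_right_field using \<tau> by (intro exI[of _ "T - \<tau>"]) auto
    show "((\<lambda>t. (R + L * n (y \<tau>)) * \<bar>t - 0\<bar> powr \<alpha>) \<longlongrightarrow> 0) (at_right 0)"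
      using tendsto_mult_left[OF powr_tendsto_zero[OF \<alpha>(1), of 0 "{0<..}"], of "R + L * n (y \<tau>)"] by simp
  qed
  moreover have "adm 0 (T - \<tau>) R (\<lambda>t. y (\<tau> + t))"
    by (rule adm_shift[OF solD(3)[OF s]]) (use \<tau> R in auto)
  moreover have "davie 0 (T - \<tau>) R (\<lambda>t. x (\<tau> + t)) (\<lambda>t. \<sigma> (y (\<tau> + t))) (hdelta S (\<lambda>t. y (\<tau> + t)))"
    using davie_shift[OF solD(4)[OF s], of \<tau>] \<tau> R by auto
  ultimately show ?thesis using R by (simp add: sol_def)
qed

text \<open>Only intervals that straddle \<open>a\<close> are new. There the remainder splits into
  those of both sides, the left one propagated, plus a product of Hoelder increments. The second
  piece has weight 0, which the weight \<gamma> dominates on times up to 1.\<close>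

lemma sol_concat:
  assumes y: "sol \<gamma> a x \<psi> y R" and a: "0 < a" and z: "sol 0 h (\<lambda>t. x (a + t)) (y a) z R'"
    and h: "0 < h" "a + h \<le> 1" and \<gamma>: "0 \<le> \<gamma>" and x: "holder_line \<eta> H x"
  shows "\<exists>R. sol \<gamma> (a + h) x \<psi> (\<lambda>t. if t \<le> a then y t else z (t - a)) R"
proof -
  define w where "w = (\<lambda>t. if t \<le> a then y t else z (t - a))"
  note R = solD(1)[OF y] and R' = solD(1)[OF z]
  note cy = adm_ctrl[OF solD(3)[OF y]] and cz = adm_ctrl[OF solD(3)[OF z]]
  have ya: "y a \<in> V" by (rule sol_V[OF y]) (use a in auto)
  note x' = holder_line_shift[OF x, of a]
  have h1: "h \<le> 1" using h a by simp
  note start = solution_at_start[OF z ya _ _ h1 x']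
  define P where "P = \<Lambda> * (1 + R)"
  define Q where "Q = B * R"
  have PQ: "0 \<le> P" "0 \<le> Q" using R \<Lambda> B by (auto simp: P_def Q_def)
  have c\<sigma>: "ctrl \<gamma> a P Q (\<lambda>t. \<sigma> (y t))"
    unfolding P_def Q_def by (rule \<sigma>_ctrl[OF solD(3)[OF y] _ \<gamma> R]) (use h in auto)
  define R2 where "R2 = R + R' + L * R + H * (L * (L * (P + Q)))"
  have R2: "R \<le> R2" "R' \<le> R2" "R + R' \<le> R2" "R' + L * R + H * (L * (L * (P + Q))) \<le> R2" "0 \<le> R2"
    using R R' L H PQ by (auto simp: R2_def)
  have le: "c * s powr - \<gamma> * e \<le> R2 * s powr - \<gamma> * e" if "c \<le> R2" "0 \<le> e" for c s e :: real
    using that by (intro mult_right_mono) auto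
  have w1: "1 \<le> s powr - \<gamma>" if "0 < s" "s \<le> a + h" for s
    using that h \<gamma> by (intro weight_ge_1) auto
  have "adm \<gamma> (a + h) R2 w"
    unfolding adm_def ctrl_def
  proof (intro conjI allI impI)
    fix s assume s: "0 < s \<and> s \<le> a + h"
    have "w s \<in> V \<and> n (w s) \<le> R2 * s powr - \<gamma> \<and> norm (w s) \<le> R2"
    proof (cases "s \<le> a")
      case True
      have "n (y s) \<le> R2 * s powr - \<gamma>"
        by (rule order_trans[OF ctrl_n[OF cy] mult_right_mono[OF R2(1)]]) (use True s in auto)
      then show ?thesis
        using ctrl_V[OF cy, of s] adm_norm[OF solD(3)[OF y], of s] s R2 True
        by (auto simp: w_def)
    next
      case False
      then have "z (s - a) \<in> V" "n (z (s - a)) \<le> R'" "norm (z (s - a)) \<le> R'"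
        using ctrl_V[OF cz, of "s - a"] ctrl_n[OF cz, of "s - a"] adm_norm[OF solD(3)[OF z], of "s - a"] s
        by auto
      moreover have "R' \<le> R2 * s powr - \<gamma>"
        using mult_mono[OF R2(2) w1[of s]] R2 s by auto
      ultimately show ?thesis using False R2 by (auto simp: w_def)
    qed
    then show "w s \<in> V" "n (w s) \<le> R2 * s powr - \<gamma>" "norm (w s) \<le> R2" by auto
  next
    fix s t assume st: "0 < s \<and> s \<le> t \<and> t \<le> a + h"
    consider "t \<le> a" | "s \<le> a" "a < t" | "a < s" by linarith
    then show "norm (w t - w s) \<le> R2 * s powr - \<gamma> * (t - s) powr \<alpha>"
    proof cases
      case 1
      then show ?thesis
        using order_trans[OF ctrl_holder[OF cy] le[OF R2(1)], of s t] st by (auto simp: w_def)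
    next
      case 2
      have "norm (z (t - a) - y s) \<le> norm (z (t - a) - y a) + norm (y a - y s)"
        using norm_triangle_ineq[of "z (t - a) - y a" "y a - y s"] by simp
      also have "\<dots> \<le> R' * (t - a) powr \<alpha> + R * s powr - \<gamma> * (a - s) powr \<alpha>"
        using start(1)[of "t - a"] ctrl_holder[OF cy, of s a] 2 st by (intro add_mono) auto
      also have "\<dots> \<le> (R' * s powr - \<gamma>) * (t - s) powr \<alpha> + R * s powr - \<gamma> * (t - s) powr \<alpha>"
        using 2 st \<alpha> R R' mult_left_mono[OF w1[of s] R']
        by (intro add_mono mult_mono[of R'] mult_left_mono powr_mono2) auto
      also have "\<dots> = (R + R') * s powr - \<gamma> * (t - s) powr \<alpha>" by (simp add: algebra_simps)
      also have "\<dots> \<le> R2 * s powr - \<gamma> * (t - s) powr \<alpha>" by (rule le[OF R2(3)]) simp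
      finally show ?thesis using 2 by (simp add: w_def)
    next
      case 3
      have "norm (z (t - a) - z (s - a)) \<le> R' * (t - s) powr \<alpha>"
        using ctrl_holder[OF cz, of "s - a" "t - a"] 3 st by simp
      also have "\<dots> \<le> R2 * s powr - \<gamma> * (t - s) powr \<alpha>"
        using mult_mono[OF R2(2) w1[of s]] R2 st by (intro mult_right_mono) auto
      finally show ?thesis using 3 st by (simp add: w_def)
    qed
  qed
  moreover have "davie \<gamma> (a + h) R2 x (\<lambda>t. \<sigma> (w t)) (hdelta S w)"
    unfolding davie_def
  proof (intro allI impI)
    fix s t assume st: "0 < s \<and> s \<le> t \<and> t \<le> a + h"
    let ?p = "\<eta> + \<alpha>"
    consider "t \<le> a" | "s \<le> a" "a < t" | "a < s" by linarith
    then show "norm (hdelta S w s t - (x t - x s) *\<^sub>R S (t - s) (\<sigma> (w s))) \<le> R2 * s powr - \<gamma> * (t - s) powr ?p"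
    proof cases
      case 1
      then show ?thesis
        using order_trans[OF davieD[OF solD(4)[OF y]] le[OF R2(1)], of s t] st
        by (auto simp: w_def hdelta_def)
    next
      case 2
      define Dz where "Dz = z (t - a) - S (t - a) (y a) - (x t - x a) *\<^sub>R S (t - a) (\<sigma> (y a))"
      define Dy where "Dy = hdelta S y s a - (x a - x s) *\<^sub>R S (a - s) (\<sigma> (y s))"
      have SS: "S (t - a) (S (a - s) u) = S (t - s) u" for u
        using S_add[of "a - s" "t - a" u] 2 by simp
      have ta: "0 \<le> t - a" "t - a \<le> 1" using 2 st h1 by auto
      have SDy: "S (t - a) Dy = S (t - a) (y a) - S (t - s) (y s) - (x a - x s) *\<^sub>R S (t - s) (\<sigma> (y s))"
        using ta by (simp add: Dy_def hdelta_def S_diff S_scaleR SS)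
      have S\<sigma>: "S (t - a) (hdelta S (\<lambda>t. \<sigma> (y t)) s a) = S (t - a) (\<sigma> (y a)) - S (t - s) (\<sigma> (y s))"
        using ta by (simp add: hdelta_def S_diff SS)
      \<comment> \<open>The increment of \<open>x\<close> is split at \<open>a\<close>. Exchanging
        \<open>S (t - s) (\<sigma> (y s))\<close> for \<open>S (t - a) (\<sigma> (y a))\<close> on
        the right part creates the last term, of order \<eta> in \<open>x\<close> and \<alpha> in
        the integrand.\<close>
      have "hdelta S w s t - (x t - x s) *\<^sub>R S (t - s) (\<sigma> (w s)) =
          Dz + S (t - a) Dy + (x t - x a) *\<^sub>R S (t - a) (hdelta S (\<lambda>t. \<sigma> (y t)) s a)"
        unfolding SDy S\<sigma> using 2 by (simp add: w_def hdelta_def Dz_def algebra_simps)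
      also have "norm \<dots> \<le> norm Dz + norm (S (t - a) Dy) + \<bar>x t - x a\<bar> * norm (S (t - a) (hdelta S (\<lambda>t. \<sigma> (y t)) s a))"
        by (intro norm_triangle_le add_mono) auto
      also have "\<dots> \<le> (R' * s powr - \<gamma>) * (t - s) powr ?p + L * (R * s powr - \<gamma> * (t - s) powr ?p) +
          (H * (t - s) powr \<eta>) * (L * (L * (P + Q) * s powr - \<gamma> * (t - s) powr \<alpha>))"
      proof (intro add_mono)
        have "norm Dz \<le> R' * (t - a) powr ?p"
          using start(2)[of "t - a"] 2 st by (simp add: Dz_def)
        also have "\<dots> \<le> (R' * s powr - \<gamma>) * (t - s) powr ?p"
          using 2 st \<alpha> \<eta> R' w1[of s] mult_left_mono[OF w1[of s] R'] by (intro mult_mono powr_mono2) auto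
        finally show "norm Dz \<le> (R' * s powr - \<gamma>) * (t - s) powr ?p" .
        have "norm (S (t - a) Dy) \<le> L * norm Dy" by (rule S_norm[OF ta])
        also have "\<dots> \<le> L * (R * s powr - \<gamma> * (a - s) powr ?p)"
          unfolding Dy_def using davieD[OF solD(4)[OF y], of s a] 2 st L by (intro mult_left_mono) auto
        also have "\<dots> \<le> L * (R * s powr - \<gamma> * (t - s) powr ?p)"
          using 2 st \<alpha> \<eta> R L by (intro mult_left_mono powr_mono2) auto
        finally show "norm (S (t - a) Dy) \<le> L * (R * s powr - \<gamma> * (t - s) powr ?p)" .
        show "\<bar>x t - x a\<bar> * norm (S (t - a) (hdelta S (\<lambda>t. \<sigma> (y t)) s a)) \<le>
            (H * (t - s) powr \<eta>) * (L * (L * (P + Q) * s powr - \<gamma> * (t - s) powr \<alpha>))"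
        proof (rule mult_mono)
          have "\<bar>x t - x a\<bar> \<le> H * \<bar>t - a\<bar> powr \<eta>" by (rule holder_lineD[OF x])
          also have "\<dots> \<le> H * (t - s) powr \<eta>" using 2 H \<eta> by (intro mult_left_mono powr_mono2) auto
          finally show "\<bar>x t - x a\<bar> \<le> H * (t - s) powr \<eta>" .
          have "norm (S (t - a) (hdelta S (\<lambda>t. \<sigma> (y t)) s a)) \<le> L * norm (hdelta S (\<lambda>t. \<sigma> (y t)) s a)"
            by (rule S_norm[OF ta])
          also have "\<dots> \<le> L * (L * (P + Q) * s powr - \<gamma> * (a - s) powr \<alpha>)"
            using ctrl_hdelta[OF c\<sigma> PQ _ _ \<open>s \<le> a\<close>] st h L by (intro mult_left_mono) auto
          also have "\<dots> \<le> L * (L * (P + Q) * s powr - \<gamma> * (t - s) powr \<alpha>)"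
            using 2 \<alpha> L PQ by (intro mult_left_mono powr_mono2) auto
          finally show "norm (S (t - a) (hdelta S (\<lambda>t. \<sigma> (y t)) s a)) \<le>
              L * (L * (P + Q) * s powr - \<gamma> * (t - s) powr \<alpha>)" .
        qed (use H in auto)
      qed
      also have "\<dots> = (R' + L * R + H * (L * (L * (P + Q)))) * s powr - \<gamma> * (t - s) powr ?p"
        by (simp add: powr_add algebra_simps)
      also have "\<dots> \<le> R2 * s powr - \<gamma> * (t - s) powr ?p" by (rule le[OF R2(4)]) simp
      finally show ?thesis .
    next
      case 3
      have "norm (hdelta S w s t - (x t - x s) *\<^sub>R S (t - s) (\<sigma> (w s))) \<le> R' * (t - s) powr ?p"
        using davieD[OF solD(4)[OF z], of "s - a" "t - a"] 3 st by (simp add: w_def hdelta_def)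
      also have "\<dots> \<le> R2 * s powr - \<gamma> * (t - s) powr ?p"
        using mult_mono[OF R2(2) w1[of s]] R2 st by (intro mult_right_mono) auto
      finally show ?thesis .
    qed
  qed
  moreover have "((\<lambda>t. w t - S t \<psi>) \<longlongrightarrow> 0) (at_right 0)"
  proof (rule tendsto_cong[THEN iffD1, OF _ solD(5)[OF y]])
    show "\<forall>\<^sub>F t in at_right 0. y t - S t \<psi> = w t - S t \<psi>"
      unfolding eventually_at_right_field using a by (intro exI[of _ a]) (auto simp: w_def)
  qed
  moreover have "w 0 = \<psi>" using a solD(2)[OF y] by (simp add: w_def)
  ultimately have "sol \<gamma> (a + h) x \<psi> w R2" using R2 by (simp add: sol_def)
  then show ?thesis unfolding w_def by blast
qed

text \<open>Linear growth makes the improvement of a bound \<open>Z\<close> affine with slope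
  \<open>1 / 2\<close>, on a step length \<open>h\<close> independent of the solution. Iterating
  removes the bound \<open>R\<close> of the solution and leaves one that is affine in the size of
  \<psi>.\<close>

lemma apriori_step:
  assumes "\<alpha> < \<eta>"
  shows "\<exists>h C. 0 < h \<and> h \<le> 1 \<and> 0 \<le> C \<and> (\<forall>T x \<psi> y R t. holder_line \<eta> H x \<longrightarrow> 0 < T \<longrightarrow> T \<le> h \<longrightarrow>
    \<psi> \<in> V \<longrightarrow> sol 0 T x \<psi> y R \<longrightarrow> 0 \<le> t \<longrightarrow> t \<le> T \<longrightarrow> n (y t) \<le> C * (1 + n \<psi>))"
proof -
  have gap: "\<alpha> + 0 < \<eta>" "(0::real) < \<eta>" using assms \<eta> by auto
  have c50: "0 \<le> path_const 0 * (\<Lambda> + B)" using path_const[OF gap(2)] \<Lambda> B by simp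
  obtain h where h: "0 < h" "h \<le> 1" "\<And>T. 0 < T \<Longrightarrow> T \<le> h \<Longrightarrow> path_const 0 * (\<Lambda> + B) * T powr (\<eta> - 0 - \<alpha>) \<le> 1 / 2"
    using small_powr[of "\<eta> - 0 - \<alpha>" "1 / 2" "path_const 0 * (\<Lambda> + B)"] c50 assms by auto
  define C where "C = 2 * (L * (L * L)) + 1"
  have C: "0 \<le> C" "1 \<le> C" using L by (auto simp: C_def)
  have "n (y t) \<le> C * (1 + n \<psi>)"
    if x: "holder_line \<eta> H x" and T: "0 < T" "T \<le> h" and \<psi>: "\<psi> \<in> V" and y: "sol 0 T x \<psi> y R"
      and t: "0 \<le> t" "t \<le> T" for T x \<psi> y R t
  proof (cases "t = 0")
    case True
    have "n \<psi> \<le> 1 * (1 + n \<psi>)" by simp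
    also have "\<dots> \<le> C * (1 + n \<psi>)" using C n_nonneg[OF \<psi>] by (intro mult_right_mono) auto
    finally show ?thesis using True solD(2)[OF y] by simp
  next
    case False
    have T1: "T \<le> 1" using T h by simp
    define A where "A = L * (L * L * n \<psi>)"
    have A: "0 \<le> A" using L n_nonneg[OF \<psi>] by (simp add: A_def)
    have free: "adm 0 T A (\<lambda>t. S t \<psi>)"
      unfolding A_def by (rule free_adm[OF init_V[OF \<psi> order_refl] T1])
    have d: "davie 0 T R x (\<lambda>t. \<sigma> (y t)) (hdelta S (\<lambda>t. y t - S t \<psi>))"
      unfolding davie_minus_free by (rule solD(4)[OF y])
    have step: "adm 0 T ((A + 1 / 2) + 1 / 2 * Z) y" if Z: "0 \<le> Z" "adm 0 T Z y" for Z
    proof -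
      have c: "ctrl 0 T (\<Lambda> * (1 + Z)) (B * Z) (\<lambda>t. \<sigma> (y t))"
        by (rule \<sigma>_ctrl[OF Z(2) T1 order_refl Z(1)])
      have J: "adm 0 T (path_const 0 * (\<Lambda> * (1 + Z) + B * Z) * T powr (\<eta> - 0 - \<alpha>)) (\<lambda>t. y t - S t \<psi>)"
        by (rule path_adm[OF c _ _ T(1) T1 order_refl gap(1) x d solD(5)[OF y]]) (use \<Lambda> B Z in auto)
      have "path_const 0 * (\<Lambda> * (1 + Z) + B * Z) * T powr (\<eta> - 0 - \<alpha>) \<le> path_const 0 * ((\<Lambda> + B) * (1 + Z)) * T powr (\<eta> - 0 - \<alpha>)"
        using path_const[OF gap(2)] \<Lambda> B Z by (intro mult_right_mono mult_left_mono) (auto simp: algebra_simps)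
      also have "\<dots> = (path_const 0 * (\<Lambda> + B) * T powr (\<eta> - 0 - \<alpha>)) * (1 + Z)" by (simp add: mult_ac)
      also have "\<dots> \<le> 1 / 2 * (1 + Z)" using h(3)[OF T] Z by (intro mult_right_mono) auto
      finally have J': "adm 0 T (1 / 2 * (1 + Z)) (\<lambda>t. y t - S t \<psi>)"
        by (rule adm_mono[OF J]) simp
      have "adm 0 T (A + 1 / 2 * (1 + Z)) (\<lambda>t. S t \<psi> + (y t - S t \<psi>))"
        by (rule adm_add[OF free J']) (use Z T1 in auto)
      then show ?thesis by (simp add: algebra_simps add_divide_distrib)
    qed
    let ?b = "(A + 1 / 2) / (1 - 1 / 2)"
    have *: "adm 0 T (?b + (1 / 2) ^ m * (R - ?b)) y" for m
      by (rule geometric_contraction[of "\<lambda>Z. adm 0 T Z y"]) (use solD(1,3)[OF y] step A in auto)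
    have "n (y t) \<le> ?b + (1 / 2) ^ m * (R - ?b)" for m
      using ctrl_n[OF adm_ctrl[OF *[of m]], of t] t False by simp
    then have "n (y t) \<le> ?b"
      by (intro LIMSEQ_le_const[OF geometric_contraction_tendsto[of "1 / 2" ?b "R - ?b"]]) auto
    also have "?b = 2 * (L * (L * L)) * n \<psi> + 1" by (simp add: A_def)
    also have "\<dots> \<le> C * (1 + n \<psi>)"
      using L n_nonneg[OF \<psi>] by (simp add: C_def algebra_simps)
    finally show ?thesis .
  qed
  then show ?thesis using h C by (intro exI[of _ h] exI[of _ C]) auto
qed

text \<open>The step estimate is iterated at multiples of \<open>h\<close> along shifted solutions.
  As \<open>h\<close> and \<open>C\<close> do not depend on the solution, finitely many steps cover
  the unit interval.\<close>

lemma apriori_bound: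
  assumes "\<alpha> < \<eta>"
  shows "\<exists>R1. \<forall>T x \<psi> y R t. holder_line \<eta> H x \<longrightarrow> 0 < T \<longrightarrow> T \<le> 1 \<longrightarrow>
    \<psi> \<in> V \<longrightarrow> n \<psi> \<le> R0 \<longrightarrow> sol 0 T x \<psi> y R \<longrightarrow> 0 \<le> t \<longrightarrow> t \<le> T \<longrightarrow> n (y t) \<le> R1"
proof -
  obtain h C where h: "0 < h" "h \<le> 1" "0 \<le> C" and step: "\<forall>T x \<psi> y R t. holder_line \<eta> H x \<longrightarrow> 0 < T \<longrightarrow> T \<le> h \<longrightarrow>
    \<psi> \<in> V \<longrightarrow> sol 0 T x \<psi> y R \<longrightarrow> 0 \<le> t \<longrightarrow> t \<le> T \<longrightarrow> n (y t) \<le> C * (1 + n \<psi>)"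
    using apriori_step[OF assms] by blast
  note step = step[rule_format]
  \<comment> \<open>Adding \<open>r\<close> to the step bound makes \<open>b\<close> increasing, so
    it covers all earlier times; the absolute value secures nonnegativity.\<close>
  define b where "b = (\<lambda>k. ((\<lambda>r. r + C * (1 + r)) ^^ k) \<bar>R0\<bar>)"
  have b0: "b 0 = \<bar>R0\<bar>" and bS: "b (Suc k) = b k + C * (1 + b k)" for k by (simp_all add: b_def)
  have b: "0 \<le> b k" for k by (induction k) (use h in \<open>auto simp: b0 bS\<close>)
  have main: "n (y t) \<le> b k"
    if x: "holder_line \<eta> H x" and T: "0 < T" "T \<le> 1" and \<psi>: "\<psi> \<in> V" "n \<psi> \<le> R0" and y: "sol 0 T x \<psi> y R"
      and t: "0 \<le> t" "t \<le> T" "t \<le> real k * h" for T x \<psi> y R t k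
    using t
  proof (induction k arbitrary: t)
    case 0
    then show ?case using solD(2)[OF y] \<psi> by (simp add: b0)
  next
    case (Suc k)
    define \<tau> where "\<tau> = real k * h"
    have \<tau>: "0 \<le> \<tau>" using h by (simp add: \<tau>_def)
    show ?case
    proof (cases "t \<le> \<tau>")
      case True
      then have "n (y t) \<le> b k" using Suc by (simp add: \<tau>_def)
      also have "\<dots> \<le> b (Suc k)" using b[of k] h by (simp add: bS)
      finally show ?thesis .
    next
      case False
      have y\<tau>: "n (y \<tau>) \<le> b k" by (rule Suc.IH) (use \<tau> False Suc.prems in \<open>auto simp: \<tau>_def\<close>)
      have "n (y t) \<le> C * (1 + n (y \<tau>))"
      proof (cases "\<tau> = 0")
        case True
        have "sol 0 t x \<psi> y R" by (rule sol_restrict[OF y]) (use Suc.prems T in auto)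
        from step[OF x _ _ \<psi>(1) this, of t] show ?thesis
          using False True \<tau> Suc.prems solD(2)[OF y] by (simp add: \<tau>_def algebra_simps)
      next
        case \<tau>0: False
        have "sol 0 t x \<psi> y R" by (rule sol_restrict[OF y]) (use Suc.prems T in auto)
        then have "sol 0 (t - \<tau>) (\<lambda>t. x (\<tau> + t)) (y \<tau>) (\<lambda>t. y (\<tau> + t)) R"
          by (rule sol_shift) (use \<tau> \<tau>0 False Suc.prems T in auto)
        from step[OF holder_line_shift[OF x] _ _ _ this, of "t - \<tau>"] show ?thesis
          using False \<tau> \<tau>0 Suc.prems sol_V[OF y, of \<tau>] by (simp add: \<tau>_def algebra_simps)
      qed
      also have "\<dots> \<le> C * (1 + b k)" using y\<tau> h by (intro mult_left_mono) auto
      also have "\<dots> \<le> b (Suc k)" using b[of k] by (simp add: bS)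
      finally show ?thesis .
    qed
  qed
  obtain k :: nat where k: "1 < real k * h" using reals_Archimedean3[OF h(1)] by blast
  show ?thesis
    by (intro exI[of _ "b k"] allI impI main) (use k in auto)
qed

text \<open>The a priori bound keeps every restart value in one ball of \<open>V\<close>, so the
  local existence time \<open>h\<close> is the same at each restart and finitely many steps reach
  \<open>b\<close>.\<close>

lemma global_existence_regular:
  assumes gap: "\<alpha> < \<eta>" and x: "holder_line \<eta> H x" and \<psi>: "\<psi> \<in> V" and b: "0 < b" "b \<le> 1"
  shows "\<exists>y R. sol 0 b x \<psi> y R"
proof -
  obtain R1 where R1: "\<forall>T x \<psi>' y R t. holder_line \<eta> H x \<longrightarrow> 0 < T \<longrightarrow> T \<le> 1 \<longrightarrow>
    \<psi>' \<in> V \<longrightarrow> n \<psi>' \<le> n \<psi> \<longrightarrow> sol 0 T x \<psi>' y R \<longrightarrow> 0 \<le> t \<longrightarrow> t \<le> T \<longrightarrow> n (y t) \<le> R1"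
    using apriori_bound[OF gap] by blast
  note R1 = R1[rule_format, OF x _ _ \<psi> order_refl]
  \<comment> \<open>The maximum covers the very first step, where there is no solution yet to which
    \<open>R1\<close> could be applied.\<close>
  define R2 where "R2 = max R1 (n \<psi>)"
  have R2: "0 \<le> L * L * R2" using L n_nonneg[OF \<psi>] by (simp add: R2_def)
  have "\<alpha> + (1 + \<omega>) * 0 < \<eta>" using gap by simp
  from local_existence[OF order_refl this R2] obtain h where h: "0 < h" "h \<le> 1"
    and loc: "\<forall>x \<psi>. holder_line \<eta> H x \<longrightarrow> init 0 (L * L * R2) \<psi> \<longrightarrow> (\<exists>y R. sol 0 h x \<psi> y R)"
    by blast
  note loc = loc[rule_format]
  have "\<exists>y R. sol 0 (min (real (Suc k) * h) b) x \<psi> y R" for k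
  proof (induction k)
    case 0
    obtain y R where y: "sol 0 h x \<psi> y R"
      using loc[OF x init_V[OF \<psi>]] by (auto simp: R2_def)
    have "sol 0 (min (real (Suc 0) * h) b) x \<psi> y R" by (rule sol_restrict[OF y]) (use h in auto)
    then show ?case by blast
  next
    case (Suc k)
    define a where "a = min (real (Suc k) * h) b"
    have a: "0 < a" "a \<le> b" using h b by (auto simp: a_def)
    obtain y R where y: "sol 0 a x \<psi> y R" using Suc unfolding a_def by blast
    show ?case
    proof (cases "b \<le> real (Suc k) * h")
      case True
      then have "min (real (Suc (Suc k)) * h) b = a" using h by (simp add: a_def algebra_simps)
      then show ?thesis using y by metis
    next
      case False
      define h' where "h' = min h (b - a)"
      have a': "a = real (Suc k) * h" using False by (simp add: a_def)
      have h': "0 < h'" "h' \<le> h" "a + h' \<le> 1" "a + h' = min (real (Suc (Suc k)) * h) b"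
        using False h b a a' by (auto simp: h'_def algebra_simps)
      have ya: "y a \<in> V" "n (y a) \<le> R2"
        using sol_V[OF y, of a] R1[OF _ _ y, of a] a b by (auto simp: R2_def)
      obtain z R' where "sol 0 h (\<lambda>t. x (a + t)) (y a) z R'"
        using loc[OF holder_line_shift[OF x] init_V[OF ya]] by blast
      then have "sol 0 h' (\<lambda>t. x (a + t)) (y a) z R'" by (rule sol_restrict) (use h h' in auto)
      from sol_concat[OF y a(1) this h'(1,3) order_refl x] show ?thesis unfolding h'(4) by blast
    qed
  qed
  moreover obtain k :: nat where "b < real k * h" using reals_Archimedean3[OF h(1)] by blast
  then have "min (real (Suc k) * h) b = b" using h by (simp add: algebra_simps)
  ultimately show ?thesis by metis
qed

theorem global_existence:
  assumes \<gamma>: "0 \<le> \<gamma>" "\<alpha> + (1 + \<omega>) * \<gamma> < \<eta>" and x: "holder_line \<eta> H x" and \<psi>: "init \<gamma> R0 \<psi>"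
  shows "\<exists>y R. sol \<gamma> 1 x \<psi> y R"
proof -
  have gap: "\<alpha> < \<eta>" using exponent_gap[OF \<gamma>] \<gamma> by simp
  have "0 \<le> R0" using \<psi> by (simp add: init_def)
  from local_existence[OF \<gamma> this] obtain T y R where T: "0 < T" "T \<le> 1" and y: "sol \<gamma> T x \<psi> y R"
    using x \<psi> by blast
  show ?thesis
  proof (cases "T = 1")
    case True
    then show ?thesis using y by blast
  next
    case False
    have "\<exists>z R'. sol 0 (1 - T) (\<lambda>t. x (T + t)) (y T) z R'"
      by (rule global_existence_regular[OF gap holder_line_shift[OF x] sol_V[OF y T(1) order_refl]])
        (use False T in auto)
    then obtain z R' where "sol 0 (1 - T) (\<lambda>t. x (T + t)) (y T) z R'" by blast
    from sol_concat[OF y T(1) this _ _ \<gamma>(1) x] show ?thesis using False T by auto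
  qed
qed

end

subsection \<open>Mild solutions\<close>

lemma continuous_into_norm: "continuous_into T UNIV norm f \<longleftrightarrow> continuous_on T f"
  by (simp add: continuous_into_def continuous_on_def tendsto_norm_zero_iff LIM_zero_iff)

lemma simplex_coordinates_tendsto:
  "(fst \<longlongrightarrow> s) (at (s, t) within A)" "(snd \<longlongrightarrow> t) (at (s, t) within A)"
  using tendsto_fst[OF tendsto_ident_at, of "(s, t)" A] tendsto_snd[OF tendsto_ident_at, of "(s, t)" A]
  by simp_all

lemma eventually_within: "(\<And>q. q \<in> A \<Longrightarrow> P q) \<Longrightarrow> \<forall>\<^sub>F q in at p within A. P q"
  by (auto simp: eventually_at_filter)

context smoothing
begin

lemma n_nonneg_diff: "u \<in> V \<Longrightarrow> v \<in> V \<Longrightarrow> 0 \<le> n (u - v)"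
  by (intro n_nonneg V_diff)

lemma n_null_comparison:
  assumes "\<forall>\<^sub>F q in F. f q \<in> V \<and> n (f q) \<le> g q" "(g \<longlongrightarrow> 0) F"
  shows "((\<lambda>q. n (f q)) \<longlongrightarrow> 0) F"
  by (rule Lim_null_comparison[OF _ assms(2)])
    (use assms(1) in \<open>auto elim!: eventually_mono simp: n_nonneg\<close>)

lemma hdelta_diag: "hdelta S f s s = 0"
  by (simp add: hdelta_def S_zero)

lemma n_null_norm:
  assumes "\<forall>\<^sub>F q in F. f q \<in> V" "((\<lambda>q. n (f q)) \<longlongrightarrow> 0) F"
  shows "(f \<longlongrightarrow> 0) F"
proof (rule Lim_null_comparison)
  show "\<forall>\<^sub>F q in F. norm (f q) \<le> L * n (f q)"
    using assms(1) by eventually_elim (rule V_norm)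
  show "((\<lambda>q. L * n (f q)) \<longlongrightarrow> 0) F" using tendsto_mult_left[OF assms(2), of L] by simp
qed

lemma n_null_diff:
  assumes "\<forall>\<^sub>F q in F. f q \<in> V \<and> g q \<in> V"
    and "((\<lambda>q. n (f q)) \<longlongrightarrow> 0) F" "((\<lambda>q. n (g q)) \<longlongrightarrow> 0) F"
  shows "((\<lambda>q. n (f q - g q)) \<longlongrightarrow> 0) F"
proof (rule n_null_comparison)
  show "\<forall>\<^sub>F q in F. f q - g q \<in> V \<and> n (f q - g q) \<le> n (f q) + n (g q)"
    using assms(1) by eventually_elim (simp add: V_diff n_triangle4)
  show "((\<lambda>q. n (f q) + n (g q)) \<longlongrightarrow> 0) F" using tendsto_add[OF assms(2,3)] by simp
qed

lemma continuous_into_compose: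
  fixes T :: "'b::t2_space set"
  assumes "continuous_into T V n f" "p \<in> T" "\<forall>\<^sub>F q in F. g q \<in> T" "(g \<longlongrightarrow> p) F"
  shows "((\<lambda>q. n (f (g q) - f p)) \<longlongrightarrow> 0) F"
proof -
  have "continuous (at p within T) (\<lambda>q. n (f q - f p))"
    using assms(1,2) by (simp add: continuous_into_def continuous_within n_zero)
  from continuous_within_tendsto_compose[OF this assms(3,4)] show ?thesis by (simp add: n_zero)
qed

lemma continuous_into_continuous_on:
  assumes "continuous_into T V n f"
  shows "continuous_on T f"
  unfolding continuous_on_def
proof
  fix p assume p: "p \<in> T"
  have "((\<lambda>q. f q - f p) \<longlongrightarrow> 0) (at p within T)"
    by (rule n_null_norm) (use assms p in \<open>auto simp: continuous_into_def intro!: eventually_within V_diff\<close>)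
  then show "(f \<longlongrightarrow> f p) (at p within T)" by (rule LIM_zero_cancel)
qed

text \<open>Joint continuity of time and datum at positive times, from smoothing alone: half of the
  time moves \<open>l\<close> into \<open>V\<close>, where \<open>S_id\<close> controls a small
  change of time, and the other half returns from the ambient space to \<open>V\<close>.\<close>

lemma S_V_tendsto:
  assumes \<tau>0: "0 < \<tau>0" "\<tau>0 \<le> 1" and \<tau>: "(\<tau> \<longlongrightarrow> \<tau>0) F" "\<forall>\<^sub>F q in F. \<tau> q \<le> 1" and f: "(f \<longlongrightarrow> l) F"
  shows "((\<lambda>q. n (S (\<tau> q) (f q) - S \<tau>0 l)) \<longlongrightarrow> 0) F"
    and "\<forall>\<^sub>F q in F. S (\<tau> q) (f q) - S \<tau>0 l \<in> V"
proof -
  have ev: "\<forall>\<^sub>F q in F. \<tau>0 / 2 < \<tau> q \<and> \<tau> q \<le> 1"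
    using order_tendstoD(1)[OF \<tau>(1), of "\<tau>0 / 2"] \<tau>(2) \<tau>0 by (simp add: eventually_conj_iff)
  \<comment> \<open>Close to \<open>\<tau>0\<close> all times exceed \<open>\<tau>0 / 2\<close>;
    splitting them in half accounts for \<open>\<tau>0 / 4\<close>.\<close>
  define D where "D = L * (\<tau>0 / 4) powr - \<alpha> * (L * (L * (\<tau>0 / 4) powr - \<alpha> * norm l))"
  have D: "0 \<le> D" using L by (simp add: D_def)
  have small: "(m / 2) powr - \<alpha> \<le> (\<tau>0 / 4) powr - \<alpha>" if "\<tau>0 / 2 \<le> m" for m
    using that \<tau>0 \<alpha> by (intro powr_mono2') auto
  have time: "n (S M l - S m l) \<le> D * (M - m) powr \<alpha>" if m: "\<tau>0 / 2 \<le> m" "m \<le> M" "M \<le> 1" for m M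
  proof -
    have m2: "0 < m / 2" "m / 2 \<le> 1" using m \<tau>0 by auto
    define v where "v = S (m / 2) l"
    have v: "v \<in> V" unfolding v_def by (rule S_smooth_V[OF m2])
    have "S M l = S (m / 2) (S (M - m) v)" "S m l = S (m / 2) v"
      using S_add[of "m / 2" "M - m" l] S_add[of "M - m / 2" "m / 2" l] S_add[of "m / 2" "m / 2" l] m \<tau>0
      by (simp_all add: v_def)
    then have "S M l - S m l = S (m / 2) (S (M - m) v - v)"
      using m2 by (simp add: S_diff)
    then have "n (S M l - S m l) \<le> L * (m / 2) powr - \<alpha> * norm (S (M - m) v - v)"
      using S_smooth[OF m2] by simp
    also have "\<dots> \<le> L * (\<tau>0 / 4) powr - \<alpha> * (L * (M - m) powr \<alpha> * n v)"
      using small[OF m(1)] L m \<tau>0 by (intro mult_mono mult_left_mono S_id v) auto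
    also have "\<dots> \<le> L * (\<tau>0 / 4) powr - \<alpha> * (L * (M - m) powr \<alpha> * (L * (\<tau>0 / 4) powr - \<alpha> * norm l))"
    proof -
      have "n v \<le> L * (m / 2) powr - \<alpha> * norm l" unfolding v_def by (rule S_smooth[OF m2])
      also have "\<dots> \<le> L * (\<tau>0 / 4) powr - \<alpha> * norm l"
        using small[OF m(1)] L by (intro mult_right_mono mult_left_mono) auto
      finally show ?thesis using L by (intro mult_left_mono) auto
    qed
    finally show ?thesis by (simp add: D_def mult_ac)
  qed
  have SV: "S t u \<in> V" if "\<tau>0 / 2 \<le> t" "t \<le> 1" for t u
    by (rule S_smooth_V) (use that \<tau>0 in auto)
  show "\<forall>\<^sub>F q in F. S (\<tau> q) (f q) - S \<tau>0 l \<in> V"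
    using ev by eventually_elim (use SV \<tau>0 in \<open>auto intro: V_diff\<close>)
  show "((\<lambda>q. n (S (\<tau> q) (f q) - S \<tau>0 l)) \<longlongrightarrow> 0) F"
  proof (rule n_null_comparison)
    show "\<forall>\<^sub>F q in F. S (\<tau> q) (f q) - S \<tau>0 l \<in> V \<and> n (S (\<tau> q) (f q) - S \<tau>0 l) \<le>
        L * (\<tau>0 / 2) powr - \<alpha> * norm (f q - l) + D * \<bar>\<tau> q - \<tau>0\<bar> powr \<alpha>"
      using ev
    proof eventually_elim
      case (elim q)
      then have \<tau>q: "0 < \<tau> q" "\<tau> q \<le> 1" "\<tau>0 / 2 \<le> \<tau> q" using \<tau>0 by auto
      have V': "S (\<tau> q) (f q - l) \<in> V" "S (\<tau> q) l \<in> V" "S \<tau>0 l \<in> V"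
        using SV[OF \<tau>q(3,2)] SV[of \<tau>0] \<tau>0 by auto
      have eq: "S (\<tau> q) (f q) - S \<tau>0 l = S (\<tau> q) (f q - l) + (S (\<tau> q) l - S \<tau>0 l)"
        using \<tau>q by (simp add: S_diff)
      have 1: "n (S (\<tau> q) (f q - l)) \<le> L * (\<tau>0 / 2) powr - \<alpha> * norm (f q - l)"
      proof -
        have "n (S (\<tau> q) (f q - l)) \<le> L * \<tau> q powr - \<alpha> * norm (f q - l)" by (rule S_smooth[OF \<tau>q(1,2)])
        also have "\<dots> \<le> L * (\<tau>0 / 2) powr - \<alpha> * norm (f q - l)"
          using \<tau>q \<tau>0 \<alpha> L by (intro mult_right_mono mult_left_mono powr_mono2') auto
        finally show ?thesis .
      qed
      have 2: "n (S (\<tau> q) l - S \<tau>0 l) \<le> D * \<bar>\<tau> q - \<tau>0\<bar> powr \<alpha>"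
      proof (cases "\<tau>0 \<le> \<tau> q")
        case True
        then show ?thesis using time[of \<tau>0 "\<tau> q"] \<tau>q \<tau>0 by simp
      next
        case False
        then show ?thesis
          using time[of "\<tau> q" \<tau>0] \<tau>q \<tau>0 n_minus_commute[OF V'(2,3)] by simp
      qed
      show ?case
        unfolding eq using 1 2 n_triangle[OF V'(1) V_diff[OF V'(2,3)]] V' by (auto intro: V_plus V_diff)
    qed
    have "((\<lambda>q. \<bar>\<tau> q - \<tau>0\<bar> powr \<alpha>) \<longlongrightarrow> \<bar>\<tau>0 - \<tau>0\<bar> powr \<alpha>) F"
      using \<alpha> by (intro tendsto_powr' tendsto_intros \<tau>) auto
    then have "((\<lambda>q. L * (\<tau>0 / 2) powr - \<alpha> * norm (f q - l) + D * \<bar>\<tau> q - \<tau>0\<bar> powr \<alpha>) \<longlongrightarrow>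
        L * (\<tau>0 / 2) powr - \<alpha> * norm (l - l) + D * \<bar>\<tau>0 - \<tau>0\<bar> powr \<alpha>) F"
      by (intro tendsto_add tendsto_mult tendsto_const tendsto_norm tendsto_diff f)
    then show "((\<lambda>q. L * (\<tau>0 / 2) powr - \<alpha> * norm (f q - l) + D * \<bar>\<tau> q - \<tau>0\<bar> powr \<alpha>) \<longlongrightarrow> 0) F"
      by simp
  qed
qed

lemma S_tendsto:
  assumes "0 < \<tau>0" "\<tau>0 \<le> 1" "(\<tau> \<longlongrightarrow> \<tau>0) F" "\<forall>\<^sub>F q in F. \<tau> q \<le> 1" "(f \<longlongrightarrow> l) F"
  shows "((\<lambda>q. S (\<tau> q) (f q)) \<longlongrightarrow> S \<tau>0 l) F"
  by (rule LIM_zero_cancel, rule n_null_norm) (use S_V_tendsto[OF assms] in auto)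

text \<open>Continuity at \<open>t0\<close> is seen from a slightly earlier \<open>r\<close>:
  increments from \<open>r\<close> are small by the Hoelder bound, and
  \<open>S (t - r) (y r)\<close> is continuous in \<open>t\<close> by smoothing. A direct comparison
  would involve the semigroup on \<open>V\<close> near time 0, where it need not be
  continuous.\<close>

lemma path_continuous:
  assumes \<kappa>: "0 < \<kappa>" and E: "0 \<le> E"
    and inc: "\<And>s t. 0 < s \<Longrightarrow> s \<le> t \<Longrightarrow> t \<le> 1 \<Longrightarrow> hdelta S y s t \<in> V \<and> n (hdelta S y s t) \<le> E * (t - s) powr \<kappa>"
    and yV: "\<And>t. 0 < t \<Longrightarrow> t \<le> 1 \<Longrightarrow> y t \<in> V"
  shows "continuous_into {0<..1} V n y"
  unfolding continuous_into_def
proof (intro conjI ballI)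
  show "y ` {0<..1} \<subseteq> V" using yV by auto
  fix t0 :: real assume "t0 \<in> {0<..1}"
  then have t0: "0 < t0" "t0 \<le> 1" by auto
  show "((\<lambda>t. n (y t - y t0)) \<longlongrightarrow> 0) (at t0 within {0<..1})"
  proof (rule tendstoI)
    fix e :: real assume e: "0 < e"
    obtain h0 where h0: "0 < h0" "\<And>h. 0 < h \<Longrightarrow> h \<le> h0 \<Longrightarrow> 2 * E * h powr \<kappa> \<le> e / 2"
      using small_powr[of \<kappa> "e / 2" "2 * E"] \<kappa> E e by auto
    define h where "h = min h0 (t0 / 2)"
    define r where "r = t0 - h"
    have h: "0 < h" "2 * E * h powr \<kappa> \<le> e / 2" using h0 t0 by (auto simp: h_def)
    have r: "0 < r" "r < t0" "t0 - r = h" using h t0 by (auto simp: r_def h_def)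
    let ?g = "\<lambda>t. E * (t - r) powr \<kappa> + E * (t0 - r) powr \<kappa> + n (S (t - r) (y r) - S (t0 - r) (y r))"
    have "((\<lambda>t. (t - r) powr \<kappa>) \<longlongrightarrow> (t0 - r) powr \<kappa>) (at t0 within {0<..1})"
      using r by (intro tendsto_intros) auto
    moreover have "((\<lambda>t. n (S (t - r) (y r) - S (t0 - r) (y r))) \<longlongrightarrow> 0) (at t0 within {0<..1})"
      using r t0 by (intro S_V_tendsto tendsto_intros eventually_within) auto
    ultimately have "(?g \<longlongrightarrow> E * (t0 - r) powr \<kappa> + E * (t0 - r) powr \<kappa> + 0) (at t0 within {0<..1})"
      by (intro tendsto_add tendsto_mult tendsto_const)
    moreover have "E * (t0 - r) powr \<kappa> + E * (t0 - r) powr \<kappa> + 0 < e"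
      using h e r by simp
    ultimately have "\<forall>\<^sub>F t in at t0 within {0<..1}. ?g t < e" by (rule order_tendstoD)
    moreover have "\<forall>\<^sub>F t in at t0 within {0<..1}. r < t"
      using r by (intro order_tendstoD(1)[OF tendsto_ident_at])
    moreover have "\<forall>\<^sub>F t in at t0 within {0<..1}. t \<in> {0<..1}" by (rule eventually_within)
    ultimately show "\<forall>\<^sub>F t in at t0 within {0<..1}. dist (n (y t - y t0)) 0 < e"
    proof eventually_elim
      case (elim t)
      have i: "hdelta S y r t \<in> V" "n (hdelta S y r t) \<le> E * (t - r) powr \<kappa>"
        "hdelta S y r t0 \<in> V" "n (hdelta S y r t0) \<le> E * (t0 - r) powr \<kappa>"
        using inc[of r t] inc[of r t0] elim r t0 by auto
      have SV: "S (t - r) (y r) \<in> V" "S (t0 - r) (y r) \<in> V"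
        using elim r t0 by (auto intro!: S_smooth_V)
      have "y t - y t0 = (hdelta S y r t - hdelta S y r t0) + (S (t - r) (y r) - S (t0 - r) (y r))"
        by (simp add: hdelta_def)
      then have "n (y t - y t0) \<le> n (hdelta S y r t - hdelta S y r t0) + n (S (t - r) (y r) - S (t0 - r) (y r))"
        using n_triangle[OF V_diff[OF i(1,3)] V_diff[OF SV]] by simp
      also have "\<dots> \<le> ?g t"
        using n_triangle4[OF i(1,3)] i by simp
      finally show ?case
        using elim n_nonneg_diff[OF yV yV, of t t0] t0 by simp
    qed
  qed
qed

lemma convolved_tendsto:
  assumes f: "continuous_on {0<..1} f" and st: "0 < s" "s < t" "t \<le> 1"
  shows "((\<lambda>q. S (snd q - fst q) (f (fst q))) \<longlongrightarrow> S (t - s) (f s)) (at (s, t) within lopen_simplex2 0 1)"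
proof (rule S_tendsto)
  show "((\<lambda>q. snd q - fst q) \<longlongrightarrow> t - s) (at (s, t) within lopen_simplex2 0 1)"
    by (intro tendsto_intros simplex_coordinates_tendsto)
  show "\<forall>\<^sub>F q in at (s, t) within lopen_simplex2 0 1. snd q - fst q \<le> 1"
    by (rule eventually_within) (auto simp: lopen_simplex2_def)
  show "((\<lambda>q. f (fst q)) \<longlongrightarrow> f s) (at (s, t) within lopen_simplex2 0 1)"
    by (rule continuous_on_tendsto_compose[OF f simplex_coordinates_tendsto(1)])
      (use st in \<open>auto intro!: eventually_within simp: lopen_simplex2_def\<close>)
qed (use st in auto)

text \<open>On the diagonal the propagator has length 0 and smoothing is void; the Hoelder bound
  takes its place.\<close>

lemma diagonal_tendsto:
  fixes F :: "real \<Rightarrow> real \<Rightarrow> 'b::real_normed_vector"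
  assumes \<kappa>: "0 < \<kappa>" and s: "0 < s"
    and bound: "\<And>s t. 0 < s \<Longrightarrow> s \<le> t \<Longrightarrow> t \<le> 1 \<Longrightarrow> norm (F s t) \<le> C * s powr - \<gamma> * (t - s) powr \<kappa>"
  shows "((\<lambda>q. F (fst q) (snd q)) \<longlongrightarrow> 0) (at (s, s) within lopen_simplex2 0 1)"
proof (rule Lim_null_comparison)
  let ?F = "at (s, s) within lopen_simplex2 0 1"
  show "\<forall>\<^sub>F q in ?F. norm (F (fst q) (snd q)) \<le> C * fst q powr - \<gamma> * (snd q - fst q) powr \<kappa>"
    by (rule eventually_within) (auto simp: lopen_simplex2_def intro!: bound)
  have "((\<lambda>q. (snd q - fst q) powr \<kappa>) \<longlongrightarrow> (s - s) powr \<kappa>) ?F"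
    using \<kappa> by (intro tendsto_powr' tendsto_intros simplex_coordinates_tendsto disjI2 conjI eventually_within)
      (auto simp: lopen_simplex2_def)
  moreover have "((\<lambda>q. C * fst q powr - \<gamma>) \<longlongrightarrow> C * s powr - \<gamma>) ?F"
    using s by (intro tendsto_intros simplex_coordinates_tendsto) auto
  ultimately have "((\<lambda>q. C * fst q powr - \<gamma> * (snd q - fst q) powr \<kappa>) \<longlongrightarrow> C * s powr - \<gamma> * (s - s) powr \<kappa>) ?F"
    by (rule tendsto_mult[rotated])
  then show "((\<lambda>q. C * fst q powr - \<gamma> * (snd q - fst q) powr \<kappa>) \<longlongrightarrow> 0) ?F"
    by simp
qed

lemma hdelta_continuous_on:
  assumes f: "continuous_on {0<..1} f"
    and bound: "\<And>s t. 0 < s \<Longrightarrow> s \<le> t \<Longrightarrow> t \<le> 1 \<Longrightarrow> norm (hdelta S f s t) \<le> C * s powr - \<gamma> * (t - s) powr \<kappa>"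
    and \<kappa>: "0 < \<kappa>"
  shows "continuous_on (lopen_simplex2 0 1) (\<lambda>(s, t). hdelta S f s t)"
  unfolding continuous_on_def
proof
  fix p assume "p \<in> lopen_simplex2 0 1"
  then obtain s t where p: "p = (s, t)" and st: "0 < s" "s \<le> t" "t \<le> 1"
    by (auto simp: lopen_simplex2_def)
  let ?F = "at (s, t) within lopen_simplex2 0 1"
  have "((\<lambda>q. hdelta S f (fst q) (snd q)) \<longlongrightarrow> hdelta S f s t) ?F"
  proof (cases "s = t")
    case True
    have "((\<lambda>q. hdelta S f (fst q) (snd q)) \<longlongrightarrow> 0) ?F"
      using diagonal_tendsto[OF \<kappa> st(1) bound] True by simp
    then show ?thesis using True by (simp add: hdelta_def S_zero)
  next
    case False
    have "((\<lambda>q. f (snd q)) \<longlongrightarrow> f t) ?F"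
      by (rule continuous_on_tendsto_compose[OF f simplex_coordinates_tendsto(2)])
        (use st in \<open>auto intro!: eventually_within simp: lopen_simplex2_def\<close>)
    then show ?thesis
      unfolding hdelta_def using False st by (intro tendsto_diff convolved_tendsto[OF f]) auto
  qed
  then show "((\<lambda>(s, t). hdelta S f s t) \<longlongrightarrow> (case p of (s, t) \<Rightarrow> hdelta S f s t)) (at p within lopen_simplex2 0 1)"
    by (simp add: p case_prod_unfold)
qed

end

context smoothing
begin

text \<open>Provides what \<open>Y_space\<close> and the extension to time 0 ask for. Setting
  \<open>J 0 = 0\<close> makes \<open>hdelta S J 0 t = J t\<close>, so decay of \<open>J\<close>
  becomes the Hoelder bound at \<open>s = 0\<close> and the closed simplex is covered.\<close>

lemma path_regularity:
  assumes c: "ctrl \<gamma> 1 P Q \<phi>" and P: "0 \<le> P" and Q: "0 \<le> Q" and \<gamma>: "0 \<le> \<gamma>" "\<alpha> + \<gamma> < \<eta>"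
    and x: "holder_line \<eta> H x" and d: "davie \<gamma> 1 C x \<phi> (hdelta S J)"
    and J: "(J \<longlongrightarrow> 0) (at_right 0)" and J0: "J 0 = 0"
  shows "continuous_into {0<..1} V n J"
    and "continuous_on {0..1} J"
    and "\<exists>E\<ge>0. \<forall>s t. 0 \<le> s \<longrightarrow> s \<le> t \<longrightarrow> t \<le> 1 \<longrightarrow>
      hdelta S J s t \<in> V \<and> n (hdelta S J s t) \<le> E * (t - s) powr (\<eta> - \<gamma>)"
    and "continuous_into (simplex2 0 1) V n (\<lambda>(s, t). hdelta S J s t)"
proof -
  have \<gamma>': "\<gamma> < \<eta>" using \<gamma> \<alpha> by simp
  have \<kappa>: "0 < \<eta> - \<gamma>" using \<gamma>' by simp
  define E where "E = (decay_const \<gamma> + holder_const \<gamma>) * (P + Q)"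
  have c34: "0 \<le> decay_const \<gamma>" "0 \<le> holder_const \<gamma>" using decay_const holder_const \<gamma>' by auto
  have E: "0 \<le> E" "decay_const \<gamma> * (P + Q) \<le> E" "holder_const \<gamma> * (P + Q) \<le> E"
    using c34 P Q by (auto simp: E_def intro!: mult_right_mono)
  have JV: "J t \<in> V \<and> n (J t) \<le> E * t powr (\<eta> - \<gamma>)" if "0 < t" "t \<le> 1" for t
    using path_bound[OF c P Q order_refl \<gamma>(1) \<gamma>' x d J that] mult_right_mono[OF E(2), of "t powr (\<eta> - \<gamma>)"]
    by auto
  have inc: "hdelta S J s t \<in> V \<and> n (hdelta S J s t) \<le> E * (t - s) powr (\<eta> - \<gamma>)"
    if st: "0 \<le> s" "s \<le> t" "t \<le> 1" for s t
  proof (cases "0 < s")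
    case True
    then show ?thesis
      using kernel_V(1)[OF c P Q order_refl \<gamma>(1) x chen_hdelta d True st(2,3)]
        kernel_holder[OF c P Q order_refl \<gamma>(1) \<gamma>' x chen_hdelta d True st(2,3)]
        mult_right_mono[OF E(3), of "(t - s) powr (\<eta> - \<gamma>)"] by auto
  next
    case False
    then have s: "s = 0" using st by simp
    then have "hdelta S J s t = J t" using st J0 by (simp add: hdelta_def S_zero_right)
    then show ?thesis using JV[of t] st s J0 by (cases "t = 0") (auto simp: V_zero n_zero)
  qed
  then show "\<exists>E\<ge>0. \<forall>s t. 0 \<le> s \<longrightarrow> s \<le> t \<longrightarrow> t \<le> 1 \<longrightarrow>
      hdelta S J s t \<in> V \<and> n (hdelta S J s t) \<le> E * (t - s) powr (\<eta> - \<gamma>)" using E by blast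
  show JC: "continuous_into {0<..1} V n J"
    by (rule path_continuous[OF \<kappa> E(1)]) (use inc JV in auto)
  obtain G where G: "adm 0 1 G J" using path_adm[OF c P Q _ order_refl \<gamma> x d J] by auto
  show J_cont: "continuous_on {0..1} J"
  proof (rule holder_continuous_on[OF \<alpha>(1)])
    fix s t :: real assume st: "s \<in> {0..1}" "t \<in> {0..1}" "s \<le> t"
    show "norm (J t - J s) \<le> (\<bar>G\<bar> + L * E) * (t - s) powr \<alpha>"
    proof (cases "0 < s")
      case True
      have "norm (J t - J s) \<le> G * (t - s) powr \<alpha>"
        using ctrl_holder[OF adm_ctrl[OF G] True, of t] True st by auto
      also have "\<dots> \<le> (\<bar>G\<bar> + L * E) * (t - s) powr \<alpha>"
        using L E(1) by (intro mult_right_mono add_increasing2) auto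
      finally show ?thesis .
    next
      case False
      then have s: "s = 0" using st by simp
      show ?thesis
      proof (cases "t = 0")
        case False
        then have t: "0 < t" "t \<le> 1" using st s by auto
        have "norm (J t) \<le> L * n (J t)" using JV[OF t] by (intro V_norm) auto
        also have "\<dots> \<le> L * (E * t powr (\<eta> - \<gamma>))" using JV[OF t] L by (intro mult_left_mono) auto
        also have "\<dots> \<le> L * (E * t powr \<alpha>)"
          using L E(1) t \<gamma> by (intro mult_left_mono powr_mono') auto
        also have "\<dots> \<le> (\<bar>G\<bar> + L * E) * t powr \<alpha>" by (simp add: algebra_simps)
        finally show ?thesis by (simp add: s J0)
      qed (simp add: s)
    qed
  qed
  show "continuous_into (simplex2 0 1) V n (\<lambda>(s, t). hdelta S J s t)"
    unfolding continuous_into_def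
  proof (intro conjI ballI)
    show "(\<lambda>(s, t). hdelta S J s t) ` simplex2 0 1 \<subseteq> V" using inc by (auto simp: simplex2_def)
    fix p assume "p \<in> simplex2 0 1"
    then obtain s t where p: "p = (s, t)" and st: "0 \<le> s" "s \<le> t" "t \<le> 1"
      by (auto simp: simplex2_def)
    let ?F = "at (s, t) within simplex2 0 1"
    \<comment> \<open>Diagonal points, including the origin, use the Hoelder bound. Off the diagonal
      the propagator keeps a positive length, so ambient continuity of \<open>J\<close> at
      \<open>s\<close>, possibly 0, is enough.\<close>
    have "((\<lambda>q. n (hdelta S J (fst q) (snd q) - hdelta S J s t)) \<longlongrightarrow> 0) ?F"
    proof (cases "s = t")
      case True
      show ?thesis
      proof (rule n_null_comparison)
        show "\<forall>\<^sub>F q in ?F. hdelta S J (fst q) (snd q) - hdelta S J s t \<in> V \<and>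
            n (hdelta S J (fst q) (snd q) - hdelta S J s t) \<le> E * (snd q - fst q) powr (\<eta> - \<gamma>)"
          by (rule eventually_within) (use inc True in \<open>auto simp: simplex2_def hdelta_diag\<close>)
        have "((\<lambda>q. (snd q - fst q) powr (\<eta> - \<gamma>)) \<longlongrightarrow> (t - s) powr (\<eta> - \<gamma>)) ?F"
          using \<kappa> by (intro tendsto_powr' tendsto_intros simplex_coordinates_tendsto disjI2 conjI eventually_within)
            (auto simp: simplex2_def)
        from tendsto_mult_left[OF this, of E] show "((\<lambda>q. E * (snd q - fst q) powr (\<eta> - \<gamma>)) \<longlongrightarrow> 0) ?F"
          using True by simp
      qed
    next
      case False
      then have st': "s < t" "0 < t" using st by auto
      have ev: "\<forall>\<^sub>F q in ?F. snd q \<in> {0<..1}"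
      proof -
        have "\<forall>\<^sub>F q in ?F. snd q \<le> 1" by (rule eventually_within) (auto simp: simplex2_def)
        with order_tendstoD(1)[OF simplex_coordinates_tendsto(2) st'(2)] show ?thesis
          by eventually_elim simp
      qed
      have 1: "((\<lambda>q. n (J (snd q) - J t)) \<longlongrightarrow> 0) ?F"
        by (rule continuous_into_compose[OF JC _ ev simplex_coordinates_tendsto(2)]) (use st st' in auto)
      have evJ: "\<forall>\<^sub>F q in ?F. J (snd q) - J t \<in> V"
        using ev by eventually_elim (use JV st st' in \<open>auto intro: V_diff\<close>)
      have f: "((\<lambda>q. J (fst q)) \<longlongrightarrow> J s) ?F"
        by (rule continuous_on_tendsto_compose[OF J_cont simplex_coordinates_tendsto(1)])
          (use st in \<open>auto intro!: eventually_within simp: simplex2_def\<close>)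
      have \<tau>: "((\<lambda>q. snd q - fst q) \<longlongrightarrow> t - s) ?F" "\<forall>\<^sub>F q in ?F. snd q - fst q \<le> 1"
        by (auto intro!: tendsto_intros simplex_coordinates_tendsto eventually_within simp: simplex2_def)
      have ts: "0 < t - s" "t - s \<le> 1" using st st' by auto
      note 2 = S_V_tendsto[OF ts \<tau> f]
      have "((\<lambda>q. n ((J (snd q) - J t) - (S (snd q - fst q) (J (fst q)) - S (t - s) (J s)))) \<longlongrightarrow> 0) ?F"
        by (rule n_null_diff[OF _ 1 2(1)]) (use evJ 2(2) in eventually_elim, simp)
      then show ?thesis by (simp add: hdelta_def algebra_simps)
    qed
    then show "((\<lambda>q. n ((case q of (s, t) \<Rightarrow> hdelta S J s t) - (case p of (s, t) \<Rightarrow> hdelta S J s t))) \<longlongrightarrow> 0)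
        (at p within simplex2 0 1)"
      by (simp add: p case_prod_unfold)
  qed
qed

end

text \<open>The extension to \<open>s = 0\<close> is defined by \<open>Lim\<close>, which determines
  a value only along a nontrivial filter. The maximum in the approximating points keeps them above
  the diagonal.\<close>

lemma lopen_simplex2_limit_point:
  assumes "0 \<le> t" "t \<le> 1"
  shows "at (0, t) within lopen_simplex2 0 1 \<noteq> bot"
proof -
  have "(0, t) islimpt lopen_simplex2 0 1"
    unfolding islimpt_approachable
  proof (intro allI impI)
    fix e :: real assume e: "0 < e"
    define \<delta> where "\<delta> = min 1 (e / 3)"
    have \<delta>: "0 < \<delta>" "\<delta> \<le> 1" "2 * \<delta> < e" using e by (auto simp: \<delta>_def)
    have "dist (\<delta>, max \<delta> t) (0, t) \<le> \<bar>\<delta>\<bar> + \<bar>max \<delta> t - t\<bar>"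
      unfolding dist_Pair_Pair dist_real_def using sqrt_sum_squares_le_sum_abs[of \<delta> "max \<delta> t - t"] by simp
    also have "\<dots> < e" using \<delta> assms by (auto simp: max_def)
    finally show "\<exists>x'\<in>lopen_simplex2 0 1. x' \<noteq> (0, t) \<and> dist x' (0, t) < e"
      using \<delta> assms by (intro bexI[of _ "(\<delta>, max \<delta> t)"]) (auto simp: lopen_simplex2_def)
  qed
  then show ?thesis by (simp add: trivial_limit_within)
qed

text \<open>The estimates live in one space of the scale. The other spaces return because the
  definition of the integral admits remainders in any \<open>Xs \<beta>'\<close>; their embeddings
  into the ambient space suffice to compare these.\<close>

locale scaled_problem = rough_nonlinearity S "Xs \<alpha>" "N \<alpha>" \<alpha> L \<eta> H \<sigma> \<omega> \<Lambda> B
  for S :: "real \<Rightarrow> 'a::banach \<Rightarrow> 'a" and Xs N \<alpha> L \<eta> H \<sigma> \<omega> \<Lambda> B +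
  assumes Xs_zero: "Xs 0 = UNIV" and N_zero: "N 0 = norm"
    and Xs_norm: "0 \<le> l \<Longrightarrow> l < 2 \<Longrightarrow> \<exists>K\<ge>0. \<forall>u\<in>Xs l. norm u \<le> K * N l u"
begin

section \<open>Identification of the convolution integral\<close>

lemma powr_cancel: "0 < s \<Longrightarrow> s powr \<gamma> * s powr - \<gamma> = 1" for s \<gamma> :: real
  by (simp add: powr_minus)

text \<open>With these exponents \<open>\<rho> + \<eta> + \<beta>' - \<alpha>'\<close> equals
  \<eta>, and the conditions reduce to \<open>0 < \<alpha> < 1\<close>,
  \<open>1 - \<eta> < \<alpha>\<close> and \<open>0 \<le> \<gamma> < \<eta>\<close>.\<close>

lemma admissible:
  assumes c: "ctrl \<gamma> 1 P Q \<phi>" and P: "0 \<le> P" and Q: "0 \<le> Q" and \<gamma>: "0 \<le> \<gamma>" "\<gamma> < \<eta>"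
    and \<phi>: "continuous_into {0<..1} (Xs \<alpha>) (N \<alpha>) \<phi>"
  shows "conv_admissible S Xs N \<eta> 0 1 \<phi> \<alpha> 0 \<alpha> \<gamma>"
proof -
  note bound = ctrl_hdelta[OF c P Q order_refl]
  have "\<phi> \<in> C1_weighted \<gamma> 0 1 (Xs \<alpha>) (N \<alpha>)"
  proof -
    have "(t - 0) powr \<gamma> * N \<alpha> (\<phi> t) \<le> P" if "0 < t" "t \<le> 1" for t
      using mult_left_mono[OF ctrl_n[OF c that], of "t powr \<gamma>"] powr_cancel[OF that(1)]
      by (simp add: mult.left_commute)
    then show ?thesis using \<phi> unfolding C1_weighted_def by (auto intro!: bdd_aboveI[of _ P])
  qed
  moreover have "hdelta S \<phi> \<in> C2_weighted \<alpha> \<gamma> 0 1 (Xs 0) (N 0)"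
  proof -
    have "(s - 0) powr \<gamma> * norm (hdelta S \<phi> s t) * (t - s) powr - \<alpha> \<le> L * (P + Q)"
      if "0 < s" "s < t" "t \<le> 1" for s t
    proof -
      have "s powr \<gamma> * norm (hdelta S \<phi> s t) * (t - s) powr - \<alpha> \<le>
          s powr \<gamma> * (L * (P + Q) * s powr - \<gamma> * (t - s) powr \<alpha>) * (t - s) powr - \<alpha>"
        using bound[of s t] that by (intro mult_right_mono mult_left_mono) auto
      also have "\<dots> = L * (P + Q) * (s powr \<gamma> * s powr - \<gamma>) * ((t - s) powr \<alpha> * (t - s) powr - \<alpha>)"
        by (simp only: mult_ac)
      finally show ?thesis using powr_cancel[of s \<gamma>] powr_cancel[of "t - s" \<alpha>] that by simp
    qed
    moreover have "continuous_on (lopen_simplex2 0 1) (\<lambda>(s, t). hdelta S \<phi> s t)"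
      by (rule hdelta_continuous_on[OF continuous_into_continuous_on[OF \<phi>] bound \<alpha>(1)])
    ultimately show ?thesis
      unfolding C2_weighted_def
      by (auto simp: Xs_zero N_zero continuous_into_norm hdelta_diag intro!: bdd_aboveI[of _ "L * (P + Q)"])
  qed
  ultimately show ?thesis
    using \<alpha> \<eta> \<gamma> by (simp add: conv_admissible_def)
qed

text \<open>Two remainders may belong to different exponents and spaces, but in the ambient space
  both have order above 1 away from 0. Their difference \<open>D\<close> is additive by the common
  defining relation, so \<open>S (t - v) (D u v)\<close> has zero defect and the sewing bound
  annihilates it.\<close>

lemma remainder_unique:
  assumes M: "conv_remainder S Xs N \<eta> x 0 1 \<phi> M" and M': "conv_remainder S Xs N \<eta> x 0 1 \<phi> M'"
    and st: "0 < s" "s \<le> t" "t \<le> 1"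
  shows "M s t = M' s t"
proof -
  have bound: "\<exists>p C. 1 < p \<and> 0 \<le> C \<and> (\<forall>u v. s \<le> u \<and> u \<le> v \<and> v \<le> 1 \<longrightarrow> norm (M u v) \<le> C * (v - u) powr p)"
    if "conv_remainder S Xs N \<eta> x 0 1 \<phi> M" "s < 1" for M
  proof -
    obtain \<alpha>' \<beta>' \<rho> \<gamma>' where a: "conv_admissible S Xs N \<eta> 0 1 \<phi> \<alpha>' \<beta>' \<rho> \<gamma>'"
      and C2: "\<And>\<theta>. 0 < \<theta> \<Longrightarrow> \<theta> < 1 \<Longrightarrow> M \<in> C2 (\<eta> + \<rho>) \<theta> 1 (Xs \<beta>') (N \<beta>')"
      using \<open>conv_remainder S Xs N \<eta> x 0 1 \<phi> M\<close> unfolding conv_remainder_def by auto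
    have ex: "0 \<le> \<beta>'" "\<beta>' < 2" "1 < \<eta> + \<rho>" using a by (auto simp: conv_admissible_def)
    obtain K where K0: "0 \<le> K" and K: "\<And>u. u \<in> Xs \<beta>' \<Longrightarrow> norm u \<le> K * N \<beta>' u"
      using Xs_norm[OF ex(1,2)] by blast
    note C2s = C2[OF st(1) \<open>s < 1\<close>]
    have MX: "M u v \<in> Xs \<beta>'" if "s \<le> u" "u \<le> v" "v \<le> 1" for u v
      using C2s that by (force simp: C2_def continuous_into_def simplex2_def)
    obtain C where C: "\<And>u v. s \<le> u \<Longrightarrow> u < v \<Longrightarrow> v \<le> 1 \<Longrightarrow> N \<beta>' (M u v) * (v - u) powr (- (\<eta> + \<rho>)) \<le> C"
      using C2s unfolding C2_def bdd_above_def by blast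
    have diag: "M u u = 0" if "s \<le> u" "u \<le> 1" for u using C2s that by (auto simp: C2_def)
    have "norm (M u v) \<le> K * \<bar>C\<bar> * (v - u) powr (\<eta> + \<rho>)" if uv: "s \<le> u" "u \<le> v" "v \<le> 1" for u v
    proof (cases "u = v")
      case True
      then show ?thesis using diag uv by simp
    next
      case False
      then have uv': "0 < (v - u) powr (\<eta> + \<rho>)" using uv by simp
      have "N \<beta>' (M u v) * (v - u) powr (- (\<eta> + \<rho>)) \<le> C" using C uv False by auto
      then have le: "N \<beta>' (M u v) \<le> C * (v - u) powr (\<eta> + \<rho>)"
        unfolding powr_minus using uv' by (simp add: field_simps)
      have "norm (M u v) \<le> K * N \<beta>' (M u v)" by (rule K[OF MX[OF uv]])
      also have "\<dots> \<le> K * (\<bar>C\<bar> * (v - u) powr (\<eta> + \<rho>))"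
        using K0 uv' by (intro mult_left_mono order_trans[OF le] mult_right_mono) auto
      finally show ?thesis by simp
    qed
    then show ?thesis using ex K0 by (intro exI[of _ "\<eta> + \<rho>"] exI[of _ "K * \<bar>C\<bar>"]) auto
  qed
  define D where "D = (\<lambda>u v. M u v - M' u v)"
  have chen: "D r t = D s t + S (t - s) (D r s)" if "0 < r" "r \<le> s" "s \<le> t" "t \<le> 1" for r s t
  proof -
    have "M r t - M s t - S (t - s) (M r s) = M' r t - M' s t - S (t - s) (M' r s)"
      using M M' that unfolding conv_remainder_def by auto
    then show ?thesis using that by (simp add: D_def S_diff algebra_simps)
  qed
  have diag: "D u u = 0" if "0 < u" "u \<le> 1" for u
    using chen[of u u u] that by (simp add: S_zero)
  have "D s t = 0"
  proof (cases "s = t")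
    case True
    then show ?thesis using diag st by simp
  next
    case False
    then have s1: "s < 1" using st by simp
    obtain p C where p: "1 < p" "0 \<le> C" and C: "\<And>u v. s \<le> u \<Longrightarrow> u \<le> v \<Longrightarrow> v \<le> 1 \<Longrightarrow> norm (M u v) \<le> C * (v - u) powr p"
      using bound[OF M s1] by blast
    obtain p' C' where p': "1 < p'" "0 \<le> C'" and C': "\<And>u v. s \<le> u \<Longrightarrow> u \<le> v \<Longrightarrow> v \<le> 1 \<Longrightarrow> norm (M' u v) \<le> C' * (v - u) powr p'"
      using bound[OF M' s1] by blast
    define q where "q = min p p'"
    have D: "norm (D u v) \<le> (C + C') * (v - u) powr q" if uv: "s \<le> u" "u \<le> v" "v \<le> 1" for u v
    proof -
      have "norm (D u v) \<le> norm (M u v) + norm (M' u v)" unfolding D_def by (rule norm_triangle_ineq4)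
      also have "\<dots> \<le> C * (v - u) powr p + C' * (v - u) powr p'" using C C' uv by (intro add_mono) auto
      also have "\<dots> \<le> C * (v - u) powr q + C' * (v - u) powr q"
        using p p' uv st by (intro add_mono mult_left_mono powr_mono') (auto simp: q_def)
      finally show ?thesis by (simp add: algebra_simps)
    qed
    have SD: "S (t - v) (D u v) = D u t - D v t" if "s \<le> u" "u \<le> v" "v \<le> t" for u v
      using chen[of u v t] that st by simp
    have "norm (S (t - t) (D s t)) \<le> 0 / (1 - 2 powr (1 - q)) * (t - s) powr q"
    proof (rule sewing_bound[where a = s and b = t and C = "L * (C + C')"
          and R = "\<lambda>u v. S (t - v) (D u v)"])
      show "1 < q" using p p' by (simp add: q_def)
      show "norm (S (t - v) (D u v)) \<le> L * (C + C') * (v - u) powr q" if "s \<le> u" "u \<le> v" "v \<le> t" for u v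
      proof -
        have "norm (S (t - v) (D u v)) \<le> L * norm (D u v)" by (rule S_norm) (use that st in auto)
        also have "\<dots> \<le> L * ((C + C') * (v - u) powr q)" using D[of u v] that st L by (intro mult_left_mono) auto
        finally show ?thesis by (simp add: mult_ac)
      qed
      fix u m v assume "s \<le> u" "v \<le> t" "m - u = v - m" "u \<le> m"
      then show "norm (S (t - v) (D u v) - S (t - m) (D u m) - S (t - v) (D m v)) \<le> 0 * (v - u) powr q"
        using SD[of u v] SD[of u m] SD[of m v] by simp
    qed (use st in auto)
    then show ?thesis by (simp add: S_zero)
  qed
  then show ?thesis by (simp add: D_def)
qed

text \<open>\<open>J\<close> yields an explicit remainder. By uniqueness the one selected by
  \<open>SOME\<close> has the same values, so the open integral is \<open>hdelta S J\<close>, and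
  letting \<open>s\<close> tend to 0 leaves \<open>J t\<close>. Here \<open>x'\<close> is the given
  driver and \<open>x\<close> its extension to the line.\<close>

lemma conv_integral_path:
  assumes c: "ctrl \<gamma> 1 P Q \<phi>" and P: "0 \<le> P" and Q: "0 \<le> Q" and \<gamma>: "0 \<le> \<gamma>" "\<alpha> + \<gamma> < \<eta>"
    and x: "holder_line \<eta> H x" and d: "davie \<gamma> 1 C x \<phi> (hdelta S J)"
    and J: "(J \<longlongrightarrow> 0) (at_right 0)" and J0: "J 0 = 0"
    and \<phi>: "continuous_into {0<..1} (Xs \<alpha>) (N \<alpha>) \<phi>"
    and x': "\<And>t. 0 \<le> t \<Longrightarrow> t \<le> 1 \<Longrightarrow> x' t = x t" and t: "0 \<le> t" "t \<le> 1"
  shows "conv_integral S Xs N \<eta> x' 0 1 \<phi> 0 t = J t"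
proof -
  have \<gamma>': "\<gamma> < \<eta>" using \<gamma> \<alpha> by simp
  note reg = path_regularity[OF c P Q \<gamma> x d J J0]
  define M where "M = (\<lambda>s t. (x' t - x' s) *\<^sub>R S (t - s) (\<phi> s) - hdelta S J s t)"
  have M_bound: "norm (M s t) \<le> \<bar>C\<bar> * s powr - \<gamma> * (t - s) powr (\<eta> + \<alpha>)" if "0 < s" "s \<le> t" "t \<le> 1" for s t
  proof -
    have "norm (M s t) \<le> C * s powr - \<gamma> * (t - s) powr (\<eta> + \<alpha>)"
      using davieD[OF d that] x'[of s] x'[of t] that by (simp add: M_def norm_minus_commute)
    also have "\<dots> \<le> \<bar>C\<bar> * s powr - \<gamma> * (t - s) powr (\<eta> + \<alpha>)" by (intro mult_right_mono) auto
    finally show ?thesis .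
  qed
  have p: "0 < \<eta> + \<alpha>" using \<eta> by simp
  have M_diag: "M s s = 0" for s by (simp add: M_def hdelta_diag)
  have M_cont: "continuous_on (lopen_simplex2 0 1) (\<lambda>(s, t). M s t)"
    unfolding continuous_on_def
  proof
    fix p assume "p \<in> lopen_simplex2 0 1"
    then obtain s t where p: "p = (s, t)" and st: "0 < s" "s \<le> t" "t \<le> 1"
      by (auto simp: lopen_simplex2_def)
    let ?F = "at (s, t) within lopen_simplex2 0 1"
    have "((\<lambda>q. M (fst q) (snd q)) \<longlongrightarrow> M s t) ?F"
    proof (cases "s = t")
      case True
      then show ?thesis using diagonal_tendsto[OF \<open>0 < \<eta> + \<alpha>\<close> st(1) M_bound] by (simp add: M_diag)
    next
      case False
      have ev: "\<forall>\<^sub>F q in ?F. fst q \<in> {0..1}" "\<forall>\<^sub>F q in ?F. snd q \<in> {0..1}"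
        by (auto intro!: eventually_within simp: lopen_simplex2_def)
      have x'c: "continuous_on {0..1} x'"
        using holder_line_continuous_on[OF \<eta>(1) x] x' by (subst continuous_on_cong[OF refl]) auto
      note lims = continuous_on_tendsto_compose[OF x'c simplex_coordinates_tendsto(1) _ ev(1)]
        continuous_on_tendsto_compose[OF x'c simplex_coordinates_tendsto(2) _ ev(2)]
        continuous_on_tendsto_compose[OF reg(2) simplex_coordinates_tendsto(2) _ ev(2)]
      have J_cont: "continuous_on {0<..1} J" by (rule continuous_on_subset[OF reg(2)]) auto
      show ?thesis
        unfolding M_def hdelta_def using False st
        by (intro tendsto_intros lims convolved_tendsto continuous_into_continuous_on[OF \<phi>] J_cont) auto
    qed
    then show "((\<lambda>(s, t). M s t) \<longlongrightarrow> (case p of (s, t) \<Rightarrow> M s t)) (at p within lopen_simplex2 0 1)"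
      by (simp add: p case_prod_unfold)
  qed
  have C2M: "M \<in> C2 (\<eta> + \<alpha>) (0 + \<theta>) 1 (Xs 0) (N 0)" if "0 < \<theta>" for \<theta>
  proof -
    have "continuous_on (simplex2 \<theta> 1) (\<lambda>(s, t). M s t)"
      by (rule continuous_on_subset[OF M_cont]) (use that in \<open>auto simp: simplex2_def lopen_simplex2_def\<close>)
    moreover have "norm (M s t) * (t - s) powr - (\<eta> + \<alpha>) \<le> \<bar>C\<bar> * \<theta> powr - \<gamma>"
      if st: "\<theta> \<le> s" "s < t" "t \<le> 1" for s t
    proof -
      have "norm (M s t) * (t - s) powr - (\<eta> + \<alpha>) \<le>
          \<bar>C\<bar> * s powr - \<gamma> * (t - s) powr (\<eta> + \<alpha>) * (t - s) powr - (\<eta> + \<alpha>)"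
        using M_bound[of s t] st \<open>0 < \<theta>\<close> by (intro mult_right_mono) auto
      also have "\<dots> = \<bar>C\<bar> * s powr - \<gamma>" using powr_cancel[of "t - s" "\<eta> + \<alpha>"] st by simp
      also have "\<dots> \<le> \<bar>C\<bar> * \<theta> powr - \<gamma>" by (rule weight_mono) (use st \<open>0 < \<theta>\<close> \<gamma> in auto)
      finally show ?thesis .
    qed
    ultimately show ?thesis
      unfolding C2_def
      by (auto simp: Xs_zero N_zero continuous_into_norm M_diag intro!: bdd_aboveI[of _ "\<bar>C\<bar> * \<theta> powr - \<gamma>"])
  qed
  have rem: "conv_remainder S Xs N \<eta> x' 0 1 \<phi> M"
    unfolding conv_remainder_def
  proof (intro conjI allI impI)
    have "conv_admissible S Xs N \<eta> 0 1 \<phi> \<alpha> 0 \<alpha> \<gamma>" by (rule admissible[OF c P Q \<gamma>(1) \<gamma>' \<phi>])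
    then show "\<exists>\<alpha>' \<beta>' \<rho> \<gamma>'. conv_admissible S Xs N \<eta> 0 1 \<phi> \<alpha>' \<beta>' \<rho> \<gamma>' \<and>
        (\<forall>\<theta>. 0 < \<theta> \<and> \<theta> < 1 - 0 \<longrightarrow> M \<in> C2 (\<eta> + \<rho>) (0 + \<theta>) 1 (Xs \<beta>') (N \<beta>'))"
      using C2M by blast
    fix r s t :: real assume rst: "0 < r \<and> r \<le> s \<and> s \<le> t \<and> t \<le> 1"
    then have "S (t - s) (S (s - r) u) = S (t - r) u" for u using S_add[of "s - r" "t - s" u] by simp
    then have SM: "S (t - s) (M r s) = (x' s - x' r) *\<^sub>R S (t - r) (\<phi> r) - (S (t - s) (J s) - S (t - r) (J r))"
      and S\<phi>: "S (t - s) (hdelta S \<phi> r s) = S (t - s) (\<phi> s) - S (t - r) (\<phi> r)"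
      using rst by (simp_all add: M_def hdelta_def S_diff S_scaleR)
    show "M r t - M s t - S (t - s) (M r s) = - ((x' t - x' s) *\<^sub>R S (t - s) (hdelta S \<phi> r s))"
      unfolding SM S\<phi> unfolding M_def hdelta_def by (simp add: algebra_simps)
  qed
  have op: "conv_open S Xs N \<eta> x' 0 1 \<phi> s t = hdelta S J s t" if "0 < s" "s \<le> t" "t \<le> 1" for s t
  proof -
    have "conv_remainder S Xs N \<eta> x' 0 1 \<phi> (SOME M. conv_remainder S Xs N \<eta> x' 0 1 \<phi> M)"
      by (rule someI[of "conv_remainder S Xs N \<eta> x' 0 1 \<phi>", OF rem])
    from remainder_unique[OF this rem that] show ?thesis by (simp add: conv_open_def M_def)
  qed
  let ?F = "at (0, t) within lopen_simplex2 0 1"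
  have ev: "\<forall>\<^sub>F q in ?F. fst q \<in> {0..1}" "\<forall>\<^sub>F q in ?F. snd q \<in> {0..1}"
    by (auto intro!: eventually_within simp: lopen_simplex2_def)
  have Js: "((\<lambda>q. J (fst q)) \<longlongrightarrow> 0) ?F"
    using continuous_on_tendsto_compose[OF reg(2) simplex_coordinates_tendsto(1) _ ev(1)] J0 by simp
  \<comment> \<open>For \<open>t = 0\<close> the propagator may be arbitrarily short, so only its
    uniform bound is used, together with \<open>J\<close> tending to 0.\<close>
  have "((\<lambda>q. S (snd q - fst q) (J (fst q))) \<longlongrightarrow> 0) ?F"
  proof (rule Lim_null_comparison)
    show "\<forall>\<^sub>F q in ?F. norm (S (snd q - fst q) (J (fst q))) \<le> L * norm (J (fst q))"
      by (rule eventually_within) (auto simp: lopen_simplex2_def intro!: S_norm)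
    show "((\<lambda>q. L * norm (J (fst q))) \<longlongrightarrow> 0) ?F"
      using tendsto_mult_left[OF tendsto_norm_zero[OF Js], of L] by simp
  qed
  then have lim: "((\<lambda>q. hdelta S J (fst q) (snd q)) \<longlongrightarrow> J t - 0) ?F"
    unfolding hdelta_def
    using continuous_on_tendsto_compose[OF reg(2) simplex_coordinates_tendsto(2) _ ev(2)] t
    by (intro tendsto_diff) auto
  have "((\<lambda>(s', t'). conv_open S Xs N \<eta> x' 0 1 \<phi> s' t') \<longlongrightarrow> J t - 0) ?F"
  proof (rule tendsto_cong[THEN iffD1, OF _ lim])
    show "\<forall>\<^sub>F q in ?F. hdelta S J (fst q) (snd q) = (case q of (s', t') \<Rightarrow> conv_open S Xs N \<eta> x' 0 1 \<phi> s' t')"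
      by (rule eventually_within) (auto simp: lopen_simplex2_def op)
  qed
  from tendsto_Lim[OF lopen_simplex2_limit_point[OF t] this] show ?thesis
    by (simp add: conv_integral_def)
qed

lemma \<sigma>_continuous_into:
  fixes y :: "real \<Rightarrow> 'a"
  assumes y: "continuous_into {0<..1} (Xs \<alpha>) (N \<alpha>) y"
  shows "continuous_into {0<..1} (Xs \<alpha>) (N \<alpha>) (\<lambda>t. \<sigma> (y t))"
  unfolding continuous_into_def
proof (intro conjI ballI)
  have yV: "y t \<in> Xs \<alpha>" if "t \<in> {0<..1}" for t using y that by (auto simp: continuous_into_def)
  then show "(\<lambda>t. \<sigma> (y t)) ` {0<..1} \<subseteq> Xs \<alpha>" using \<sigma>_V by auto
  fix p :: real assume p: "p \<in> {0<..1}"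
  let ?F = "at p within {0<..1}"
  have lim: "((\<lambda>q. N \<alpha> (y q - y p)) \<longlongrightarrow> 0) ?F" using y p by (auto simp: continuous_into_def)
  define R where "R = N \<alpha> (y p) + 1"
  have R: "0 < R" using n_nonneg[OF yV[OF p]] by (simp add: R_def)
  have ev: "\<forall>\<^sub>F q in ?F. N \<alpha> (y q - y p) < 1" using lim by (rule order_tendstoD) simp
  have ev': "\<forall>\<^sub>F q in ?F. q \<in> {0<..1}" by (rule eventually_within)
  show "((\<lambda>q. N \<alpha> (\<sigma> (y q) - \<sigma> (y p))) \<longlongrightarrow> 0) ?F"
  proof (rule n_null_comparison)
    show "\<forall>\<^sub>F q in ?F. \<sigma> (y q) - \<sigma> (y p) \<in> Xs \<alpha> \<and>
        N \<alpha> (\<sigma> (y q) - \<sigma> (y p)) \<le> \<Lambda> * (1 + R) powr \<omega> * N \<alpha> (y q - y p)"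
      using ev ev'
    proof eventually_elim
      case (elim q)
      have "N \<alpha> (y q) \<le> N \<alpha> (y q - y p) + N \<alpha> (y p)"
        using n_triangle[OF V_diff[OF yV[OF elim(2)] yV[OF p]] yV[OF p]] by simp
      then show ?case
        using elim yV p R by (intro conjI V_diff \<sigma>_V \<sigma>_local) (auto simp: R_def)
    qed
    show "((\<lambda>q. \<Lambda> * (1 + R) powr \<omega> * N \<alpha> (y q - y p)) \<longlongrightarrow> 0) ?F"
      using tendsto_mult_left[OF lim, of "\<Lambda> * (1 + R) powr \<omega>"] by simp
  qed
qed

text \<open>The free orbit drops out of \<open>hdelta\<close>, so increments are those of the
  integral part, and \<open>y 0 = \<psi>\<close> makes the latter vanish at 0. The surplus
  \<open>\<eta> - \<gamma> - \<alpha>\<close> is given away to reach Hoelder order \<alpha>.\<close>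

lemma solution_regularity:
  assumes y: "sol \<gamma> 1 x \<psi> y R" and x: "holder_line \<eta> H x" and \<gamma>: "0 \<le> \<gamma>" "\<alpha> + \<gamma> < \<eta>"
  shows "y \<in> Y_space S Xs N \<alpha> \<gamma>"
    and "continuous_into {0<..1} (Xs \<alpha>) (N \<alpha>) y"
proof -
  note R = solD(1)[OF y] and cy = adm_ctrl[OF solD(3)[OF y]]
  define J where "J = (\<lambda>t. y t - S t \<psi>)"
  have J0: "J 0 = 0" using solD(2)[OF y] by (simp add: J_def S_zero)
  have hJ: "hdelta S J s t = hdelta S y s t" if "0 \<le> s" "s \<le> t" for s t
    unfolding J_def using that by (rule hdelta_minus_free)
  have d: "davie \<gamma> 1 R x (\<lambda>t. \<sigma> (y t)) (hdelta S J)"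
    unfolding J_def davie_minus_free by (rule solD(4)[OF y])
  have P: "0 \<le> \<Lambda> * (1 + R)" "0 \<le> B * R" using \<Lambda> B R by auto
  note reg = path_regularity[OF \<sigma>_ctrl[OF solD(3)[OF y] order_refl \<gamma>(1) R] P \<gamma> x d
      solD(5)[OF y, folded J_def] J0]
  obtain E where E: "0 \<le> E" and inc: "\<And>s t. 0 \<le> s \<Longrightarrow> s \<le> t \<Longrightarrow> t \<le> 1 \<Longrightarrow>
      hdelta S y s t \<in> Xs \<alpha> \<and> N \<alpha> (hdelta S y s t) \<le> E * (t - s) powr (\<eta> - \<gamma>)"
    using reg(3) hJ by metis
  show yC: "continuous_into {0<..1} (Xs \<alpha>) (N \<alpha>) y"
    by (rule path_continuous[of "\<eta> - \<gamma>" E]) (use inc E \<gamma> \<alpha> ctrl_V[OF cy] in auto)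
  have "y \<in> C1_weighted \<gamma> 0 1 (Xs \<alpha>) (N \<alpha>)"
  proof -
    have "(t - 0) powr \<gamma> * N \<alpha> (y t) \<le> R" if "0 < t" "t \<le> 1" for t
      using mult_left_mono[OF ctrl_n[OF cy that], of "t powr \<gamma>"] powr_cancel[OF that(1)]
      by (simp add: mult.left_commute)
    then show ?thesis using yC unfolding C1_weighted_def by (auto intro!: bdd_aboveI[of _ R])
  qed
  moreover have "y \<in> C1_weighted 0 0 1 (Xs 0) (N 0)"
    using continuous_into_continuous_on[OF yC] adm_norm[OF solD(3)[OF y]] unfolding C1_weighted_def
    by (auto simp: Xs_zero N_zero continuous_into_norm intro!: bdd_aboveI[of _ R])
  moreover have "hdelta S y \<in> C2 \<alpha> 0 1 (Xs \<alpha>) (N \<alpha>)"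
  proof -
    have "N \<alpha> (hdelta S y s t) * (t - s) powr - \<alpha> \<le> E" if st: "0 \<le> s" "s < t" "t \<le> 1" for s t
    proof -
      have "N \<alpha> (hdelta S y s t) \<le> E * (t - s) powr (\<eta> - \<gamma>)" using inc st by auto
      also have "\<dots> \<le> E * (t - s) powr \<alpha>"
        using E st \<gamma> by (intro mult_left_mono powr_mono') auto
      finally have "N \<alpha> (hdelta S y s t) * (t - s) powr - \<alpha> \<le> E * (t - s) powr \<alpha> * (t - s) powr - \<alpha>"
        by (rule mult_right_mono) simp
      then show ?thesis using powr_cancel[of "t - s" \<alpha>] st by (simp add: mult.assoc)
    qed
    moreover have "continuous_into (simplex2 0 1) (Xs \<alpha>) (N \<alpha>) (\<lambda>(s, t). hdelta S y s t)"
    proof -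
      have *: "(case q of (s, t) \<Rightarrow> hdelta S y s t) = (case q of (s, t) \<Rightarrow> hdelta S J s t)" if "q \<in> simplex2 0 1" for q
        using that hJ by (auto simp: simplex2_def)
      have "((\<lambda>q. N \<alpha> ((case q of (s, t) \<Rightarrow> hdelta S y s t) - (case p of (s, t) \<Rightarrow> hdelta S y s t))) \<longlongrightarrow> 0)
          (at p within simplex2 0 1)" if "p \<in> simplex2 0 1" for p
      proof (rule tendsto_cong[THEN iffD1])
        show "((\<lambda>q. N \<alpha> ((case q of (s, t) \<Rightarrow> hdelta S J s t) - (case p of (s, t) \<Rightarrow> hdelta S J s t))) \<longlongrightarrow> 0)
            (at p within simplex2 0 1)"
          using reg(4) that by (simp add: continuous_into_def)
      qed (rule eventually_within, simp add: * that)
      moreover have "(\<lambda>(s, t). hdelta S y s t) ` simplex2 0 1 \<subseteq> Xs \<alpha>" using inc by (auto simp: simplex2_def)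
      ultimately show ?thesis by (simp add: continuous_into_def)
    qed
    ultimately show ?thesis unfolding C2_def by (auto simp: hdelta_diag intro!: bdd_aboveI[of _ E])
  qed
  ultimately show "y \<in> Y_space S Xs N \<alpha> \<gamma>" by (simp add: Y_space_def)
qed

lemma solution_mild:
  assumes y: "sol \<gamma> 1 x \<psi> y R" and x: "holder_line \<eta> H x" and \<gamma>: "0 \<le> \<gamma>" "\<alpha> + \<gamma> < \<eta>"
    and x': "\<And>t. 0 \<le> t \<Longrightarrow> t \<le> 1 \<Longrightarrow> x' t = x t"
  shows "mild_solution S Xs N \<eta> x' \<sigma> \<psi> y"
proof -
  note R = solD(1)[OF y]
  have comp: "\<sigma> \<circ> y = (\<lambda>t. \<sigma> (y t))" by auto
  have P: "0 \<le> \<Lambda> * (1 + R)" "0 \<le> B * R" using \<Lambda> B R by auto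
  note c = \<sigma>_ctrl[OF solD(3)[OF y] order_refl \<gamma>(1) R]
  note \<sigma>y = \<sigma>_continuous_into[OF solution_regularity(2)[OF y x \<gamma>]]
  have d: "davie \<gamma> 1 R x (\<lambda>t. \<sigma> (y t)) (hdelta S (\<lambda>t. y t - S t \<psi>))"
    unfolding davie_minus_free by (rule solD(4)[OF y])
  have "conv_admissible S Xs N \<eta> 0 1 (\<lambda>t. \<sigma> (y t)) \<alpha> 0 \<alpha> \<gamma>"
    by (rule admissible[OF c P \<gamma>(1) _ \<sigma>y]) (use \<gamma> \<alpha> in simp)
  moreover have "conv_integral S Xs N \<eta> x' 0 1 (\<lambda>t. \<sigma> (y t)) 0 t = y t - S t \<psi>" if "0 \<le> t" "t \<le> 1" for t
    by (rule conv_integral_path[OF c P \<gamma> x d solD(5)[OF y] _ \<sigma>y x' that])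
      (use solD(2)[OF y] in \<open>simp_all add: S_zero\<close>)
  ultimately show ?thesis
    unfolding mild_solution_def conv_well_defined_def comp by auto
qed

text \<open>The space bounds \<open>hdelta\<close>, the estimates use plain increments. The two
  differ by \<open>S (t - s) (z s) - z s\<close>, where \<open>S_id\<close> turns the weighted scale
  bound of \<open>z s\<close> into the missing Hoelder bound.\<close>

lemma Y_space_adm:
  assumes z: "z \<in> Y_space S Xs N \<alpha> \<gamma>" and \<gamma>: "0 \<le> \<gamma>"
  shows "\<exists>R\<ge>0. adm \<gamma> 1 R z" and "continuous_into {0<..1} (Xs \<alpha>) (N \<alpha>) z"
proof -
  show zC: "continuous_into {0<..1} (Xs \<alpha>) (N \<alpha>) z"
    using z by (simp add: Y_space_def C1_weighted_def)
  have zV: "z t \<in> Xs \<alpha>" if "0 < t" "t \<le> 1" for t using zC that by (auto simp: continuous_into_def)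
  have bdd: "bdd_above {(t - 0) powr \<gamma> * N \<alpha> (z t) | t. 0 < t \<and> t \<le> 1}"
    "bdd_above {(t - 0) powr 0 * N 0 (z t) | t. 0 < t \<and> t \<le> 1}"
    "bdd_above {N \<alpha> (hdelta S z s t) * (t - s) powr - \<alpha> | s t. 0 \<le> s \<and> s < t \<and> t \<le> 1}"
    subgoal using z unfolding Y_space_def C1_weighted_def by (elim CollectE conjE)
    subgoal using z unfolding Y_space_def C1_weighted_def by (elim CollectE conjE)
    subgoal using z unfolding Y_space_def C2_def by (elim CollectE conjE)
    done
  obtain a where a: "\<And>t. 0 < t \<Longrightarrow> t \<le> 1 \<Longrightarrow> (t - 0) powr \<gamma> * N \<alpha> (z t) \<le> a"
    using bdd(1) unfolding bdd_above_def by blast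
  obtain b where b: "\<And>t. 0 < t \<Longrightarrow> t \<le> 1 \<Longrightarrow> (t - 0) powr 0 * N 0 (z t) \<le> b"
    using bdd(2) unfolding bdd_above_def by blast
  obtain c where c: "\<And>s t. 0 \<le> s \<Longrightarrow> s < t \<Longrightarrow> t \<le> 1 \<Longrightarrow> N \<alpha> (hdelta S z s t) * (t - s) powr - \<alpha> \<le> c"
    using bdd(3) unfolding bdd_above_def by blast
  have hV: "hdelta S z s t \<in> Xs \<alpha>" if "0 \<le> s" "s \<le> t" "t \<le> 1" for s t
    using z that by (force simp: Y_space_def C2_def continuous_into_def simplex2_def)
  have na: "N \<alpha> (z t) \<le> \<bar>a\<bar> * t powr - \<gamma>" if "0 < t" "t \<le> 1" for t
  proof -
    have "t powr - \<gamma> * (t powr \<gamma> * N \<alpha> (z t)) \<le> t powr - \<gamma> * \<bar>a\<bar>"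
      using a[OF that] by (intro mult_left_mono) auto
    then show ?thesis using powr_cancel[OF that(1), of \<gamma>] by (simp add: mult.assoc[symmetric] mult.commute)
  qed
  have nc: "N \<alpha> (hdelta S z s t) \<le> \<bar>c\<bar> * (t - s) powr \<alpha>" if "0 \<le> s" "s \<le> t" "t \<le> 1" for s t
  proof (cases "s = t")
    case True
    then show ?thesis by (simp add: hdelta_diag n_zero)
  next
    case False
    then have "N \<alpha> (hdelta S z s t) * (t - s) powr - \<alpha> * (t - s) powr \<alpha> \<le> \<bar>c\<bar> * (t - s) powr \<alpha>"
      using c[of s t] that by (intro mult_right_mono) auto
    moreover have "(t - s) powr - \<alpha> * (t - s) powr \<alpha> = 1"
      using powr_cancel[of "t - s" \<alpha>] False that by (simp add: mult.commute)
    ultimately show ?thesis by (simp only: mult.assoc mult_1_right)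
  qed
  define R where "R = \<bar>a\<bar> + \<bar>b\<bar> + L * \<bar>c\<bar> + L * \<bar>a\<bar>"
  have R: "\<bar>a\<bar> \<le> R" "\<bar>b\<bar> \<le> R" "L * \<bar>c\<bar> + L * \<bar>a\<bar> \<le> R" "0 \<le> R" using L by (auto simp: R_def)
  have "adm \<gamma> 1 R z"
    unfolding adm_def ctrl_def
  proof (intro conjI allI impI)
    fix t :: real assume "0 < t \<and> t \<le> 1"
    then have t: "0 < t" "t \<le> 1" by auto
    show "z t \<in> Xs \<alpha>" by (rule zV[OF t])
    show "N \<alpha> (z t) \<le> R * t powr - \<gamma>"
      by (rule order_trans[OF na[OF t] mult_right_mono[OF R(1)]]) simp
    show "norm (z t) \<le> R" using b[OF t] R(2) t by (simp add: N_zero)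
  next
    fix s t :: real assume "0 < s \<and> s \<le> t \<and> t \<le> 1"
    then have st: "0 < s" "s \<le> t" "t \<le> 1" by auto
    have s1: "1 \<le> s powr - \<gamma>" using st \<gamma> by (intro weight_ge_1) auto
    have "norm (z t - z s) \<le> norm (hdelta S z s t) + norm (S (t - s) (z s) - z s)"
      using norm_triangle_ineq[of "hdelta S z s t" "S (t - s) (z s) - z s"] by (simp add: hdelta_def)
    also have "\<dots> \<le> L * (\<bar>c\<bar> * (t - s) powr \<alpha>) + L * (t - s) powr \<alpha> * (\<bar>a\<bar> * s powr - \<gamma>)"
    proof (rule add_mono)
      have "norm (hdelta S z s t) \<le> L * N \<alpha> (hdelta S z s t)" by (rule V_norm[OF hV]) (use st in auto)
      also have "\<dots> \<le> L * (\<bar>c\<bar> * (t - s) powr \<alpha>)" using nc[of s t] st L by (intro mult_left_mono) auto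
      finally show "norm (hdelta S z s t) \<le> L * (\<bar>c\<bar> * (t - s) powr \<alpha>)" .
      have "norm (S (t - s) (z s) - z s) \<le> L * (t - s) powr \<alpha> * N \<alpha> (z s)"
        by (rule S_id) (use st zV in auto)
      also have "\<dots> \<le> L * (t - s) powr \<alpha> * (\<bar>a\<bar> * s powr - \<gamma>)"
        using na[of s] st L by (intro mult_left_mono) auto
      finally show "norm (S (t - s) (z s) - z s) \<le> L * (t - s) powr \<alpha> * (\<bar>a\<bar> * s powr - \<gamma>)" .
    qed
    also have "\<dots> \<le> L * (\<bar>c\<bar> * (t - s) powr \<alpha>) * s powr - \<gamma> + L * (t - s) powr \<alpha> * (\<bar>a\<bar> * s powr - \<gamma>)"
      using L mult_left_mono[OF s1, of "L * (\<bar>c\<bar> * (t - s) powr \<alpha>)"] by (intro add_right_mono) auto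
    also have "\<dots> = (L * \<bar>c\<bar> + L * \<bar>a\<bar>) * s powr - \<gamma> * (t - s) powr \<alpha>" by (simp add: algebra_simps)
    also have "\<dots> \<le> R * s powr - \<gamma> * (t - s) powr \<alpha>" using R by (intro mult_right_mono) auto
    finally show "norm (z t - z s) \<le> R * s powr - \<gamma> * (t - s) powr \<alpha>" .
  qed
  then show "\<exists>R\<ge>0. adm \<gamma> 1 R z" using R by blast
qed

text \<open>The notion of mild solution gives no rate for the remainder in the exponents used here.
  Membership in the space controls \<open>\<sigma> \<circ> z\<close>, so an integral path
  \<open>J\<close> with the right rate exists, and \<open>conv_integral_path\<close> identifies it
  with the integral in the equation.\<close>

lemma mild_solution_sol:
  assumes m: "mild_solution S Xs N \<eta> x' \<sigma> \<psi> z" and z: "z \<in> Y_space S Xs N \<alpha> \<gamma>"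
    and x: "holder_line \<eta> H x" and \<gamma>: "0 \<le> \<gamma>" "\<alpha> + \<gamma> < \<eta>"
    and x': "\<And>t. 0 \<le> t \<Longrightarrow> t \<le> 1 \<Longrightarrow> x' t = x t"
  shows "\<exists>R. sol \<gamma> 1 x \<psi> z R"
proof -
  have \<gamma>': "\<gamma> < \<eta>" using \<gamma> \<alpha> by simp
  obtain R where R: "0 \<le> R" and a: "adm \<gamma> 1 R z" using Y_space_adm(1)[OF z \<gamma>(1)] by blast
  have comp: "\<sigma> \<circ> z = (\<lambda>t. \<sigma> (z t))" by auto
  define P where "P = \<Lambda> * (1 + R)"
  define Q where "Q = B * R"
  have PQ: "0 \<le> P" "0 \<le> Q" using \<Lambda> B R by (auto simp: P_def Q_def)
  have c: "ctrl \<gamma> 1 P Q (\<lambda>t. \<sigma> (z t))"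
    unfolding P_def Q_def by (rule \<sigma>_ctrl[OF a order_refl \<gamma>(1) R])
  note \<sigma>z = \<sigma>_continuous_into[OF Y_space_adm(2)[OF z \<gamma>(1)]]
  obtain J where J: "J 0 = 0" "davie \<gamma> 1 (sewing_const * (P + Q)) x (\<lambda>t. \<sigma> (z t)) (hdelta S J)" "(J \<longlongrightarrow> 0) (at_right 0)"
    using path_exists[OF c PQ _ order_refl \<gamma>(1) \<gamma>' x] by auto
  have zJ: "z t = S t \<psi> + J t" if "0 \<le> t" "t \<le> 1" for t
    using m conv_integral_path[OF c PQ \<gamma> x J(2,3,1) \<sigma>z x' that] that
    unfolding mild_solution_def comp by auto
  have hz: "hdelta S z s t = hdelta S J s t" if "0 \<le> s" "s \<le> t" "t \<le> 1" for s t
    using that zJ[of s] zJ[of t] S_add[of s "t - s" \<psi>] by (simp add: hdelta_def S_plus)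
  define R' where "R' = R + sewing_const * (P + Q)"
  have R': "R \<le> R'" "sewing_const * (P + Q) \<le> R'" "0 \<le> R'" using R sewing_const PQ by (auto simp: R'_def)
  have "davie \<gamma> 1 (sewing_const * (P + Q)) x (\<lambda>t. \<sigma> (z t)) (hdelta S z)"
    using J(2) hz by (auto simp: davie_def)
  then have "davie \<gamma> 1 R' x (\<lambda>t. \<sigma> (z t)) (hdelta S z)"
    by (rule davie_weaken) (use R' in auto)
  moreover have "adm \<gamma> 1 R' z" by (rule adm_mono[OF a R'(1)]) simp
  moreover have "((\<lambda>t. z t - S t \<psi>) \<longlongrightarrow> 0) (at_right 0)"
  proof (rule tendsto_cong[THEN iffD1, OF _ J(3)])
    show "\<forall>\<^sub>F t in at_right 0. J t = z t - S t \<psi>"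
      unfolding eventually_at_right_field using zJ by (intro exI[of _ 1]) auto
  qed
  moreover have "z 0 = \<psi>" using zJ[of 0] J(1) by (simp add: S_zero)
  ultimately show ?thesis using R' by (auto simp: sol_def)
qed

end

subsection \<open>Verification of the hypotheses\<close>

lemma unit_interval_mean_value:
  fixes h :: "real \<Rightarrow> 'a::real_normed_vector"
  assumes "\<And>r. (h has_vector_derivative h' r) (at r)"
    and "\<And>r. 0 \<le> r \<Longrightarrow> r \<le> 1 \<Longrightarrow> norm (h' r) \<le> M"
  shows "norm (h 1 - h 0) \<le> M"
proof -
  have "norm (h 1 - h 0) \<le> M * 1 - M * 0"
  proof (rule differentiable_bound_general[of 0 1 h "\<lambda>r. M * r" h' "\<lambda>_. M"])
    show "continuous_on {0..1} h"
      using assms(1) by (intro continuous_at_imp_continuous_on ballI has_vector_derivative_continuous)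
  qed (use assms in \<open>auto intro!: continuous_intros derivative_eq_intros\<close>)
  then show ?thesis by simp
qed

lemma gateaux_along_line:
  assumes "has_gateaux_derivative \<sigma> \<sigma>'"
  shows "((\<lambda>r. \<sigma> (v + r *\<^sub>R h)) has_vector_derivative blinfun_apply (\<sigma>' (v + r *\<^sub>R h)) h) (at r)"
proof -
  have "((\<lambda>q. \<sigma> ((v + r *\<^sub>R h) + q *\<^sub>R h)) has_vector_derivative blinfun_apply (\<sigma>' (v + r *\<^sub>R h)) h) (at (r - r))"
    using assms by (simp add: has_gateaux_derivative_def)
  moreover have "((\<lambda>q. q - r) has_real_derivative 1) (at r)"
    by (auto intro!: derivative_eq_intros)
  ultimately have "((\<lambda>q. \<sigma> ((v + r *\<^sub>R h) + q *\<^sub>R h)) \<circ> (\<lambda>q. q - r) has_vector_derivative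
      1 *\<^sub>R blinfun_apply (\<sigma>' (v + r *\<^sub>R h)) h) (at r)"
    by (intro vector_diff_chain_at) (simp_all add: has_real_derivative_iff_has_vector_derivative)
  then show ?thesis by (simp add: o_def algebra_simps)
qed

lemma gateaux_imp_lipschitz:
  assumes "has_gateaux_derivative \<sigma> \<sigma>'" and B: "\<And>u. norm (\<sigma>' u) \<le> B"
  shows "norm (\<sigma> u - \<sigma> v) \<le> B * norm (u - v)"
proof -
  have "norm (\<sigma> (v + 1 *\<^sub>R (u - v)) - \<sigma> (v + 0 *\<^sub>R (u - v))) \<le> B * norm (u - v)"
  proof (rule unit_interval_mean_value[OF gateaux_along_line[OF assms(1)]])
    fix r
    show "norm (blinfun_apply (\<sigma>' (v + r *\<^sub>R (u - v))) (u - v)) \<le> B * norm (u - v)"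
      by (rule order_trans[OF norm_blinfun mult_right_mono[OF B]]) simp
  qed
  then show ?thesis by simp
qed

text \<open>Run through the segments from \<open>b\<close> to \<open>a\<close> and from
  \<open>d\<close> to \<open>c\<close> with one parameter. The derivative of the difference splits
  into \<open>\<sigma>'\<close> applied to the difference of directions and a difference of
  \<open>\<sigma>'\<close> at two points, which stay in the ball by convexity.\<close>

lemma gateaux_four_point:
  assumes g: "has_gateaux_derivative \<sigma> \<sigma>'" and B: "\<And>u. norm (\<sigma>' u) \<le> B"
    and K: "K-lipschitz_on {z. norm z \<le> R} \<sigma>'"
    and R: "norm a \<le> R" "norm b \<le> R" "norm c \<le> R" "norm d \<le> R"
  shows "norm ((\<sigma> a - \<sigma> b) - (\<sigma> c - \<sigma> d)) \<le>
    B * norm ((a - b) - (c - d)) + K * (norm (a - c) + norm (b - d)) * norm (c - d)"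
proof -
  have K0: "0 \<le> K" using K by (rule lipschitz_on_nonneg)
  let ?p = "\<lambda>r. b + r *\<^sub>R (a - b)" and ?q = "\<lambda>r. d + r *\<^sub>R (c - d)"
  have "norm ((\<sigma> (?p 1) - \<sigma> (?q 1)) - (\<sigma> (?p 0) - \<sigma> (?q 0))) \<le>
    B * norm ((a - b) - (c - d)) + K * (norm (a - c) + norm (b - d)) * norm (c - d)"
  proof (rule unit_interval_mean_value[OF has_vector_derivative_diff[OF gateaux_along_line[OF g] gateaux_along_line[OF g]]])
    fix r :: real assume r: "0 \<le> r" "r \<le> 1"
    have seg: "norm (v + r *\<^sub>R (u - v)) \<le> R" if "norm u \<le> R" "norm v \<le> R" for u v :: 'a
    proof -
      have "v + r *\<^sub>R (u - v) = (1 - r) *\<^sub>R v + r *\<^sub>R u" by (simp add: algebra_simps)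
      also have "norm \<dots> \<le> (1 - r) * norm v + r * norm u"
        using r by (intro norm_triangle_le) auto
      also have "\<dots> \<le> (1 - r) * R + r * R" using r that by (intro add_mono mult_left_mono) auto
      finally show ?thesis by (simp add: algebra_simps)
    qed
    have pq: "norm (?p r - ?q r) \<le> norm (a - c) + norm (b - d)"
    proof -
      have "?p r - ?q r = (1 - r) *\<^sub>R (b - d) + r *\<^sub>R (a - c)" by (simp add: algebra_simps)
      also have "norm \<dots> \<le> (1 - r) * norm (b - d) + r * norm (a - c)"
        using r by (intro norm_triangle_le) auto
      also have "\<dots> \<le> 1 * norm (b - d) + 1 * norm (a - c)"
        using r by (intro add_mono mult_right_mono) auto
      finally show ?thesis by simp
    qed
    have "blinfun_apply (\<sigma>' (?p r)) (a - b) - blinfun_apply (\<sigma>' (?q r)) (c - d) =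
        blinfun_apply (\<sigma>' (?p r)) ((a - b) - (c - d)) + blinfun_apply (\<sigma>' (?p r) - \<sigma>' (?q r)) (c - d)"
      by (simp add: blinfun.diff_left blinfun.diff_right)
    also have "norm \<dots> \<le> norm (\<sigma>' (?p r)) * norm ((a - b) - (c - d)) + norm (\<sigma>' (?p r) - \<sigma>' (?q r)) * norm (c - d)"
      by (intro norm_triangle_le add_mono norm_blinfun)
    also have "\<dots> \<le> B * norm ((a - b) - (c - d)) + (K * (norm (a - c) + norm (b - d))) * norm (c - d)"
    proof (intro add_mono mult_right_mono B)
      have "norm (\<sigma>' (?p r) - \<sigma>' (?q r)) \<le> K * norm (?p r - ?q r)"
        using lipschitz_onD[OF K, of "?p r" "?q r"] seg R by (simp add: dist_norm)
      also have "\<dots> \<le> K * (norm (a - c) + norm (b - d))" using pq K0 by (rule mult_left_mono)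
      finally show "norm (\<sigma>' (?p r) - \<sigma>' (?q r)) \<le> K * (norm (a - c) + norm (b - d))" .
    qed auto
    finally show "norm (blinfun_apply (\<sigma>' (?p r)) (a - b) - blinfun_apply (\<sigma>' (?q r)) (c - d)) \<le>
      B * norm ((a - b) - (c - d)) + K * (norm (a - c) + norm (b - d)) * norm (c - d)" .
  qed
  then show ?thesis by (simp add: algebra_simps)
qed

text \<open>Clamping the time to the unit interval is 1-Lipschitz, so extending \<open>x\<close> by
  its end values preserves the Hoelder bound.\<close>

lemma holder_real_extension:
  assumes "x \<in> holder_real \<eta> 0 1" "0 \<le> \<eta>"
  obtains x' H where "0 \<le> H" "holder_line \<eta> H x'" "\<And>t. 0 \<le> t \<Longrightarrow> t \<le> 1 \<Longrightarrow> x t = x' t"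
proof -
  obtain C where C: "\<And>s t. s \<in> {0..1} \<Longrightarrow> t \<in> {0..1} \<Longrightarrow> \<bar>x t - x s\<bar> \<le> C * \<bar>t - s\<bar> powr \<eta>"
    using assms(1) unfolding holder_real_def by blast
  define k where "k = (\<lambda>t::real. max 0 (min 1 t))"
  have k: "k t \<in> {0..1}" "\<bar>k t - k s\<bar> \<le> \<bar>t - s\<bar>" for s t
    by (auto simp: k_def max_def min_def)
  have "holder_line \<eta> \<bar>C\<bar> (\<lambda>t. x (k t))"
    unfolding holder_line_def
  proof (intro allI)
    fix s t
    have "\<bar>x (k t) - x (k s)\<bar> \<le> C * \<bar>k t - k s\<bar> powr \<eta>" by (rule C[OF k(1) k(1)])
    also have "\<dots> \<le> \<bar>C\<bar> * \<bar>t - s\<bar> powr \<eta>"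
      using k(2) assms(2) by (intro mult_mono powr_mono2) auto
    finally show "\<bar>x (k t) - x (k s)\<bar> \<le> \<bar>C\<bar> * \<bar>t - s\<bar> powr \<eta>" .
  qed
  moreover have "x t = x (k t)" if "0 \<le> t" "t \<le> 1" for t using that by (simp add: k_def)
  ultimately show ?thesis using that[of "\<bar>C\<bar>" "\<lambda>t. x (k t)"] by simp
qed

text \<open>All operator bounds up to time 1 merge into one constant. The scale estimates speak of
  positive times, so \<open>t = 0\<close> is treated through \<open>S_zero\<close>, which is where
  \<open>1 \<le> L\<close> helps.\<close>

lemma semigroup_scale_smoothing:
  assumes "semigroup_scale D A S Xs N" and \<alpha>: "0 < \<alpha>" "\<alpha> < 1" and \<eta>: "0 < \<eta>" "\<eta> < 1" "1 < \<eta> + \<alpha>" and H: "0 \<le> H"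
  shows "\<exists>L. smoothing S (Xs \<alpha>) (N \<alpha>) \<alpha> L \<eta> H"
proof -
  interpret semigroup_scale D A S Xs N by fact
  note X0 = X_zero
  obtain L1 where L1: "L1 > 0" "\<And>t u. 0 < t \<Longrightarrow> t \<le> 1 \<Longrightarrow> norm (S t u) \<le> L1 * t powr (- 0 + 0) * norm u"
    using S_smoothing[of 1 0 0] X0 by auto
  obtain L2 where L2: "L2 > 0" "\<And>t u. 0 < t \<Longrightarrow> t \<le> 1 \<Longrightarrow> u \<in> Xs \<alpha> \<Longrightarrow>
      S t u \<in> Xs \<alpha> \<and> N \<alpha> (S t u) \<le> L2 * t powr (- \<alpha> + \<alpha>) * N \<alpha> u"
    using S_smoothing[of 1 \<alpha> \<alpha>] \<alpha> by (metis less_imp_le less_trans one_less_numeral_iff semiring_norm(76) zero_less_one order_refl)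
  obtain L3 where L3: "L3 > 0" "\<And>t u. 0 < t \<Longrightarrow> t \<le> 1 \<Longrightarrow>
      S t u \<in> Xs \<alpha> \<and> N \<alpha> (S t u) \<le> L3 * t powr (- \<alpha> + 0) * norm u"
    using S_smoothing[of 1 0 \<alpha>] \<alpha> X0 by auto
  obtain L4 where L4: "L4 > 0" "\<And>t u. 0 < t \<Longrightarrow> t \<le> 1 \<Longrightarrow> u \<in> Xs \<alpha> \<Longrightarrow>
      norm (S t u - u) \<le> L4 * t powr (\<alpha> - 0) * N \<alpha> u"
    using S_minus_id[of 1 0 \<alpha>] \<alpha> X0 by auto
  obtain L5 where L5: "\<And>u. u \<in> Xs \<alpha> \<Longrightarrow> norm u \<le> L5 * N \<alpha> u"
    using embedding[of 0 \<alpha>] \<alpha> X0 by auto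
  have V: "banach_subspace (Xs \<alpha>) (N \<alpha>)" using banach[of \<alpha>] \<alpha> by simp
  have N0: "0 \<le> N \<alpha> u" if "u \<in> Xs \<alpha>" for u
    using V that unfolding banach_subspace_def by (elim conjE) blast
  define L where "L = 1 + L1 + L2 + L3 + L4 + \<bar>L5\<bar>"
  have L: "1 \<le> L" "L1 \<le> L" "L2 \<le> L" "L3 \<le> L" "L4 \<le> L" "L5 \<le> L"
    using L1(1) L2(1) L3(1) L4(1) by (auto simp: L_def)
  have one: "a \<le> L * a" if "0 \<le> a" for a using mult_right_mono[OF L(1) that] by simp
  have "smoothing S (Xs \<alpha>) (N \<alpha>) \<alpha> L \<eta> H"
  proof (rule smoothing.intro)
    show "norm u \<le> L * N \<alpha> u" if "u \<in> Xs \<alpha>" for u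
      by (rule order_trans[OF L5[OF that] mult_right_mono[OF L(6) N0[OF that]]])
    show "norm (S t u) \<le> L * norm u" if "0 \<le> t" "t \<le> 1" for t u
    proof (cases "t = 0")
      case True
      then show ?thesis using one[of "norm u"] by (simp add: S_zero)
    next
      case False
      then show ?thesis
        using L1(2)[of t u] mult_right_mono[OF L(2), of "norm u"] that by simp
    qed
    show "S t u \<in> Xs \<alpha>" if "0 \<le> t" "t \<le> 1" "u \<in> Xs \<alpha>" for t u
      using L2(2)[of t u] that by (cases "t = 0") (auto simp: S_zero)
    show "N \<alpha> (S t u) \<le> L * N \<alpha> u" if "0 \<le> t" "t \<le> 1" "u \<in> Xs \<alpha>" for t u
    proof (cases "t = 0")
      case True
      then show ?thesis using one[OF N0[OF that(3)]] by (simp add: S_zero)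
    next
      case False
      then show ?thesis
        using L2(2)[of t u] mult_right_mono[OF L(3) N0[OF that(3)]] that by simp
    qed
    show "S t u \<in> Xs \<alpha>" if "0 < t" "t \<le> 1" for t u using L3(2)[OF that] by simp
    show "N \<alpha> (S t u) \<le> L * t powr - \<alpha> * norm u" if "0 < t" "t \<le> 1" for t u
    proof -
      have "N \<alpha> (S t u) \<le> L3 * (t powr - \<alpha> * norm u)" using L3(2)[OF that, of u] by (simp add: mult.assoc)
      also have "\<dots> \<le> L * (t powr - \<alpha> * norm u)" by (rule mult_right_mono[OF L(4)]) simp
      finally show ?thesis by (simp add: mult.assoc)
    qed
    show "norm (S t u - u) \<le> L * t powr \<alpha> * N \<alpha> u" if "0 \<le> t" "t \<le> 1" "u \<in> Xs \<alpha>" for t u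
    proof (cases "t = 0")
      case True
      then show ?thesis by (simp add: S_zero)
    next
      case False
      then have "norm (S t u - u) \<le> L4 * (t powr \<alpha> * N \<alpha> u)" using L4(2)[of t u] that by (simp add: mult.assoc)
      also have "\<dots> \<le> L * (t powr \<alpha> * N \<alpha> u)" by (rule mult_right_mono[OF L(5)]) (simp add: N0[OF that(3)])
      finally show ?thesis by (simp add: mult.assoc)
    qed
  qed (use S_bounded_linear S_zero S_add V L \<alpha> \<eta> H in auto)
  then show ?thesis by blast
qed

theorem theorem3p11:
  fixes D :: "'a::banach set"
    and A :: "'a \<Rightarrow> 'a"
    and S :: "real \<Rightarrow> 'a \<Rightarrow> 'a"
    and Xs :: "real \<Rightarrow> 'a set"
    and N :: "real \<Rightarrow> 'a \<Rightarrow> real"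
    and x :: "real \<Rightarrow> real"
    and \<sigma> :: "'a \<Rightarrow> 'a"
    and \<sigma>' :: "'a \<Rightarrow> 'a \<Rightarrow>\<^sub>L 'a"
    and \<psi> :: 'a
    and \<eta> \<alpha> \<theta> \<omega> L\<sigma> Lip\<sigma> :: real
  assumes setting: "semigroup_scale D A S Xs N"
    and eta: "1/2 < \<eta>" "\<eta> < 1"
    and x: "x \<in> holder_real \<eta> 0 1"
    and gateaux: "has_gateaux_derivative \<sigma> \<sigma>'"
    and gateaux_bounded: "bounded (range \<sigma>')"
    and gateaux_lipschitz: "\<And>R. R > 0 \<Longrightarrow> \<exists>K. K-lipschitz_on {z. norm z \<le> R} \<sigma>'"
    and alpha: "0 < \<alpha>" "\<alpha> < 1" "\<eta> + \<alpha> > 1"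
    and invariant: "\<And>u. u \<in> Xs \<alpha> \<Longrightarrow> \<sigma> u \<in> Xs \<alpha>"
    and constants: "L\<sigma> > 0" "Lip\<sigma> > 0" "\<omega> > 0"
    and lipschitz: "\<And>R u v. R > 0 \<Longrightarrow> u \<in> Xs \<alpha> \<Longrightarrow> v \<in> Xs \<alpha> \<Longrightarrow> N \<alpha> u \<le> R \<Longrightarrow> N \<alpha> v \<le> R \<Longrightarrow>
      N \<alpha> (\<sigma> u - \<sigma> v) \<le> Lip\<sigma> * (1 + R) powr \<omega> * N \<alpha> (u - v)"
    and growth: "\<And>u. u \<in> Xs \<alpha> \<Longrightarrow> N \<alpha> (\<sigma> u) \<le> L\<sigma> * (1 + N \<alpha> u)"
    and theta: "0 \<le> \<theta>" "\<theta> \<le> \<alpha>" "\<eta> > \<alpha> + (1 + \<omega>) * (\<alpha> - \<theta>)"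
    and psi: "\<psi> \<in> Xs \<theta>"
  shows "\<exists>y. (mild_solution S Xs N \<eta> x \<sigma> \<psi> y \<and> y \<in> Y_space S Xs N \<alpha> (\<alpha> - \<theta>)) \<and>
           (\<forall>z. mild_solution S Xs N \<eta> x \<sigma> \<psi> z \<and> z \<in> Y_space S Xs N \<alpha> (\<alpha> - \<theta>) \<longrightarrow>
                (\<forall>t\<in>{0..1}. z t = y t))"
proof -
  interpret scale: semigroup_scale D A S Xs N by (rule setting)
  have eta0: "0 < \<eta>" using eta by simp
  obtain x' H where H_nonneg: "0 \<le> H" and x'_holder: "holder_line \<eta> H x'" and xx': "\<And>t. 0 \<le> t \<Longrightarrow> t \<le> 1 \<Longrightarrow> x t = x' t"
    using holder_real_extension[OF x] eta0 by (metis less_imp_le)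
  obtain L where "smoothing S (Xs \<alpha>) (N \<alpha>) \<alpha> L \<eta> H"
    using semigroup_scale_smoothing[OF setting alpha(1,2) eta0 eta(2) alpha(3) H_nonneg] by blast
  then interpret smoothing S "Xs \<alpha>" "N \<alpha>" \<alpha> L \<eta> H .
  obtain B where B: "\<And>u. norm (\<sigma>' u) \<le> B"
    using gateaux_bounded by (auto simp: bounded_iff)
  have B0: "0 \<le> B" using B[of 0] norm_ge_zero order_trans by blast
  define \<Lambda> where "\<Lambda> = max L\<sigma> Lip\<sigma>"
  interpret scaled_problem S Xs N \<alpha> L \<eta> H \<sigma> \<omega> \<Lambda> B
  proof
    show "N \<alpha> (\<sigma> u) \<le> \<Lambda> * (1 + N \<alpha> u)" if "u \<in> Xs \<alpha>" for u
      using order_trans[OF growth[OF that] mult_right_mono[of L\<sigma> \<Lambda>]] n_nonneg[OF that] by (simp add: \<Lambda>_def)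
    show "N \<alpha> (\<sigma> u - \<sigma> v) \<le> \<Lambda> * (1 + R) powr \<omega> * N \<alpha> (u - v)"
      if "0 < R" "u \<in> Xs \<alpha>" "v \<in> Xs \<alpha>" "N \<alpha> u \<le> R" "N \<alpha> v \<le> R" for R u v
    proof -
      have "0 \<le> (1 + R) powr \<omega> * N \<alpha> (u - v)" using n_nonneg_diff[OF that(2,3)] by simp
      then have "Lip\<sigma> * ((1 + R) powr \<omega> * N \<alpha> (u - v)) \<le> \<Lambda> * ((1 + R) powr \<omega> * N \<alpha> (u - v))"
        by (intro mult_right_mono) (simp_all add: \<Lambda>_def)
      then show ?thesis using lipschitz[OF that] by (simp add: mult.assoc)
    qed
    show "norm (\<sigma> u - \<sigma> v) \<le> B * norm (u - v)" for u v by (rule gateaux_imp_lipschitz[OF gateaux B])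
    show "\<exists>K\<ge>0. \<forall>a b c d. norm a \<le> R \<longrightarrow> norm b \<le> R \<longrightarrow> norm c \<le> R \<longrightarrow> norm d \<le> R \<longrightarrow>
      norm ((\<sigma> a - \<sigma> b) - (\<sigma> c - \<sigma> d)) \<le>
        B * norm ((a - b) - (c - d)) + K * (norm (a - c) + norm (b - d)) * norm (c - d)" if "0 < R" for R
    proof -
      obtain K where K: "K-lipschitz_on {z. norm z \<le> R} \<sigma>'" using gateaux_lipschitz[OF \<open>0 < R\<close>] by blast
      show ?thesis
        using lipschitz_on_nonneg[OF K] gateaux_four_point[OF gateaux B K] by blast
    qed
    show "N 0 = norm" using scale.X_zero(2) by auto
    show "\<exists>K\<ge>0. \<forall>u\<in>Xs l. norm u \<le> K * N l u" if l: "0 \<le> l" "l < 2" for l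
    proof (cases "l = 0")
      case True
      then show ?thesis using scale.X_zero by (intro exI[of _ 1]) auto
    next
      case False
      obtain K where K: "\<And>u. u \<in> Xs l \<Longrightarrow> norm u \<le> K * N l u"
        using scale.embedding[of 0 l] scale.X_zero False l by auto
      have "0 \<le> N l u" if "u \<in> Xs l" for u
        using scale.banach[OF l] that unfolding banach_subspace_def by (elim conjE) blast
      then have "norm u \<le> \<bar>K\<bar> * N l u" if "u \<in> Xs l" for u
        using order_trans[OF K[OF that] mult_right_mono[of K "\<bar>K\<bar>"]] that by simp
      then show ?thesis by (intro exI[of _ "\<bar>K\<bar>"]) auto
    qed
  qed (use constants B0 invariant scale.X_zero in \<open>auto simp: \<Lambda>_def\<close>)
  define \<gamma> where "\<gamma> = \<alpha> - \<theta>"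
  have \<gamma>: "0 \<le> \<gamma>" "\<alpha> + (1 + \<omega>) * \<gamma> < \<eta>" using theta by (auto simp: \<gamma>_def)
  note gap = exponent_gap[OF \<gamma>]
  \<comment> \<open>Smoothing from \<open>Xs \<theta>\<close> to \<open>Xs \<alpha>\<close> has
    exponent \<open>- \<alpha> + \<theta>\<close>, that is \<open>- \<gamma>\<close>; this includes
    \<open>\<theta> = \<alpha>\<close>, where the orbit is not singular.\<close>
  have "\<exists>R. init \<gamma> R \<psi>"
  proof -
    obtain K where K: "K > 0" "\<And>t. 0 < t \<Longrightarrow> t \<le> 1 \<Longrightarrow> N \<alpha> (S t \<psi>) \<le> K * t powr (- \<alpha> + \<theta>) * N \<theta> \<psi>"
      using scale.S_smoothing[of 1 \<theta> \<alpha>] theta alpha psi by auto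
    have N0: "0 \<le> N \<theta> \<psi>"
      using scale.banach[of \<theta>] theta alpha psi unfolding banach_subspace_def by auto
    define R where "R = K * N \<theta> \<psi> + L * norm \<psi>"
    have R: "K * N \<theta> \<psi> \<le> R" "L * norm \<psi> \<le> R" "0 \<le> R" using K N0 L by (auto simp: R_def)
    have "N \<alpha> (S t \<psi>) \<le> R * t powr - \<gamma> \<and> norm (S t \<psi>) \<le> R" if t: "0 < t" "t \<le> 1" for t
    proof
      have "N \<alpha> (S t \<psi>) \<le> (K * N \<theta> \<psi>) * t powr - \<gamma>" using K(2)[OF t] by (simp add: \<gamma>_def mult_ac)
      also have "\<dots> \<le> R * t powr - \<gamma>" using R(1) by (rule mult_right_mono) simp
      finally show "N \<alpha> (S t \<psi>) \<le> R * t powr - \<gamma>" .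
      show "norm (S t \<psi>) \<le> R" using S_norm[of t \<psi>] t R(2) by simp
    qed
    then show ?thesis using R(3) by (auto simp: init_def)
  qed
  then obtain R0 where "init \<gamma> R0 \<psi>" ..
  from global_existence[OF \<gamma> x'_holder this] obtain y R where y: "sol \<gamma> 1 x' \<psi> y R" by blast
  have "z t = y t" if z: "mild_solution S Xs N \<eta> x \<sigma> \<psi> z" "z \<in> Y_space S Xs N \<alpha> \<gamma>" and t: "t \<in> {0..1}" for z t
  proof -
    obtain R' where "sol \<gamma> 1 x' \<psi> z R'" using mild_solution_sol[OF z x'_holder \<gamma>(1) gap xx'] by blast
    then show ?thesis
      by (rule solution_unique[OF _ y x'_holder _ order_refl \<gamma>]) (use t in auto)
  qed
  moreover have "mild_solution S Xs N \<eta> x \<sigma> \<psi> y" by (rule solution_mild[OF y x'_holder \<gamma>(1) gap xx'])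
  moreover have "y \<in> Y_space S Xs N \<alpha> \<gamma>" by (rule solution_regularity(1)[OF y x'_holder \<gamma>(1) gap])
  ultimately show ?thesis unfolding \<gamma>_def by blast
qed

end
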